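(* Let $T$ be an $n$-linear non-degenerate Calderón–Zygmund operator on $\mathbb{R}^d$, let $1\le i\le n$ and $1\le k_i<\infty$ be integers, let $b\in L^{k_i}_{\mathrm{loc}}$, and let $$C_b^{k_i}(T):=[b,\cdots,[b,[b,T]_i]_i\cdots]_i\qquad(k_i\text{ times})$$ be the iterated commutator in the $i$-th slot. Let $1<p_1,\dots,p_n<\infty$ and $\frac1p=\sum_{j=1}^n\frac1{p_j}$. Assume that $$(w_1,\dots,w_n),\ (w_1,\dots,w_{i-1},\lambda_i,w_{i+1},\dots,w_n)\in A_{\vec p}$$ with $\nu_i^{\frac1{k_i}}:=w_i^{\frac1{k_ip_i}}\lambda_i^{-\frac1{k_ip_i}}\in A_\infty$. Then $$\|b\|_{\mathrm{BMO}_{\nu_i^{1/k_i}}}^{k_i}\lesssim\Big\|C_b^{k_i}(T):L^{p_1}(w_1)\times\cdots\times L^{p_n}(w_n)\to L^p\Big(\lambda_i^{\frac p{p_i}}\prod_{j\ne i}w_j^{\frac p{p_j}}\Big)\Big\|.$$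
   Context: Notation: $A\lesssim B$ means $A\le CB$ for a constant $C$ that may depend on the dimension, the Lebesgue exponents, the weight constants and on other constants appearing in the assumptions (such as those of $T$, $n$, $k_i$), but not on $b$. $p'$ denotes the conjugate exponent of $p$, $Q$ denotes cubes in $\mathbb{R}^d$, $f_Q=\frac1{|Q|}\int_Qf$, and $w(Q)=\int_Qw$. $L^q(w)$ is the space with (quasi-)norm $(\int|f|^qw)^{1/q}$. The norm $\|S:X_1\times\cdots\times X_n\to Y\|$ of an $n$-linear operator is the least $C$ with $\|S(f_1,\dots,f_n)\|_Y\le C\prod_j\|f_j\|_{X_j}$. Commutators: for an $n$-linear operator $T$ and a locally integrable function $b$, $[b,T]_i(f_1,\dots,f_n)=bT(f_1,\dots,f_n)-T(f_1,\dots,bf_i,\dots,f_n)$, $1\le i\le n$. Non-degenerate Calderón–Zygmund operators: let $\Delta=\{(x,y_1,\dots,y_n)\in(\mathbb{R}^d)^{n+1}:x=y_1=\cdots=y_n\}$. An $n$-linear operator $T$ is a non-degenerate $n$-linear Calderón–Zygmund operator if there is a function $K:(\mathbb{R}^d)^{n+1}\setminus\Delta\to\mathbb{C}$ such that, with $y=(y_1,\dots,y_n)$, (i) $|K(x,y)|\le\frac{C}{(\sum_{i=1}^n|x-y_i|)^{nd}}$; (ii) $|K(x+h,y)-K(x,y)|+\sum_{i=1}^n|K(x,\dots,y_i+h,\dots)-K(x,y)|\le\frac{C}{(\sum_{i=1}^n|x-y_i|)^{nd}}\,\omega\big(\frac{|h|}{\sum_{i=1}^n|x-y_i|}\big)$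 whenever $|h|\le\frac12\max_i|x-y_i|$, where $\omega$ is an increasing subadditive function with $\omega(t)\to0$ as $t\to0$; (iii) for all $f_1,\dots,f_n\in C_c^\infty(\mathbb{R}^d)$, $T(f_1,\dots,f_n)(x)=\int_{\mathbb{R}^{nd}}K(x,y_1,\dots,y_n)\prod_{i=1}^nf_i(y_i)\,dy$ for $x\notin\bigcap_{i=1}^n\operatorname{spt}f_i$; (iv) for every $y\in\mathbb{R}^d$ and $r>0$ there exists $x\notin B(y,r)$ with $|K(x,y,\dots,y)|\gtrsim\frac1{r^{nd}}$ (implied constant independent of $y$ and $r$). Weights: a weight is a positive locally integrable function. $w\in A_\infty$ if $[w]_{A_\infty}:=\sup_Q\frac1{w(Q)}\int_QM(w\chi_Q)<\infty$, $M$ being the Hardy–Littlewood maximal operator. $\vec w=(w_1,\dots,w_n)\in A_{\vec p}$, $\vec p=(p_1,\dots,p_n)$, if $$[\vec w]_{A_{\vec p}}:=\sup_Q\Big(\frac1{|Q|}\int_Q\prod_{i=1}^nw_i^{\frac p{p_i}}\Big)\prod_{i=1}^n\Big(\frac1{|Q|}\int_Qw_i^{1-p_i'}\Big)^{\frac p{p_i'}}<\infty.$$ Weighted BMO: for $\nu\in A_\infty$, $\|b\|_{\mathrm{BMO}_\nu}:=\sup_Q\frac1{\nu(Q)}\int_Q|b-b_Q|$, and $b\in\mathrm{BMO}_\nu$ if this is finite.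
   Formalization: Since (iii) fixes T only on smooth functions while the commutator applies T to b^m f_i, it is also assumed that T acts on integrable functions of bounded support and that, off the supports, its values there are a.e. limits of T on smooth functions converging in L^1. *)

theory Defs
  imports "HOL-Analysis.Analysis"
begin

text \<open>
  Conventions. \<open>\<real>\<^sup>d\<close> is a type \<open>'a::euclidean_space\<close> with \<open>d = DIM('a)\<close>. The slots of an
  \<open>n\<close>-linear operator are the elements of a finite type \<open>'n\<close> with \<open>n = CARD('n)\<close>; tuples are
  functions on \<open>'n\<close>, so that \<open>f(i := g)\<close> replaces the \<open>i\<close>-th entry. Functions, kernels and the
  symbol \<open>b\<close> are complex valued; functions are identified almost everywhere. All quantities that
  may be infinite (averages, weight constants, BMO and operator norms) are of type \<open>ennreal\<close>.
\<close>

section \<open>Weights\<close>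

text \<open>Powers \<open>x\<^sup>a\<close> of extended nonnegative reals; only used for \<open>a > 0\<close>.\<close>

definition epowr :: "ennreal \<Rightarrow> real \<Rightarrow> ennreal" where
  "epowr x a = (if x = \<infinity> then \<infinity> else ennreal (enn2real x powr a))"

definition cubes :: "'a::euclidean_space set set" where
  "cubes = {cbox (c - r *\<^sub>R (\<Sum>e\<in>Basis. e)) (c + r *\<^sub>R (\<Sum>e\<in>Basis. e)) | c r. 0 < r}"

definition avg :: "'a::euclidean_space set \<Rightarrow> ('a \<Rightarrow> ennreal) \<Rightarrow> ennreal" where
  "avg Q g = (\<integral>\<^sup>+x\<in>Q. g x \<partial>lebesgue) / emeasure lebesgue Q"

definition weight :: "('a::euclidean_space \<Rightarrow> real) \<Rightarrow> bool" where
  "weight w \<longleftrightarrow> (\<forall>x. 0 < w x) \<and> (\<forall>S. compact S \<longrightarrow> set_integrable lebesgue S w)"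

definition weight_mass :: "('a::euclidean_space \<Rightarrow> real) \<Rightarrow> 'a set \<Rightarrow> ennreal" where
  "weight_mass w Q = (\<integral>\<^sup>+x\<in>Q. ennreal (w x) \<partial>lebesgue)"

definition HL_maximal :: "('a::euclidean_space \<Rightarrow> real) \<Rightarrow> 'a \<Rightarrow> ennreal" where
  "HL_maximal f x = (SUP Q\<in>{Q\<in>cubes. x \<in> Q}. avg Q (\<lambda>y. ennreal \<bar>f y\<bar>))"

definition Ainf_const :: "('a::euclidean_space \<Rightarrow> real) \<Rightarrow> ennreal" where
  "Ainf_const w = (SUP Q\<in>cubes.
     (\<integral>\<^sup>+x\<in>Q. HL_maximal (\<lambda>y. w y * indicator Q y) x \<partial>lebesgue) / weight_mass w Q)"

definition in_Ainf :: "('a::euclidean_space \<Rightarrow> real) \<Rightarrow> bool" where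
  "in_Ainf w \<longleftrightarrow> weight w \<and> Ainf_const w < \<infinity>"

definition conj_exp :: "real \<Rightarrow> real" where
  "conj_exp q = q / (q - 1)"

definition total_exp :: "('n::finite \<Rightarrow> real) \<Rightarrow> real" where
  "total_exp p = 1 / (\<Sum>j\<in>UNIV. 1 / p j)"

definition Ap_const ::
  "('n::finite \<Rightarrow> real) \<Rightarrow> ('n \<Rightarrow> 'a::euclidean_space \<Rightarrow> real) \<Rightarrow> ennreal" where
  "Ap_const p w = (SUP Q\<in>cubes.
     avg Q (\<lambda>x. ennreal (\<Prod>j\<in>UNIV. w j x powr (total_exp p / p j))) *
     (\<Prod>j\<in>UNIV. epowr (avg Q (\<lambda>x. ennreal (w j x powr (1 - conj_exp (p j)))))
                     (total_exp p / conj_exp (p j))))"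

definition in_Ap ::
  "('n::finite \<Rightarrow> real) \<Rightarrow> ('n \<Rightarrow> 'a::euclidean_space \<Rightarrow> real) \<Rightarrow> bool" where
  "in_Ap p w \<longleftrightarrow> (\<forall>j. weight (w j)) \<and> Ap_const p w < \<infinity>"

section \<open>Function spaces\<close>

definition Lp_norm ::
  "real \<Rightarrow> ('a::euclidean_space \<Rightarrow> real) \<Rightarrow> ('a \<Rightarrow> complex) \<Rightarrow> ennreal" where
  "Lp_norm q w f = epowr (\<integral>\<^sup>+x. ennreal (norm (f x) powr q * w x) \<partial>lebesgue) (1 / q)"

definition locally_Lp :: "nat \<Rightarrow> ('a::euclidean_space \<Rightarrow> complex) \<Rightarrow> bool" where
  "locally_Lp k b \<longleftrightarrow> b \<in> borel_measurable lebesgue \<and>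
     (\<forall>S. compact S \<longrightarrow> set_integrable lebesgue S (\<lambda>x. norm (b x) ^ k))"

definition mean :: "'a::euclidean_space set \<Rightarrow> ('a \<Rightarrow> complex) \<Rightarrow> complex" where
  "mean Q b = set_lebesgue_integral lebesgue Q b / of_real (measure lebesgue Q)"

definition BMO_norm ::
  "('a::euclidean_space \<Rightarrow> real) \<Rightarrow> ('a \<Rightarrow> complex) \<Rightarrow> ennreal" where
  "BMO_norm \<nu> b = (SUP Q\<in>cubes.
     (\<integral>\<^sup>+x\<in>Q. ennreal (norm (b x - mean Q b)) \<partial>lebesgue) / weight_mass \<nu> Q)"

definition spt :: "('a::euclidean_space \<Rightarrow> complex) \<Rightarrow> 'a set" where
  "spt f = closure {x. f x \<noteq> 0}"

primrec C_k :: "nat \<Rightarrow> ('a::euclidean_space \<Rightarrow> complex) \<Rightarrow> bool" where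
  "C_k 0 f \<longleftrightarrow> continuous_on UNIV f"
| "C_k (Suc m) f \<longleftrightarrow> (\<forall>x. f differentiable at x) \<and>
     (\<forall>v. C_k m (\<lambda>x. frechet_derivative f (at x) v))"

definition Cc_inf :: "('a::euclidean_space \<Rightarrow> complex) set" where
  "Cc_inf = {f. (\<forall>m. C_k m f) \<and> compact (spt f)}"

definition L1_c :: "('a::euclidean_space \<Rightarrow> complex) set" where
  "L1_c = {f. integrable lebesgue f \<and> bounded {x. f x \<noteq> 0}}"

section \<open>Multilinear operators and Calderon--Zygmund kernels\<close>

type_synonym ('n, 'a) operator = "('n \<Rightarrow> 'a \<Rightarrow> complex) \<Rightarrow> 'a \<Rightarrow> complex"

text \<open>
  Only the values on tuples of integrable functions of bounded support are meaningful. This is the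
  class that commutators with a rough \<open>b\<close> need: for bounded \<open>g\<close> of compact support and
  \<open>b \<in> L\<^sup>k\<^sub>l\<^sub>o\<^sub>c\<close>, one only knows that \<open>b\<^sup>k g\<close> belongs to \<open>L1_c\<close>.
\<close>

definition multilinear_operator :: "('n::finite, 'a::euclidean_space) operator \<Rightarrow> bool" where
  "multilinear_operator T \<longleftrightarrow>
     (\<forall>f. (\<forall>j. f j \<in> L1_c) \<longrightarrow> T f \<in> borel_measurable lebesgue) \<and>
     (\<forall>f g. (\<forall>j. f j \<in> L1_c \<and> g j \<in> L1_c \<and> (AE x in lebesgue. f j x = g j x)) \<longrightarrow>
        (AE x in lebesgue. T f x = T g x)) \<and>
     (\<forall>f j g c. (\<forall>l. f l \<in> L1_c) \<and> g \<in> L1_c \<longrightarrow>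
        (AE x in lebesgue. T (f(j := \<lambda>y. c * f j y + g y)) x = c * T f x + T (f(j := g)) x))"

text \<open>
  Condition (iii) of a Calderon--Zygmund operator prescribes \<open>T\<close> on smooth functions only, whereas a
  commutator applies it to \<open>b\<^sup>m f\<^sub>i\<close>. The next predicate says that, off the supports, the values of
  \<open>T\<close> on \<open>L1_c\<close> are obtained from those on smooth functions by approximation in \<open>L\<^sup>1\<close> (the limit of
  the approximations exists by the kernel bounds). Without such a link the values \<open>T(\<dots>, b\<^sup>m f\<^sub>i, \<dots>)\<close> would be
  unrelated to the kernel.
\<close>

definition off_support_extension :: "('n::finite, 'a::euclidean_space) operator \<Rightarrow> bool" where
  "off_support_extension T \<longleftrightarrow>
     (\<forall>f \<phi> S. (\<forall>j. f j \<in> L1_c) \<and> (\<forall>j. compact (S j)) \<and>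
        (\<forall>m j. \<phi> m j \<in> Cc_inf \<and> spt (\<phi> m j) \<subseteq> S j) \<and>
        (\<forall>j. (\<lambda>m::nat. \<integral>x. norm (\<phi> m j x - f j x) \<partial>lebesgue) \<longlonglongrightarrow> 0) \<longrightarrow>
        (AE x in lebesgue. x \<notin> (\<Inter>j. S j) \<longrightarrow> (\<lambda>m. T (\<phi> m) x) \<longlonglongrightarrow> T f x))"

definition modulus :: "(real \<Rightarrow> real) \<Rightarrow> bool" where
  "modulus \<omega> \<longleftrightarrow> mono_on {0..} \<omega> \<and> (\<forall>s\<ge>0. \<forall>t\<ge>0. \<omega> (s + t) \<le> \<omega> s + \<omega> t) \<and>
     (\<omega> \<longlongrightarrow> 0) (at_right 0)"

text \<open>A kernel is a total function, but its values on the diagonal \<open>x = y\<^sub>1 = \<dots> = y\<^sub>n\<close> play no role.\<close>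

definition off_diag :: "'a \<Rightarrow> ('n \<Rightarrow> 'a) \<Rightarrow> bool" where
  "off_diag x y \<longleftrightarrow> \<not> (\<forall>j. y j = x)"

definition kernel_dist :: "'a::euclidean_space \<Rightarrow> ('n::finite \<Rightarrow> 'a) \<Rightarrow> real" where
  "kernel_dist x y = (\<Sum>j\<in>UNIV. norm (x - y j))"

definition kernel_size ::
  "real \<Rightarrow> ('a::euclidean_space \<Rightarrow> ('n::finite \<Rightarrow> 'a) \<Rightarrow> complex) \<Rightarrow> bool" where
  "kernel_size C K \<longleftrightarrow> (\<forall>x y. off_diag x y \<longrightarrow>
     norm (K x y) \<le> C / kernel_dist x y ^ (CARD('n) * DIM('a)))"

definition kernel_regular ::
  "real \<Rightarrow> (real \<Rightarrow> real) \<Rightarrow> ('a::euclidean_space \<Rightarrow> ('n::finite \<Rightarrow> 'a) \<Rightarrow> complex) \<Rightarrow> bool" where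
  "kernel_regular C \<omega> K \<longleftrightarrow> (\<forall>x y h. off_diag x y \<and>
     norm h \<le> 1 / 2 * Max (range (\<lambda>j. norm (x - y j))) \<longrightarrow>
     norm (K (x + h) y - K x y) + (\<Sum>j\<in>UNIV. norm (K x (y(j := y j + h)) - K x y))
       \<le> C / kernel_dist x y ^ (CARD('n) * DIM('a)) * \<omega> (norm h / kernel_dist x y))"

text \<open>\<open>\<real>\<^sup>n\<^sup>d\<close> is the space of tuples with the product measure.\<close>

definition kernel_represents ::
  "('a::euclidean_space \<Rightarrow> ('n::finite \<Rightarrow> 'a) \<Rightarrow> complex) \<Rightarrow> ('n, 'a) operator \<Rightarrow> bool" where
  "kernel_represents K T \<longleftrightarrow> (\<forall>f. (\<forall>j. f j \<in> Cc_inf) \<longrightarrow>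
     (AE x in lebesgue. x \<notin> (\<Inter>j. spt (f j)) \<longrightarrow>
        T f x = (\<integral>y. K x y * (\<Prod>j\<in>UNIV. f j (y j)) \<partial>(\<Pi>\<^sub>M j\<in>UNIV. lborel))))"

definition kernel_nondegenerate ::
  "real \<Rightarrow> ('a::euclidean_space \<Rightarrow> ('n::finite \<Rightarrow> 'a) \<Rightarrow> complex) \<Rightarrow> bool" where
  "kernel_nondegenerate c K \<longleftrightarrow> (\<forall>y r. 0 < r \<longrightarrow>
     (\<exists>x. x \<notin> ball y r \<and> norm (K x (\<lambda>_. y)) \<ge> c / r ^ (CARD('n) * DIM('a))))"

text \<open>
  The parameters record the constants on which implied constants may depend: \<open>C\<close> from the size and
  regularity conditions, the modulus \<open>\<omega>\<close>, and the lower bound \<open>c\<close> from non-degeneracy.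
\<close>

definition nondegenerate_CZO ::
  "real \<Rightarrow> (real \<Rightarrow> real) \<Rightarrow> real \<Rightarrow> ('n::finite, 'a::euclidean_space) operator \<Rightarrow> bool" where
  "nondegenerate_CZO C \<omega> c T \<longleftrightarrow> multilinear_operator T \<and> modulus \<omega> \<and> 0 < c \<and>
     (\<exists>K. kernel_size C K \<and> kernel_regular C \<omega> K \<and> kernel_represents K T \<and>
          kernel_nondegenerate c K)"

section \<open>Commutators and operator norms\<close>

definition commutator ::
  "'n \<Rightarrow> ('a \<Rightarrow> complex) \<Rightarrow> ('n, 'a) operator \<Rightarrow> ('n, 'a) operator" where
  "commutator i b T = (\<lambda>f x. b x * T f x - T (f(i := \<lambda>y. b y * f i y)) x)"

definition iterated_commutator ::
  "'n \<Rightarrow> nat \<Rightarrow> ('a \<Rightarrow> complex) \<Rightarrow> ('n, 'a) operator \<Rightarrow> ('n, 'a) operator" where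
  "iterated_commutator i k b T = (commutator i b ^^ k) T"

text \<open>
  The tuples at which \<open>T\<close> is evaluated in \<open>iterated_commutator i k b T f\<close> have \<open>i\<close>-th entry
  \<open>b\<^sup>m f\<^sub>i\<close> with \<open>m \<le> k\<close>.
\<close>

definition commutator_domain ::
  "'n \<Rightarrow> nat \<Rightarrow> ('a::euclidean_space \<Rightarrow> complex) \<Rightarrow> ('n \<Rightarrow> 'a \<Rightarrow> complex) set" where
  "commutator_domain i k b =
     {f. (\<forall>j. f j \<in> L1_c) \<and> (\<forall>m\<le>k. (\<lambda>x. b x ^ m * f i x) \<in> L1_c)}"

text \<open>
  The norm of \<open>S : L\<^sup>p\<^sup>1(w\<^sub>1) \<times> \<dots> \<times> L\<^sup>p\<^sup>n(w\<^sub>n) \<rightarrow> L\<^sup>q(v)\<close> for an operator \<open>S\<close> with domain \<open>D\<close>, namely the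
  least admissible \<open>C\<close>; it is infinite if there is no finite one.
\<close>

definition operator_norm ::
  "('n \<Rightarrow> 'a \<Rightarrow> complex) set \<Rightarrow> ('n::finite \<Rightarrow> real) \<Rightarrow> ('n \<Rightarrow> 'a::euclidean_space \<Rightarrow> real) \<Rightarrow>
     real \<Rightarrow> ('a \<Rightarrow> real) \<Rightarrow> ('n, 'a) operator \<Rightarrow> ennreal" where
  "operator_norm D p w q v S =
     Inf {C. \<forall>f\<in>D. (\<forall>j. Lp_norm (p j) (w j) (f j) < \<infinity>) \<longrightarrow>
                Lp_norm q v (S f) \<le> C * (\<Prod>j\<in>UNIV. Lp_norm (p j) (w j) (f j))}"

end

theory Submission
  imports Defs
begin

text \<open>
  The constant may depend on everything but the operator and the functions, so every cube \<open>Q\<close> can be treated on its own. Let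
  \<open>N\<close> be larger than the operator norm of the commutator.

  Non-degeneracy at the centre of \<open>Q\<close> and a large multiple of its side
  gives a disjoint companion cube \<open>F\<close> of the same size, at a comparable distance, such that the
  kernel differs from a constant \<open>\<kappa>\<close> by at most \<open>\<bar>\<kappa>\<bar> / 4\<close> for \<open>x\<close> in \<open>F\<close> and all \<open>y\<^sub>j\<close> in \<open>Q\<close>
  (\<open>kernel_almost_constant\<close>). For functions \<open>f\<^sub>j\<close> on \<open>Q\<close> the commutator at \<open>x\<close> in \<open>F\<close> is therefore close to
  \<open>\<kappa>\<close> times the product of the integrals of the \<open>f\<^sub>j\<close>, \<open>j \<noteq> i\<close>, and the integral of \<open>(b x - b)\<^sup>k f\<^sub>i\<close>
  (\<open>commutator_off_support_estimate\<close>). The kernel formula is given for smooth functions only; integrable functions on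
  a cube are limits in \<open>L\<^sup>1\<close> of smooth functions supported in the same cube (\<open>L1_smooth_sequence\<close>), and
  \<open>off_support_extension\<close> carries the values of \<open>T\<close> over.

  Off a small part of a cube containing \<open>Q\<close> and \<open>F\<close>, all weights are
  constants up to bounded factors (\<open>weights_almost_constant\<close>). Testing with functions on the good part \<open>E\<close> of \<open>Q\<close>
  makes these constants cancel, except for the quotient that is comparable to \<open>\<nu>\<^sup>k\<close>.

  As \<open>b\<close> is complex valued, \<open>(b x - b y)\<^sup>k\<close> has no sign. But finitely many multipliers
  \<open>\<psi>\<close>, their number depending on \<open>k\<close> only, suffice to detect the mean of \<open>\<bar>z - b\<bar>\<^sup>k\<close> over \<open>E\<close> by an integral of
  \<open>\<psi> (z - b)\<^sup>k\<close> for all complex \<open>z\<close> at once (\<open>norming_family\<close>). One of them works for all \<open>b x\<close> with \<open>x\<close> in a fixed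
  proportion of \<open>F\<close>. So there is a number \<open>\<alpha>\<close> such that \<open>\<bar>b - \<alpha>\<bar>\<close> is at most a multiple of \<open>N\<^bsup>1/k\<^esup>\<close> times the
  average of \<open>\<nu>\<close> over \<open>Q\<close>, off a set of small proportion in \<open>Q\<close> (\<open>local_oscillation\<close>).

  This holds on every cube. Iterated stopping times then bound \<open>\<bar>b - \<alpha>\<bar>\<close>
  on \<open>Q\<close> by a sum of averages of \<open>\<nu>\<close> over a sparse family of subcubes, and the integral of that sum is at most a
  multiple of the integral of the maximal function of \<open>\<nu>\<close> restricted to \<open>Q\<close>
  (\<open>sparse_oscillation_bound\<close>). The constant of \<open>\<nu>\<close> compares the latter with \<open>\<nu>(Q)\<close>.
\<close>

section \<open>Smooth functions are dense in \<open>L\<^sup>1\<close> of a cube\<close>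

text \<open>
  The function \<open>exp (- 1 / t)\<close> on the positive half line, with a polynomial in
  \<open>1 / t\<close> as a factor: the polynomial makes the family closed under
  differentiation, so that smoothness needs a single derivative.
\<close>

definition bump :: "real poly \<Rightarrow> real \<Rightarrow> real" where
  "bump P t = (if t > 0 then poly P (1 / t) * exp (- (1 / t)) else 0)"

text \<open>
  This limit is what makes every member of the family differentiable at the origin.
\<close>

lemma poly_exp_decay: "((\<lambda>t. poly P (1 / t) * exp (- (1 / t))) \<longlongrightarrow> 0) (at_right (0::real))"
proof -
  have "((\<lambda>s. \<Sum>j\<le>degree P. coeff P j * (s ^ j / exp s)) \<longlongrightarrow> (\<Sum>j\<le>degree P. coeff P j * 0)) (at_top :: real filter)"
    by (intro tendsto_intros tendsto_power_div_exp_0)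
  then have "((\<lambda>s. poly P s * exp (- s)) \<longlongrightarrow> 0) (at_top :: real filter)"
    by (simp add: poly_altdef sum_distrib_right exp_minus divide_inverse mult.assoc)
  from filterlim_compose[OF this filterlim_inverse_at_top_right]
  show ?thesis by (simp add: inverse_eq_divide)
qed

lemma bump_has_derivative:
  "(bump P has_real_derivative bump ([:0, 0, 1:] * (P - pderiv P)) t) (at t)"
proof -
  consider "t > 0" | "t < 0" | "t = 0" by linarith
  then show ?thesis
  proof cases
    case 1
    have "((\<lambda>t. poly P (1 / t) * exp (- (1 / t))) has_real_derivative
            poly ([:0, 0, 1:] * (P - pderiv P)) (1 / t) * exp (- (1 / t))) (at t)"
      using 1 by (auto intro!: derivative_eq_intros simp: field_simps power2_eq_square)
    moreover have "bump P s = poly P (1 / s) * exp (- (1 / s))" if "s \<in> {0<..}" for s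
      using that by (simp add: bump_def)
    ultimately show ?thesis
      using 1 by (subst DERIV_cong_ev[OF refl _ refl, where g = "\<lambda>t. poly P (1 / t) * exp (- (1 / t))"])
        (auto simp: bump_def eventually_nhds intro!: exI[of _ "{0<..}"])
  next
    case 2
    have "((\<lambda>t. 0) has_real_derivative 0) (at t)" by simp
    then show ?thesis
      using 2 by (subst DERIV_cong_ev[OF refl _ refl, where g = "\<lambda>t. 0"])
        (auto simp: bump_def eventually_nhds intro!: exI[of _ "{..<0}"])
  next
    case 3
    have r: "((\<lambda>h. (bump P (0 + h) - bump P 0) / h) \<longlongrightarrow> 0) (at_right 0)"
    proof (rule Lim_transform_eventually)
      show "((\<lambda>t. poly ([:0, 1:] * P) (1 / t) * exp (- (1 / t))) \<longlongrightarrow> 0) (at_right (0::real))"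
        by (rule poly_exp_decay)
      show "\<forall>\<^sub>F h in at_right 0. poly ([:0, 1:] * P) (1 / h) * exp (- (1 / h)) = (bump P (0 + h) - bump P 0) / h"
        by (auto simp: eventually_at_filter bump_def)
    qed
    have l: "((\<lambda>h. (bump P (0 + h) - bump P 0) / h) \<longlongrightarrow> 0) (at_left 0)"
      by (rule Lim_transform_eventually[OF tendsto_const]) (auto simp: eventually_at_filter bump_def)
    have "((\<lambda>h. (bump P (0 + h) - bump P 0) / h) \<longlongrightarrow> 0) (at 0)"
      using l r by (simp add: filterlim_split_at)
    then show ?thesis using 3 by (simp add: DERIV_def bump_def)
  qed
qed

lemma C_k_Suc_imp: "C_k (Suc m) f \<Longrightarrow> C_k m f"
proof (induction m arbitrary: f)
  case 0
  then show ?case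
    by (auto intro!: differentiable_imp_continuous_on simp: differentiable_on_def intro: differentiable_at_withinI)
qed simp

text \<open>
  \<open>C_k\<close> speaks of \<open>frechet_derivative\<close>; in proofs a derivative is
  given by an explicit formula.
\<close>

lemma C_k_SucI:
  assumes "\<And>x. (f has_derivative f' x) (at x)" and "\<And>v. C_k m (\<lambda>x. f' x v)"
  shows "C_k (Suc m) f"
proof -
  have "frechet_derivative f (at x) = f' x" for x
    using assms(1)[of x] frechet_derivative_at by metis
  then show ?thesis using assms by (auto simp: differentiable_def)
qed

lemma C_k_SucD:
  assumes "C_k (Suc m) f"
  shows "(f has_derivative frechet_derivative f (at x)) (at x)" "C_k m (\<lambda>x. frechet_derivative f (at x) v)"
  using assms by (auto simp: frechet_derivative_works)

lemma C_k_const: "C_k m (\<lambda>x. c)"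
proof (induction m arbitrary: c)
  case (Suc m) then show ?case by (intro C_k_SucI[where f' = "\<lambda>x v. 0"]) auto
qed simp

lemma C_k_add: "C_k m f \<Longrightarrow> C_k m g \<Longrightarrow> C_k m (\<lambda>x. f x + g x)"
proof (induction m arbitrary: f g)
  case (Suc m)
  show ?case
  proof (rule C_k_SucI[where f' = "\<lambda>x v. frechet_derivative f (at x) v + frechet_derivative g (at x) v"])
    show "((\<lambda>x. f x + g x) has_derivative (\<lambda>v. frechet_derivative f (at x) v + frechet_derivative g (at x) v)) (at x)" for x
      by (rule has_derivative_add[OF C_k_SucD(1)[OF Suc.prems(1)] C_k_SucD(1)[OF Suc.prems(2)]])
    show "C_k m (\<lambda>x. frechet_derivative f (at x) v + frechet_derivative g (at x) v)" for v
      by (rule Suc.IH[OF C_k_SucD(2)[OF Suc.prems(1)] C_k_SucD(2)[OF Suc.prems(2)]])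
  qed
qed (simp add: continuous_on_add)

lemma C_k_mult: "C_k m f \<Longrightarrow> C_k m g \<Longrightarrow> C_k m (\<lambda>x. f x * g x)"
proof (induction m arbitrary: f g)
  case (Suc m)
  show ?case
  proof (rule C_k_SucI[where f' = "\<lambda>x v. f x * frechet_derivative g (at x) v + frechet_derivative f (at x) v * g x"])
    show "((\<lambda>x. f x * g x) has_derivative (\<lambda>v. f x * frechet_derivative g (at x) v + frechet_derivative f (at x) v * g x)) (at x)" for x
      by (rule has_derivative_mult[OF C_k_SucD(1)[OF Suc.prems(1)] C_k_SucD(1)[OF Suc.prems(2)]])
    show "C_k m (\<lambda>x. f x * frechet_derivative g (at x) v + frechet_derivative f (at x) v * g x)" for v
      by (rule C_k_add[OF Suc.IH[OF C_k_Suc_imp[OF Suc.prems(1)] C_k_SucD(2)[OF Suc.prems(2)]]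
             Suc.IH[OF C_k_SucD(2)[OF Suc.prems(1)] C_k_Suc_imp[OF Suc.prems(2)]]])
  qed
qed (simp add: continuous_on_mult)

lemma C_k_prod: "finite I \<Longrightarrow> (\<And>j. j \<in> I \<Longrightarrow> C_k m (f j)) \<Longrightarrow> C_k m (\<lambda>x. \<Prod>j\<in>I. f j x)"
  by (induction I rule: finite_induct) (auto intro: C_k_const C_k_mult)

lemma C_k_bump: "C_k m (\<lambda>x. complex_of_real (bump P (\<alpha> + \<beta> * (x \<bullet> e))))"
proof (induction m arbitrary: P)
  case 0
  have "continuous_on UNIV (bump P)"
    by (rule DERIV_continuous_on) (use bump_has_derivative in \<open>auto intro: has_field_derivative_at_within\<close>)
  moreover have "continuous_on UNIV (\<lambda>x. \<alpha> + \<beta> * (x \<bullet> e))" by (intro continuous_intros)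
  ultimately have "continuous_on UNIV (\<lambda>x. bump P (\<alpha> + \<beta> * (x \<bullet> e)))"
    by (rule continuous_on_compose2) simp
  then show ?case by (simp add: continuous_on_of_real)
next
  case (Suc m)
  define P' where "P' = [:0, 0, 1:] * (P - pderiv P)"
  show ?case
  proof (rule C_k_SucI[where f' = "\<lambda>x v. complex_of_real (bump P' (\<alpha> + \<beta> * (x \<bullet> e))) * complex_of_real (\<beta> * (v \<bullet> e))"])
    fix x :: 'a
    have 1: "((\<lambda>x. \<alpha> + \<beta> * (x \<bullet> e)) has_derivative (\<lambda>v. \<beta> * (v \<bullet> e))) (at x)"
      by (auto intro!: derivative_eq_intros)
    have 2: "(bump P has_derivative (*) (bump P' (\<alpha> + \<beta> * (x \<bullet> e)))) (at (\<alpha> + \<beta> * (x \<bullet> e)))"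
      using bump_has_derivative[of P] by (simp add: has_field_derivative_def P'_def)
    have "((\<lambda>x. bump P (\<alpha> + \<beta> * (x \<bullet> e))) has_derivative (\<lambda>v. bump P' (\<alpha> + \<beta> * (x \<bullet> e)) * (\<beta> * (v \<bullet> e)))) (at x)"
      using has_derivative_compose[OF 1 2] by simp
    from has_derivative_of_real[OF this]
    show "((\<lambda>x. complex_of_real (bump P (\<alpha> + \<beta> * (x \<bullet> e)))) has_derivative
       (\<lambda>v. complex_of_real (bump P' (\<alpha> + \<beta> * (x \<bullet> e))) * complex_of_real (\<beta> * (v \<bullet> e)))) (at x)"
      by simp
  qed (intro C_k_mult C_k_const Suc)
qed

lemma Cc_infI:
  assumes "\<And>m. C_k m f" "bounded (spt f)" shows "f \<in> Cc_inf"
  using assms unfolding Cc_inf_def by (auto simp: compact_eq_bounded_closed spt_def)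

lemma spt_subsetI: "closed Q \<Longrightarrow> (\<And>x. x \<notin> Q \<Longrightarrow> f x = 0) \<Longrightarrow> spt f \<subseteq> Q"
  unfolding spt_def by (intro closure_minimal) auto

lemma zero_outside_spt: "spt f \<subseteq> Q \<Longrightarrow> x \<notin> Q \<Longrightarrow> f x = 0"
  unfolding spt_def using closure_subset[of "{x. f x \<noteq> 0}"] by blast

lemma Cc_inf_integrable:
  assumes "f \<in> Cc_inf" shows "integrable lebesgue f" and "f \<in> borel_measurable borel" and "f \<in> L1_c"
proof -
  have c: "continuous_on UNIV f" and k: "compact (spt f)"
    using assms unfolding Cc_inf_def using C_k.simps(1) by blast+
  show m: "f \<in> borel_measurable borel" using c by (rule borel_measurable_continuous_onI)
  have "integrable lborel (\<lambda>x. indicator (spt f) x *\<^sub>R f x)"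
    using k c by (intro borel_integrable_compact) (auto intro: continuous_on_subset)
  moreover have "(\<lambda>x. indicator (spt f) x *\<^sub>R f x) = f"
    using zero_outside_spt[of f "spt f"] by (force simp: indicator_def)
  ultimately show i: "integrable lebesgue f" using m by (simp add: integrable_completion)
  show "f \<in> L1_c" using i k unfolding L1_c_def spt_def
    by (auto intro: bounded_subset[OF compact_imp_bounded closure_subset])
qed

text \<open>
  On each coordinate the product of a bump that starts at the left end and one that starts at
  the right end. Since \<open>exp (- 1 / (n s))\<close> tends to 1 for \<open>s > 0\<close>,
  dilation by \<open>n\<close> alone turns it into the indicator of the open box, while the
  support stays inside the closed box.
\<close>

definition box_bump :: "'a::euclidean_space \<Rightarrow> 'a \<Rightarrow> nat \<Rightarrow> 'a \<Rightarrow> complex" where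
  "box_bump a b n x = (\<Prod>e\<in>Basis. complex_of_real (bump [:1:] (- real n * (a \<bullet> e) + real n * (x \<bullet> e))) *
                                 complex_of_real (bump [:1:] (real n * (b \<bullet> e) + (- real n) * (x \<bullet> e))))"

lemma bump_1_bounds: "0 \<le> bump [:1:] t" "bump [:1:] t \<le> 1" by (auto simp: bump_def)

lemma bump_1_tendsto: "s > 0 \<Longrightarrow> (\<lambda>n. bump [:1:] (real n * s)) \<longlonglongrightarrow> 1"
proof -
  assume s: "s > 0"
  have "(\<lambda>n. exp (- (inverse (real n) * (1 / s)))) \<longlonglongrightarrow> exp (- (0 * (1 / s)))"
    by (intro tendsto_intros lim_inverse_n)
  then have "(\<lambda>n. exp (- (inverse (real n) * (1 / s)))) \<longlonglongrightarrow> 1" by simp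
  then show ?thesis
    by (rule Lim_transform_eventually) 
      (use s in \<open>auto simp: bump_def field_simps eventually_sequentially intro!: exI[of _ 1]\<close>)
qed

lemma box_bump_outside: "x \<notin> box a b \<Longrightarrow> box_bump a b n x = 0"
proof -
  assume "x \<notin> box a b"
  then obtain e where e: "e \<in> Basis" "x \<bullet> e \<le> a \<bullet> e \<or> b \<bullet> e \<le> x \<bullet> e" by (auto simp: mem_box not_less)
  then have "real n * (x \<bullet> e) \<le> real n * (a \<bullet> e) \<or> real n * (b \<bullet> e) \<le> real n * (x \<bullet> e)"
    by (auto intro: mult_left_mono)
  with e show ?thesis unfolding box_bump_def by (intro prod_zero) (auto simp: bump_def intro!: bexI[of _ e])
qed

lemma box_bump_norm: "norm (box_bump a b n x) \<le> 1"
  unfolding box_bump_def by (auto simp: prod_norm[symmetric] norm_mult bump_1_bounds intro!: prod_le_1 mult_le_one)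

lemma box_bump_tendsto: "(\<lambda>n. box_bump a b n x) \<longlonglongrightarrow> indicator (box a b) x"
proof (cases "x \<in> box a b")
  case True
  have "(\<lambda>n. \<Prod>e\<in>Basis. complex_of_real (bump [:1:] (real n * ((x - a) \<bullet> e))) *
            complex_of_real (bump [:1:] (real n * ((b - x) \<bullet> e)))) \<longlonglongrightarrow> (\<Prod>e\<in>(Basis::'a set). of_real 1 * of_real 1)"
    by (intro tendsto_prod tendsto_mult tendsto_of_real bump_1_tendsto)
      (use True in \<open>auto simp: mem_box inner_diff_left\<close>)
  then show ?thesis using True by (simp add: box_bump_def inner_diff_left algebra_simps)
qed (simp add: box_bump_outside)

lemma box_bump_Cc_inf: "box_bump a b n \<in> Cc_inf" and box_bump_spt: "spt (box_bump a b n) \<subseteq> cbox a b"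
proof -
  show s: "spt (box_bump a b n) \<subseteq> cbox a b"
  proof (rule spt_subsetI)
    show "box_bump a b n x = 0" if "x \<notin> cbox a b" for x
      using that box_bump_outside box_subset_cbox[of a b] by blast
  qed auto
  show "box_bump a b n \<in> Cc_inf"
  proof (rule Cc_infI)
    show "C_k m (box_bump a b n)" for m
      unfolding box_bump_def by (intro C_k_prod C_k_mult C_k_bump) auto
    show "bounded (spt (box_bump a b n))" using s bounded_cbox bounded_subset by blast
  qed
qed

text \<open>
  The approximants have their support in the same closed set \<open>Q\<close>: later on
  \<open>Q\<close> is a cube and the kernel formula is used at every point outside it.
\<close>

definition smooth_approximable :: "'a::euclidean_space set \<Rightarrow> ('a \<Rightarrow> complex) \<Rightarrow> bool" where
  "smooth_approximable Q f \<longleftrightarrow> integrable lebesgue f \<and>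
    (\<forall>e>0. \<exists>g\<in>Cc_inf. spt g \<subseteq> Q \<and> (\<integral>x. norm (g x - f x) \<partial>lebesgue) < e)"

lemma L1_triangle:
  fixes f g h :: "'a \<Rightarrow> complex"
  assumes "integrable M f" "integrable M g" "integrable M h"
  shows "(\<integral>x. norm (f x - h x) \<partial>M) \<le> (\<integral>x. norm (f x - g x) \<partial>M) + (\<integral>x. norm (g x - h x) \<partial>M)"
proof -
  have "(\<integral>x. norm (f x - h x) \<partial>M) \<le> (\<integral>x. norm (f x - g x) + norm (g x - h x) \<partial>M)"
    using assms by (intro integral_mono) (auto intro: norm_diff_triangle_le)
  then show ?thesis using assms by simp
qed

lemma smooth_approximable_limit:
  assumes "integrable lebesgue f" 
    and "\<And>e. e > 0 \<Longrightarrow> \<exists>h. smooth_approximable Q h \<and> (\<integral>x. norm (h x - f x) \<partial>lebesgue) < e"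
  shows "smooth_approximable Q f"
  unfolding smooth_approximable_def
proof (intro conjI allI impI assms(1))
  fix e :: real assume "e > 0"
  then obtain h where h: "smooth_approximable Q h" "(\<integral>x. norm (h x - f x) \<partial>lebesgue) < e / 2"
    using assms(2)[of "e/2"] by auto
  then obtain g where g: "g \<in> Cc_inf" "spt g \<subseteq> Q" "(\<integral>x. norm (g x - h x) \<partial>lebesgue) < e / 2"
    using \<open>e > 0\<close> unfolding smooth_approximable_def by (meson half_gt_zero)
  have "(\<integral>x. norm (g x - f x) \<partial>lebesgue) < e"
    using L1_triangle[of lebesgue g h f] Cc_inf_integrable(1)[OF g(1)] h g assms(1)
    unfolding smooth_approximable_def by auto
  then show "\<exists>g\<in>Cc_inf. spt g \<subseteq> Q \<and> (\<integral>x. norm (g x - f x) \<partial>lebesgue) < e" using g by auto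
qed

lemma smooth_approximable_limit_seq:
  assumes "integrable lebesgue f" "\<And>n. smooth_approximable Q (s n)"
    and "(\<lambda>n. \<integral>x. norm (s n x - f x) \<partial>lebesgue) \<longlonglongrightarrow> 0"
  shows "smooth_approximable Q f"
proof (rule smooth_approximable_limit[OF assms(1)])
  fix e :: real assume "e > 0"
  then have "\<forall>\<^sub>F n in sequentially. (\<integral>x. norm (s n x - f x) \<partial>lebesgue) < e"
    using assms(3) order_tendstoD(2) by blast
  then show "\<exists>h. smooth_approximable Q h \<and> (\<integral>x. norm (h x - f x) \<partial>lebesgue) < e"
    using assms(2) by (auto simp: eventually_sequentially)
qed

lemma smooth_approximable_dominated:
  assumes s: "\<And>n. smooth_approximable Q (s n)" and l: "\<And>x. (\<lambda>n. s n x) \<longlonglongrightarrow> f x"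
    and d: "\<And>n x. norm (s n x) \<le> h x" and h: "integrable lebesgue h"
  shows "smooth_approximable Q f"
proof -
  have m: "s n \<in> borel_measurable lebesgue" for n using s[of n] unfolding smooth_approximable_def by auto
  have mf: "f \<in> borel_measurable lebesgue" by (rule borel_measurable_LIMSEQ_metric[OF m l])
  have i: "integrable lebesgue f"
    by (rule integrable_dominated_convergence[where s = s and w = h]) (use l d mf m h in auto)
  have fh: "norm (f x) \<le> h x" for x
    by (rule LIMSEQ_le_const2[OF tendsto_norm[OF l]]) (use d in auto)
  have "(\<lambda>n. \<integral>x. norm (s n x - f x) \<partial>lebesgue) \<longlonglongrightarrow> (\<integral>x. 0 \<partial>(lebesgue :: 'a measure))"
  proof (rule integral_dominated_convergence[where w = "\<lambda>x. 2 * h x"])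
    show "AE x in lebesgue. (\<lambda>n. norm (s n x - f x)) \<longlonglongrightarrow> 0"
    proof (rule AE_I2)
      show "(\<lambda>n. norm (s n x - f x)) \<longlonglongrightarrow> 0" for x
        using l[of x] by (intro tendsto_norm_zero) (simp add: LIM_zero_iff)
    qed
    show "AE x in lebesgue. norm (norm (s n x - f x)) \<le> 2 * h x" for n
    proof (rule AE_I2)
      show "norm (norm (s n x - f x)) \<le> 2 * h x" for x
        using norm_triangle_ineq4[of "s n x" "f x"] d[of n x] fh[of x] by simp
    qed
  qed (use m mf h in auto)
  then show ?thesis using smooth_approximable_limit_seq[OF i s] by simp
qed

lemma smooth_approximable_cong_AE:
  assumes "smooth_approximable Q f" "g \<in> borel_measurable lebesgue" "AE x in lebesgue. f x = g x"
  shows "smooth_approximable Q g"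
proof -
  have f: "integrable lebesgue f" using assms(1) unfolding smooth_approximable_def by auto
  have i: "integrable lebesgue g"
    using integrable_cong_AE[THEN iffD1, OF _ assms(2,3) f] f by auto
  show ?thesis
  proof (rule smooth_approximable_limit[OF i])
    fix e :: real assume "e > 0"
    have "(\<integral>x. norm (f x - g x) \<partial>lebesgue) = (\<integral>x. 0 \<partial>(lebesgue :: 'a measure))"
      by (rule integral_cong_AE) (use assms f in auto)
    then show "\<exists>h. smooth_approximable Q h \<and> (\<integral>x. norm (h x - g x) \<partial>lebesgue) < e"
      using assms(1) \<open>e > 0\<close> by (intro exI[of _ f]) auto
  qed
qed

lemma smooth_approximable_add_scaled:
  assumes f: "smooth_approximable Q f" and g: "smooth_approximable Q g" and Q: "closed Q"
  shows "smooth_approximable Q (\<lambda>x. c * f x + g x)"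
  unfolding smooth_approximable_def
proof (intro conjI allI impI)
  have i: "integrable lebesgue f" "integrable lebesgue g" using f g unfolding smooth_approximable_def by auto
  then show "integrable lebesgue (\<lambda>x. c * f x + g x)" by auto
  fix e :: real assume e: "e > 0"
  have "e / 2 / (1 + norm c) > 0" using e by (simp add: add_pos_nonneg)
  then obtain u where u: "u \<in> Cc_inf" "spt u \<subseteq> Q" "(\<integral>x. norm (u x - f x) \<partial>lebesgue) < e / 2 / (1 + norm c)"
    using f unfolding smooth_approximable_def by meson
  obtain v where v: "v \<in> Cc_inf" "spt v \<subseteq> Q" "(\<integral>x. norm (v x - g x) \<partial>lebesgue) < e / 2"
    using g e unfolding smooth_approximable_def by (meson half_gt_zero)
  have iu: "integrable lebesgue u" "integrable lebesgue v" using u v Cc_inf_integrable by auto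
  let ?h = "\<lambda>x. c * u x + v x"
  have s: "spt ?h \<subseteq> spt u \<union> spt v"
  proof (rule spt_subsetI)
    show "closed (spt u \<union> spt v)" unfolding spt_def by (intro closed_Un closed_closure)
    show "c * u x + v x = 0" if "x \<notin> spt u \<union> spt v" for x
      using that zero_outside_spt[OF order_refl, of x u] zero_outside_spt[OF order_refl, of x v] by simp
  qed
  have "?h \<in> Cc_inf"
  proof (rule Cc_infI)
    show "C_k m ?h" for m using u v unfolding Cc_inf_def by (intro C_k_add C_k_mult C_k_const) auto
    have "compact (spt u)" "compact (spt v)" using u v unfolding Cc_inf_def by auto
    then have "bounded (spt u \<union> spt v)" by (simp add: compact_imp_bounded)
    then show "bounded (spt ?h)" using s by (rule bounded_subset)
  qed
  moreover have "(\<integral>x. norm (?h x - (c * f x + g x)) \<partial>lebesgue) < e"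
  proof -
    have "(\<integral>x. norm (?h x - (c * f x + g x)) \<partial>lebesgue) \<le> (\<integral>x. norm c * norm (u x - f x) + norm (v x - g x) \<partial>lebesgue)"
    proof (rule integral_mono)
      show "norm (?h x - (c * f x + g x)) \<le> norm c * norm (u x - f x) + norm (v x - g x)" for x
        using norm_triangle_ineq[of "c * (u x - f x)" "v x - g x"] by (simp only: norm_mult) (simp add: algebra_simps)
    qed (use iu i in auto)
    also have "\<dots> = norm c * (\<integral>x. norm (u x - f x) \<partial>lebesgue) + (\<integral>x. norm (v x - g x) \<partial>lebesgue)"
      using iu i by simp
    also have "\<dots> < e"
    proof -
      have "norm c * (\<integral>x. norm (u x - f x) \<partial>lebesgue) \<le> (1 + norm c) * (\<integral>x. norm (u x - f x) \<partial>lebesgue)"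
        by (intro mult_right_mono) auto
      also have "\<dots> < (1 + norm c) * (e / 2 / (1 + norm c))"
        using u(3) by (intro mult_strict_left_mono) (auto simp: add_pos_nonneg)
      also have "\<dots> = e / 2"
      proof -
        have "1 + norm c \<noteq> 0" using norm_ge_zero[of c] by linarith
        then show ?thesis by (metis nonzero_mult_div_cancel_left times_divide_eq_right)
      qed
      finally show ?thesis using v(3) by linarith
    qed
    finally show ?thesis .
  qed
  ultimately show "\<exists>g'\<in>Cc_inf. spt g' \<subseteq> Q \<and> (\<integral>x. norm (g' x - (c * f x + g x)) \<partial>lebesgue) < e"
    using s u v by (intro bexI[of _ ?h]) auto
qed

lemma smooth_approximable_zero: "smooth_approximable Q (\<lambda>x. 0)"
  unfolding smooth_approximable_def
proof (intro conjI allI impI bexI[of _ "\<lambda>x. 0"])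
  show "(\<lambda>x::'a. 0::complex) \<in> Cc_inf" by (rule Cc_infI) (auto simp: C_k_const spt_def)
qed (auto simp: spt_def)

lemma smooth_approximable_box:
  assumes "box a b \<subseteq> Q" "closed Q" shows "smooth_approximable Q (indicator (box a b))"
proof (cases "box a b = {}")
  case True
  then have "indicator (box a b) = (\<lambda>x. 0::complex)" by auto
  then show ?thesis using smooth_approximable_zero[of Q] by simp
next
  case False
  then have c: "cbox a b \<subseteq> Q" using closure_minimal[OF assms] closure_box[of a b] by simp
  show ?thesis
  proof (rule smooth_approximable_dominated[where s = "box_bump a b" and h = "indicator (cbox a b)"])
    show "smooth_approximable Q (box_bump a b n)" for n
      unfolding smooth_approximable_def
      using box_bump_Cc_inf[of a b n] box_bump_spt[of a b n] c Cc_inf_integrable(1)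
      by (auto intro!: bexI[of _ "box_bump a b n"])
    show "norm (box_bump a b n x) \<le> indicator (cbox a b) x" for n x
      using box_bump_norm[of a b n x] box_bump_outside[of x a b n] box_subset_cbox[of a b]
      by (auto simp: indicator_def)
    show "integrable lebesgue (indicat_real (cbox a b))" using lmeasurable_iff_integrable by blast
  qed (rule box_bump_tendsto)
qed

lemma cbox_minus_box_AE: "AE x in lebesgue. x \<in> cbox u v \<longrightarrow> x \<in> box u (v::'a::euclidean_space)"
proof -
  have "negligible (cbox u v - box u v)" by (rule negligible_frontier_interval)
  then have "AE x in lebesgue. x \<notin> cbox u v - box u v"
    using AE_not_in by (auto simp only: negligible_iff_null_sets)
  then show ?thesis by eventually_elim auto
qed

text \<open>
  The approximable sets form a Dynkin system, and the open boxes are an intersection-stable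
  generator of the Borel sets.
\<close>

lemma smooth_approximable_borel_set:
  assumes "A \<in> sets borel"
  shows "smooth_approximable (cbox u v) (indicator (A \<inter> cbox u (v::'a::euclidean_space)))"
proof -
  let ?G = "range (\<lambda>(a, b). box a b) :: 'a set set"
  have gen: "sigma_sets UNIV ?G = sets borel" by (simp add: borel_eq_box)
  show ?thesis
  proof (rule sigma_sets_induct_disjoint[where \<Omega> = UNIV and G = ?G and
      P = "\<lambda>A. smooth_approximable (cbox u v) (indicator (A \<inter> cbox u v))"])
    show "A \<in> sigma_sets UNIV ?G" using assms gen by simp
    show "Int_stable ?G"
      unfolding Int_stable_def by (auto simp: box_Int_box)
    show "?G \<subseteq> Pow UNIV" by simp
  next
    fix A assume "A \<in> ?G"
    then obtain a b where A: "A = box a b" by auto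
    obtain c d where cd: "box a b \<inter> box u v = box c d" using box_Int_box[of a b u v] by blast
    have "smooth_approximable (cbox u v) (indicator (box a b \<inter> box u v))"
      unfolding cd by (rule smooth_approximable_box) (use cd box_subset_cbox[of u v] in auto)
    then show "smooth_approximable (cbox u v) (indicator (A \<inter> cbox u v))" unfolding A
    proof (rule smooth_approximable_cong_AE)
      show "AE x in lebesgue. indicator (box a b \<inter> box u v) x = (indicator (box a b \<inter> cbox u v) x :: complex)"
        using cbox_minus_box_AE[of u v] by eventually_elim (use box_subset_cbox[of u v] in \<open>auto simp: indicator_def\<close>)
      show "indicator (box a b \<inter> cbox u v) \<in> borel_measurable lebesgue"
        by (intro borel_measurable_indicator sets.Int) auto
    qed
  next
    have "indicator {} = (\<lambda>x::'a. 0::complex)" by auto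
    then show "smooth_approximable (cbox u v) (indicator ({} \<inter> cbox u v))"
      using smooth_approximable_zero[of "cbox u v"] by simp
  next
    fix A assume A: "smooth_approximable (cbox u v) (indicator (A \<inter> cbox u v))"
    have "smooth_approximable (cbox u v) (indicator (box u v))"
      by (rule smooth_approximable_box) (auto simp: box_subset_cbox)
    then have "smooth_approximable (cbox u v) (indicator (cbox u v))"
    proof (rule smooth_approximable_cong_AE)
      show "AE x in lebesgue. indicator (box u v) x = (indicator (cbox u v) x :: complex)"
        using cbox_minus_box_AE[of u v] by eventually_elim (use box_subset_cbox[of u v] in \<open>auto simp: indicator_def\<close>)
      show "indicator (cbox u v) \<in> borel_measurable lebesgue"
        by (intro borel_measurable_indicator) auto
    qed
    from smooth_approximable_add_scaled[OF A this closed_cbox, of "-1"]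
    have "smooth_approximable (cbox u v) (\<lambda>x. -1 * indicator (A \<inter> cbox u v) x + indicator (cbox u v) x)" by simp
    also have "(\<lambda>x. -1 * indicator (A \<inter> cbox u v) x + indicator (cbox u v) x) = (indicator ((UNIV - A) \<inter> cbox u v) :: 'a \<Rightarrow> complex)"
      by (auto simp: indicator_def)
    finally show "smooth_approximable (cbox u v) (indicator ((UNIV - A) \<inter> cbox u v))" .
  next
    fix A :: "nat \<Rightarrow> 'a set"
    assume dis: "disjoint_family A" and A: "\<And>i. smooth_approximable (cbox u v) (indicator (A i \<inter> cbox u v))"
    define s where "s n = (indicator ((\<Union>i<n. A i) \<inter> cbox u v) :: 'a \<Rightarrow> complex)" for n
    have s: "smooth_approximable (cbox u v) (s n)" for n
    proof (induction n)
      case 0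
      have "s 0 = (\<lambda>x. 0)" unfolding s_def by auto
      then show ?case using smooth_approximable_zero[of "cbox u v"] by simp
    next
      case (Suc n)
      have "s (Suc n) = (\<lambda>x. 1 * s n x + indicator (A n \<inter> cbox u v) x)"
      proof
        fix x
        have "x \<notin> A j" if "x \<in> A n" "j < n" for j
          using that dis disjoint_family_onD[of A UNIV j n] by auto
        then show "s (Suc n) x = 1 * s n x + indicator (A n \<inter> cbox u v) x"
          unfolding s_def by (cases "x \<in> A n") (auto simp: indicator_def lessThan_Suc)
      qed
      then show ?case using smooth_approximable_add_scaled[OF Suc A[of n] closed_cbox, of 1] by simp
    qed
    show "smooth_approximable (cbox u v) (indicator (\<Union> (range A) \<inter> cbox u v))"
    proof (rule smooth_approximable_dominated[where s = s and h = "indicator (cbox u v)"])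
      show "(\<lambda>n. s n x) \<longlonglongrightarrow> indicator (\<Union> (range A) \<inter> cbox u v) x" for x
      proof (cases "x \<in> \<Union> (range A) \<inter> cbox u v")
        case True
        then obtain i where "x \<in> A i" by auto
        then have "\<forall>n\<ge>Suc i. s n x = 1" using True by (auto simp: s_def indicator_def)
        then have "\<forall>\<^sub>F n in sequentially. s n x = 1" unfolding eventually_sequentially by blast
        then show ?thesis using True by (auto intro!: tendsto_eventually)
      qed (auto simp: s_def indicator_def)
      show "norm (s n x) \<le> indicator (cbox u v) x" for n x by (auto simp: s_def indicator_def)
      show "integrable lebesgue (indicat_real (cbox u v))" using lmeasurable_iff_integrable by blast
    qed (use s in auto)
  qed
qed

text \<open>
  Bochner induction from indicators to integrable functions; a Lebesgue measurable set is a
  Borel set up to a null set.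
\<close>

proposition L1_smooth_approximable:
  assumes "integrable lebesgue f" "\<And>x. x \<notin> cbox u v \<Longrightarrow> f x = 0"
  shows "smooth_approximable (cbox u (v::'a::euclidean_space)) f"
proof -
  let ?Q = "cbox u v"
  have "smooth_approximable ?Q (\<lambda>x. indicat_real ?Q x *\<^sub>R f x)"
    using assms(1)
  proof (induct rule: integrable_induct)
    case (base A c)
    then obtain S N N' where A: "A = S \<union> N" "N \<subseteq> N'" "N' \<in> null_sets lborel" "S \<in> sets lborel"
      using sets_completionE by metis
    have "AE x in lebesgue. x \<notin> N'" using A(3) by (intro AE_completion AE_not_in)
    then have "AE x in lebesgue. c * indicator (S \<inter> ?Q) x + 0 = indicat_real ?Q x *\<^sub>R (indicat_real A x *\<^sub>R c)"
      by eventually_elim (use A in \<open>auto simp: indicator_def\<close>)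
    moreover have "smooth_approximable ?Q (\<lambda>x. c * indicator (S \<inter> ?Q) x + 0)"
      by (intro smooth_approximable_add_scaled closed_cbox smooth_approximable_zero smooth_approximable_borel_set) (use A in auto)
    moreover have "(\<lambda>x. indicat_real ?Q x *\<^sub>R (indicat_real A x *\<^sub>R c)) \<in> borel_measurable lebesgue"
      using base by (intro borel_measurable_scaleR borel_measurable_indicator) auto
    ultimately show ?case using smooth_approximable_cong_AE by blast
  next
    case (add f g)
    from smooth_approximable_add_scaled[OF add(2,4) closed_cbox, of 1] show ?case by (simp add: scaleR_right_distrib)
  next
    case (lim f s)
    show ?case
    proof (rule smooth_approximable_dominated[where s = "\<lambda>n x. indicat_real ?Q x *\<^sub>R s n x" and h = "\<lambda>x. 2 * norm (f x)"])
      show "norm (indicat_real ?Q x *\<^sub>R s n x) \<le> 2 * norm (f x)" for n x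
        using lim(4)[of x n] by (auto simp: indicator_def)
      show "(\<lambda>n. indicat_real ?Q x *\<^sub>R s n x) \<longlonglongrightarrow> indicat_real ?Q x *\<^sub>R f x" for x
        using lim(3)[of x] by (intro tendsto_intros) auto
    qed (use lim in auto)
  qed
  also have "(\<lambda>x. indicat_real ?Q x *\<^sub>R f x) = f" using assms(2) by (auto simp: indicator_def)
  finally show ?thesis .
qed

corollary L1_smooth_sequence:
  assumes "integrable lebesgue f" "\<And>x. x \<notin> cbox u v \<Longrightarrow> f x = 0"
  obtains \<phi> :: "nat \<Rightarrow> 'a::euclidean_space \<Rightarrow> complex" where "\<And>m. \<phi> m \<in> Cc_inf" "\<And>m. spt (\<phi> m) \<subseteq> cbox u v"
    "(\<lambda>m. \<integral>x. norm (\<phi> m x - f x) \<partial>lebesgue) \<longlonglongrightarrow> 0"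
proof -
  have "\<exists>g\<in>Cc_inf. spt g \<subseteq> cbox u v \<and> (\<integral>x. norm (g x - f x) \<partial>lebesgue) < inverse (real (Suc m))" for m
    using L1_smooth_approximable[OF assms] unfolding smooth_approximable_def by auto
  then obtain \<phi> where \<phi>: "\<And>m. \<phi> m \<in> Cc_inf \<and> spt (\<phi> m) \<subseteq> cbox u v \<and> (\<integral>x. norm (\<phi> m x - f x) \<partial>lebesgue) < inverse (real (Suc m))"
    by metis
  have "(\<lambda>m. \<integral>x. norm (\<phi> m x - f x) \<partial>lebesgue) \<longlonglongrightarrow> 0"
    by (rule tendsto_sandwich[OF _ _ tendsto_const LIMSEQ_inverse_real_of_nat])
      (use \<phi> in \<open>auto intro!: always_eventually less_imp_le\<close>)
  then show ?thesis using \<phi> that by blast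
qed

section \<open>The commutator off the support of its arguments\<close>

text \<open>
  The commutator is linear in \<open>T\<close>, so that iterating it is a binomial expansion.
  The identity holds at every point, not merely almost everywhere.
\<close>

lemma iterated_commutator_expand:
  "iterated_commutator i k b T f x =
    (\<Sum>m\<le>k. of_nat (k choose m) * (-1) ^ m * b x ^ (k - m) * T (f(i := \<lambda>y. b y ^ m * f i y)) x)"
proof (induction k arbitrary: f)
  case 0
  show ?case by (simp add: iterated_commutator_def)
next
  case (Suc k)
  define t where "t m = T (f(i := \<lambda>y. b y ^ m * f i y)) x" for m
  define S where "S = iterated_commutator i k b T"
  have "iterated_commutator i (Suc k) b T f x = b x * S f x - S (f(i := \<lambda>y. b y * f i y)) x"
    by (simp add: iterated_commutator_def S_def commutator_def)
  also have "S f x = (\<Sum>m\<le>k. of_nat (k choose m) * (-1) ^ m * b x ^ (k - m) * t m)"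
    unfolding S_def Suc t_def ..
  also have "S (f(i := \<lambda>y. b y * f i y)) x = (\<Sum>m\<le>k. of_nat (k choose m) * (-1) ^ m * b x ^ (k - m) * t (Suc m))"
    unfolding S_def Suc t_def by (simp add: mult_ac)
  finally have L: "iterated_commutator i (Suc k) b T f x =
      b x * (\<Sum>m\<le>k. of_nat (k choose m) * (-1) ^ m * b x ^ (k - m) * t m)
      - (\<Sum>m\<le>k. of_nat (k choose m) * (-1) ^ m * b x ^ (k - m) * t (Suc m))" .
  have "(\<Sum>m\<le>Suc k. of_nat (Suc k choose m) * (-1) ^ m * b x ^ (Suc k - m) * t m)
      = b x ^ Suc k * t 0 + (\<Sum>m\<le>k. of_nat (Suc k choose Suc m) * (-1) ^ Suc m * b x ^ (k - m) * t (Suc m))"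
    by (subst sum.atMost_Suc_shift) simp
  also have "\<dots> = b x ^ Suc k * t 0 + (\<Sum>m\<le>k. of_nat (k choose Suc m) * (-1) ^ Suc m * b x ^ (k - m) * t (Suc m))
      - (\<Sum>m\<le>k. of_nat (k choose m) * (-1) ^ m * b x ^ (k - m) * t (Suc m))"
    by (simp add: sum.distrib[symmetric] sum_subtractf[symmetric] algebra_simps)
  also have "b x ^ Suc k * t 0 + (\<Sum>m\<le>k. of_nat (k choose Suc m) * (-1) ^ Suc m * b x ^ (k - m) * t (Suc m))
      = (\<Sum>m\<le>Suc k. of_nat (k choose m) * (-1) ^ m * b x ^ (Suc k - m) * t m)"
    by (subst sum.atMost_Suc_shift) simp
  also have "\<dots> = (\<Sum>m\<le>k. of_nat (k choose m) * (-1) ^ m * b x ^ (Suc k - m) * t m)"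
    by simp
  also have "\<dots> = b x * (\<Sum>m\<le>k. of_nat (k choose m) * (-1) ^ m * b x ^ (k - m) * t m)"
    unfolding sum_distrib_left by (intro sum.cong) (auto simp: Suc_diff_le)
  finally have R: "(\<Sum>m\<le>Suc k. of_nat (Suc k choose m) * (-1) ^ m * b x ^ (Suc k - m) * t m)
      = b x * (\<Sum>m\<le>k. of_nat (k choose m) * (-1) ^ m * b x ^ (k - m) * t m)
      - (\<Sum>m\<le>k. of_nat (k choose m) * (-1) ^ m * b x ^ (k - m) * t (Suc m))" .
  show ?case using trans[OF L R[symmetric]] unfolding t_def .
qed

lemma binomial_difference:
  fixes z w :: complex
  shows "(\<Sum>m\<le>k. of_nat (k choose m) * (-1) ^ m * z ^ (k - m) * w ^ m) = (z - w) ^ k"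
proof -
  have "(z - w) ^ k = (- w + z) ^ k" by simp
  also have "\<dots> = (\<Sum>m\<le>k. of_nat (k choose m) * (- w) ^ m * z ^ (k - m))" by (rule binomial_ring)
  also have "\<dots> = (\<Sum>m\<le>k. of_nat (k choose m) * (-1) ^ m * z ^ (k - m) * w ^ m)"
    by (intro sum.cong refl) (simp add: power_minus[of w] mult_ac)
  finally show ?thesis by simp
qed

lemma modulus_nonneg:
  assumes "modulus \<omega>" "0 \<le> t" shows "0 \<le> \<omega> t"
proof -
  have "\<omega> (0 + 0) \<le> \<omega> 0 + \<omega> 0" using assms(1) unfolding modulus_def by blast
  then have "0 \<le> \<omega> 0" by simp
  also have "\<omega> 0 \<le> \<omega> t" using assms unfolding modulus_def by (auto intro: mono_onD)
  finally show ?thesis .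
qed

lemma modulus_mono: "modulus \<omega> \<Longrightarrow> 0 \<le> s \<Longrightarrow> s \<le> t \<Longrightarrow> \<omega> s \<le> \<omega> t"
  unfolding modulus_def by (auto intro: mono_onD)

lemma modulus_small:
  assumes "modulus \<omega>" "0 < e"
  obtains t where "0 < t" "\<omega> t < e"
proof -
  have "\<forall>\<^sub>F t in at_right 0. \<omega> t < e" using assms unfolding modulus_def by (auto intro: order_tendstoD)
  moreover have "\<forall>\<^sub>F t in at_right (0::real). 0 < t" by (simp add: eventually_at_filter)
  ultimately have "\<forall>\<^sub>F t in at_right (0::real). \<omega> t < e \<and> 0 < t" by (rule eventually_conj)
  then obtain t where "\<omega> t < e \<and> 0 < t" using eventually_happens[of _ "at_right (0::real)"] by auto
  then show ?thesis using that by blast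
qed

lemma kernel_dist_ge:
  assumes "\<And>j. \<delta> \<le> norm (x - y j)" shows "\<delta> \<le> kernel_dist x (y :: 'n::finite \<Rightarrow> 'a::euclidean_space)"
proof -
  have "\<delta> \<le> norm (x - y undefined)" by (rule assms)
  also have "\<dots> \<le> kernel_dist x y" unfolding kernel_dist_def by (rule member_le_sum) auto
  finally show ?thesis .
qed

lemma kernel_regular_bound:
  fixes K :: "'a::euclidean_space \<Rightarrow> ('n::finite \<Rightarrow> 'a) \<Rightarrow> complex"
  assumes K: "kernel_regular C \<omega> K" "modulus \<omega>" "0 \<le> C" and d: "0 < \<delta>" "\<And>j. \<delta> \<le> norm (x - y j)"
    and h: "norm h \<le> \<eta>" "\<eta> \<le> \<delta> / 2"
  shows "norm (K (x + h) y - K x y) + (\<Sum>j\<in>UNIV. norm (K x (y(j := y j + h)) - K x y))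
     \<le> C / \<delta> ^ (CARD('n) * DIM('a)) * \<omega> (\<eta> / \<delta>)"
proof -
  let ?N = "CARD('n) * DIM('a)"
  have kd: "\<delta> \<le> kernel_dist x y" using kernel_dist_ge d(2) by blast
  have off: "off_diag x y" unfolding off_diag_def using d by (metis norm_zero not_le right_minus_eq)
  have "norm (x - y undefined) \<le> Max (range (\<lambda>j. norm (x - y j)))" by (rule Max_ge) auto
  then have "\<delta> \<le> Max (range (\<lambda>j. norm (x - y j)))" using d(2) order_trans by blast
  then have "norm h \<le> 1 / 2 * Max (range (\<lambda>j. norm (x - y j)))" using h by linarith
  then have "norm (K (x + h) y - K x y) + (\<Sum>j\<in>UNIV. norm (K x (y(j := y j + h)) - K x y))
     \<le> C / kernel_dist x y ^ ?N * \<omega> (norm h / kernel_dist x y)"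
    using K(1) off unfolding kernel_regular_def by blast
  also have "\<dots> \<le> C / \<delta> ^ ?N * \<omega> (\<eta> / \<delta>)"
  proof (rule mult_mono)
    show "C / kernel_dist x y ^ ?N \<le> C / \<delta> ^ ?N"
      using kd d(1) K(3) by (intro divide_left_mono power_mono mult_pos_pos zero_less_power) auto
    show "\<omega> (norm h / kernel_dist x y) \<le> \<omega> (\<eta> / \<delta>)"
      using kd d(1) h order_trans[OF norm_ge_zero h(1)] by (intro modulus_mono[OF K(2)] frac_le) auto
    show "0 \<le> \<omega> (norm h / kernel_dist x y)" using kd d(1) by (intro modulus_nonneg[OF K(2)]) auto
  qed (use K d in auto)
  finally show ?thesis .
qed

lemma kernel_base_change:
  fixes K :: "'a::euclidean_space \<Rightarrow> ('n::finite \<Rightarrow> 'a) \<Rightarrow> complex"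
  assumes "kernel_regular C \<omega> K" "modulus \<omega>" "0 \<le> C" "0 < \<delta>" "\<And>j. \<delta> \<le> norm (x - y j)"
    and "norm (x' - x) \<le> \<eta>" "\<eta> \<le> \<delta> / 2"
  shows "norm (K x' y - K x y) \<le> C / \<delta> ^ (CARD('n) * DIM('a)) * \<omega> (\<eta> / \<delta>)"
proof -
  have "norm (K (x + (x' - x)) y - K x y) \<le> norm (K (x + (x' - x)) y - K x y) + (\<Sum>j\<in>UNIV. norm (K x (y(j := y j + (x' - x))) - K x y))"
    by (simp add: sum_nonneg)
  then show ?thesis using kernel_regular_bound[where y = y and h = "x' - x", OF assms] by simp
qed

text \<open>
  The regularity condition moves one variable at a time; the intermediate tuples take each entry
  from one of the two tuples and therefore stay away from \<open>x\<close>.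
\<close>

lemma kernel_slots_change:
  fixes K :: "'a::euclidean_space \<Rightarrow> ('n::finite \<Rightarrow> 'a) \<Rightarrow> complex"
  assumes "kernel_regular C \<omega> K" "modulus \<omega>" "0 \<le> C" "0 < \<delta>" "\<And>j. \<delta> \<le> norm (x - u j)" "\<And>j. \<delta> \<le> norm (x - v j)"
    and "\<And>j. norm (v j - u j) \<le> \<eta>" "\<eta> \<le> \<delta> / 2"
  shows "norm (K x v - K x u) \<le> real CARD('n) * (C / \<delta> ^ (CARD('n) * DIM('a)) * \<omega> (\<eta> / \<delta>))"
proof -
  define B where "B = C / \<delta> ^ (CARD('n) * DIM('a)) * \<omega> (\<eta> / \<delta>)"
  have "norm (K x (override_on u v J) - K x u) \<le> real (card J) * B" for J
  proof (induction J rule: finite_induct[OF finite])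
    case 1 then show ?case by simp
  next
    case (2 j J)
    let ?w = "override_on u v J"
    have far: "\<delta> \<le> norm (x - ?w l)" for l using assms(5,6) by (simp add: override_on_def)
    have eq: "override_on u v (insert j J) = ?w(j := ?w j + (v j - u j))"
      using 2(2) by (auto simp: override_on_def fun_eq_iff)
    have "norm (K x (?w(j := ?w j + (v j - u j))) - K x ?w) \<le>
        norm (K (x + (v j - u j)) ?w - K x ?w) + (\<Sum>l\<in>UNIV. norm (K x (?w(l := ?w l + (v j - u j))) - K x ?w))"
      using member_le_sum[of j UNIV "\<lambda>l. norm (K x (?w(l := ?w l + (v j - u j))) - K x ?w)"]
      by (simp add: add_increasing)
    also have "\<dots> \<le> B" unfolding B_def using kernel_regular_bound[OF assms(1-4) far assms(7,8)] .
    finally have "norm (K x (override_on u v (insert j J)) - K x u) \<le> B + real (card J) * B"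
      unfolding eq using 2(3) norm_triangle_ineq[of "K x (?w(j := ?w j + (v j - u j))) - K x ?w" "K x ?w - K x u"] by simp
    then show ?case using 2 by (simp add: algebra_simps)
  qed
  from this[of UNIV] show ?thesis by (simp add: override_on_def B_def)
qed

lemma kernel_continuous_slots:
  fixes K :: "'a::euclidean_space \<Rightarrow> ('n::finite \<Rightarrow> 'a) \<Rightarrow> complex"
  assumes K: "kernel_regular C \<omega> K" "modulus \<omega>" "0 \<le> C" and d: "0 < \<delta>" "\<And>z. z \<in> S \<Longrightarrow> \<delta> \<le> norm (x - z)"
  shows "continuous_on {y. \<forall>j. y j \<in> S} (K x)"
  unfolding continuous_on_sequentially
proof (intro allI ballI impI)
  fix s :: "nat \<Rightarrow> 'n \<Rightarrow> 'a" and a assume "a \<in> {y. \<forall>j. y j \<in> S}" and "(\<forall>n. s n \<in> {y. \<forall>j. y j \<in> S}) \<and> s \<longlonglongrightarrow> a"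
  then have a: "a j \<in> S" and s: "s n j \<in> S" and lim: "s \<longlonglongrightarrow> a" for j n by auto
  have lim_j: "(\<lambda>n. s n j) \<longlonglongrightarrow> a j" for j
  proof -
    have "continuous_on UNIV (\<lambda>y :: 'n \<Rightarrow> 'a. y j)" by (rule continuous_on_product_coordinates)
    then have "isCont (\<lambda>y :: 'n \<Rightarrow> 'a. y j) a" unfolding continuous_on_eq_continuous_at[OF open_UNIV] by blast
    then show ?thesis using isCont_tendsto_compose lim by blast
  qed
  define \<eta> where "\<eta> n = (\<Sum>j\<in>UNIV. norm (s n j - a j))" for n
  have "\<eta> \<longlonglongrightarrow> (\<Sum>j\<in>(UNIV::'n set). 0)"
    unfolding \<eta>_def by (intro tendsto_sum tendsto_norm_zero) (use lim_j LIM_zero in blast)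
  then have \<eta>: "\<eta> \<longlonglongrightarrow> 0" by simp
  have \<eta>j: "norm (s n j - a j) \<le> \<eta> n" for n j unfolding \<eta>_def by (rule member_le_sum) auto
  let ?N = "CARD('n) * DIM('a)"
  show "(K x \<circ> s) \<longlonglongrightarrow> K x a"
  proof (rule LIMSEQ_I)
    fix e :: real assume e: "0 < e"
    define M where "M = real CARD('n) * (C / \<delta> ^ ?N) + 1"
    have M: "M > 0" using K(3) d(1) unfolding M_def by (simp add: add_nonneg_pos)
    obtain t where t: "0 < t" "\<omega> t < e / M" using modulus_small[OF K(2)] e M by (metis divide_pos_pos)
    have "\<forall>\<^sub>F n in sequentially. \<eta> n < min (\<delta> / 2) (t * \<delta>)"
      using \<eta> d t by (intro order_tendstoD(2)) auto
    then obtain n0 where n0: "\<And>n. n \<ge> n0 \<Longrightarrow> \<eta> n < min (\<delta> / 2) (t * \<delta>)" by (auto simp: eventually_sequentially)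
    show "\<exists>n0. \<forall>n\<ge>n0. norm ((K x \<circ> s) n - K x a) < e"
    proof (intro exI allI impI)
      fix n assume n: "n \<ge> n0"
      have "norm (K x (s n) - K x a) \<le> real CARD('n) * (C / \<delta> ^ ?N * \<omega> (\<eta> n / \<delta>))"
        by (rule kernel_slots_change[OF K d(1)]) (use d(2) a s \<eta>j n0[OF n] in \<open>auto simp: less_imp_le\<close>)
      also have "\<dots> \<le> M * \<omega> t"
      proof -
        have 0: "0 \<le> \<eta> n" unfolding \<eta>_def by (simp add: sum_nonneg)
        have "\<omega> (\<eta> n / \<delta>) \<le> \<omega> t" using 0 n0[OF n] d(1) by (intro modulus_mono[OF K(2)]) (auto simp: field_simps)
        moreover have "0 \<le> \<omega> (\<eta> n / \<delta>)" using 0 d(1) by (intro modulus_nonneg[OF K(2)]) auto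
        ultimately have "(real CARD('n) * (C / \<delta> ^ ?N)) * \<omega> (\<eta> n / \<delta>) \<le> M * \<omega> t"
          using K(3) d(1) M by (intro mult_mono) (auto simp: M_def)
        then show ?thesis by (simp only: mult.assoc)
      qed
      also have "\<dots> < e" using t M by (simp add: field_simps)
      finally show "norm ((K x \<circ> s) n - K x a) < e" by simp
    qed
  qed
qed

lemma sets_PiM_lborel: "sets (\<Pi>\<^sub>M j\<in>(UNIV::'n::finite set). (lborel::'a::euclidean_space measure)) = sets borel"
proof -
  have "sets (\<Pi>\<^sub>M j\<in>(UNIV::'n set). (lborel::'a measure)) = sets (\<Pi>\<^sub>M j\<in>(UNIV::'n set). (borel::'a measure))"
    by (intro sets_PiM_cong) auto
  then show ?thesis using sets_PiM_equal_borel by simp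
qed

text \<open>
  The regularity condition makes the kernel continuous in its slots away from \<open>x\<close>,
  and continuity for the product topology gives measurability for the product measure. Without
  measurability the integral in the representation formula would have the default value 0 and
  carry no information.
\<close>

lemma kernel_slots_measurable:
  fixes K :: "'a::euclidean_space \<Rightarrow> ('n::finite \<Rightarrow> 'a) \<Rightarrow> complex"
  assumes K: "kernel_regular C \<omega> K" "modulus \<omega>" "0 \<le> C" and S: "closed S" "x \<notin> S"
  shows "(\<lambda>y. indicator {y. \<forall>j. y j \<in> S} y *\<^sub>R K x y) \<in> borel_measurable (\<Pi>\<^sub>M j\<in>UNIV. lborel)"
proof -
  obtain \<delta> where d: "0 < \<delta>" "\<And>z. z \<in> S \<Longrightarrow> \<delta> \<le> dist x z"
    using separate_point_closed[OF S] by blast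
  have "continuous_on {y. \<forall>j. y j \<in> S} (K x)"
    by (rule kernel_continuous_slots[OF K d(1)]) (use d(2) in \<open>simp add: dist_norm\<close>)
  moreover have "closed {y :: 'n \<Rightarrow> 'a. \<forall>j. y j \<in> S}"
  proof (intro closed_Collect_all)
    fix j
    have "closed ((\<lambda>y :: 'n \<Rightarrow> 'a. y j) -` S)"
      by (rule closed_vimage[OF S(1)]) (rule continuous_on_product_coordinates)
    then show "closed {y :: 'n \<Rightarrow> 'a. y j \<in> S}" by (simp add: vimage_def)
  qed
  ultimately have "(\<lambda>y. indicator {y. \<forall>j. y j \<in> S} y *\<^sub>R K x y) \<in> borel_measurable borel"
    by (intro borel_measurable_continuous_on_indicator) auto
  then show ?thesis using measurable_cong_sets[OF sets_PiM_lborel refl] by blast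
qed

interpretation lborel_product: product_sigma_finite "\<lambda>_::'n. lborel :: 'a::euclidean_space measure"
  by standard

lemma norm_integral_le:
  fixes f :: "'b \<Rightarrow> 'c::{banach, second_countable_topology}"
  assumes "integrable M f" "integrable M g" "\<And>x. norm (f x) \<le> g x"
  shows "norm (\<integral>x. f x \<partial>M) \<le> (\<integral>x. g x \<partial>M)"
proof -
  have "norm (\<integral>x. f x \<partial>M) \<le> (\<integral>x. norm (f x) \<partial>M)" by (rule integral_norm_bound)
  also have "\<dots> \<le> (\<integral>x. g x \<partial>M)" using assms by (intro integral_mono) auto
  finally show ?thesis .
qed

text \<open>
  If the kernel is within \<open>\<epsilon>\<close> of \<open>\<kappa>\<close>, then integrating
  a product of functions against it is, up to the error \<open>\<epsilon>\<close>, multiplying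
  their integrals by \<open>\<kappa>\<close>.
\<close>

lemma kernel_integral_estimate:
  fixes K :: "'a::euclidean_space \<Rightarrow> ('n::finite \<Rightarrow> 'a) \<Rightarrow> complex"
  assumes K: "kernel_regular C \<omega> K" "modulus \<omega>" "0 \<le> C" and S: "closed S" "x \<notin> S"
    and \<phi>: "\<And>j. integrable lborel (\<phi> j)" "\<And>j y. y \<notin> S \<Longrightarrow> \<phi> j y = 0"
    and const: "\<And>y. (\<forall>j. y j \<in> S) \<Longrightarrow> norm (K x y - \<kappa>) \<le> \<epsilon>"
  shows "integrable (\<Pi>\<^sub>M j\<in>UNIV. lborel) (\<lambda>y. K x y * (\<Prod>j\<in>UNIV. \<phi> j (y j)))"
    and "norm ((\<integral>y. K x y * (\<Prod>j\<in>UNIV. \<phi> j (y j)) \<partial>(\<Pi>\<^sub>M j\<in>UNIV. lborel)) - \<kappa> * (\<Prod>j\<in>UNIV. \<integral>y. \<phi> j y \<partial>lborel))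
       \<le> \<epsilon> * (\<Prod>j\<in>UNIV. \<integral>y. norm (\<phi> j y) \<partial>lborel)"
proof -
  let ?P = "\<Pi>\<^sub>M j\<in>(UNIV::'n set). (lborel :: 'a measure)"
  let ?f = "\<lambda>y. \<Prod>j\<in>UNIV. \<phi> j (y j)"
  let ?I = "indicator {y. \<forall>j. y j \<in> S} :: ('n \<Rightarrow> 'a) \<Rightarrow> real"
  have f: "integrable ?P ?f" using \<phi>(1) by (intro lborel_product.product_integrable_prod) auto
  have zero: "?f y = 0" if out: "\<not> (\<forall>j. y j \<in> S)" for y
  proof -
    obtain j where "y j \<notin> S" using out by blast
    then have "\<phi> j (y j) = 0" by (rule \<phi>(2))
    then show ?thesis by (intro prod_zero) auto
  qed
  have eq: "K x y * ?f y = (?I y *\<^sub>R K x y) * ?f y" for y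
  proof (cases "\<forall>j. y j \<in> S")
    case False
    show ?thesis unfolding zero[OF False] by simp
  qed simp
  have meas: "(\<lambda>y. (?I y *\<^sub>R K x y) * ?f y) \<in> borel_measurable ?P"
    using kernel_slots_measurable[OF K S] f by (intro borel_measurable_times) auto
  have "(\<lambda>y. (?I y *\<^sub>R K x y) * ?f y) = (\<lambda>y. K x y * ?f y)" by (rule ext) (rule eq[symmetric])
  with meas have meas: "(\<lambda>y. K x y * ?f y) \<in> borel_measurable ?P" by (simp only:)
  have bd: "norm (K x y * ?f y) \<le> norm ((norm \<kappa> + \<epsilon>) * norm (?f y))" for y
  proof (cases "\<forall>j. y j \<in> S")
    case True
    have "norm (K x y) \<le> norm \<kappa> + \<epsilon>" using const[of y] True norm_triangle_sub[of "K x y" \<kappa>] by simp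
    then have "norm (K x y * ?f y) \<le> (norm \<kappa> + \<epsilon>) * norm (?f y)" unfolding norm_mult by (intro mult_right_mono) auto
    then show ?thesis by simp
  qed (simp add: zero)
  show i: "integrable ?P (\<lambda>y. K x y * ?f y)"
    by (rule Bochner_Integration.integrable_bound[of _ "\<lambda>y. (norm \<kappa> + \<epsilon>) * norm (?f y)"])
      (use f meas bd in \<open>auto intro!: AE_I2\<close>)
  have "(\<integral>y. K x y * ?f y \<partial>?P) - \<kappa> * (\<Prod>j\<in>UNIV. \<integral>y. \<phi> j y \<partial>lborel) = (\<integral>y. K x y * ?f y - \<kappa> * ?f y \<partial>?P)"
    using i f \<phi>(1) by (simp add: lborel_product.product_integral_prod)
  also have "norm \<dots> \<le> (\<integral>y. \<epsilon> * norm (?f y) \<partial>?P)"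
  proof (rule norm_integral_le)
    fix y
    show "norm (K x y * ?f y - \<kappa> * ?f y) \<le> \<epsilon> * norm (?f y)"
    proof (cases "\<forall>j. y j \<in> S")
      case True
      then have "norm (K x y - \<kappa>) * norm (?f y) \<le> \<epsilon> * norm (?f y)" using const by (intro mult_right_mono) auto
      then show ?thesis by (simp add: norm_mult[symmetric] left_diff_distrib)
    qed (simp add: zero)
  qed (use i f in auto)
  also have "\<dots> = \<epsilon> * (\<integral>y. (\<Prod>j\<in>UNIV. norm (\<phi> j (y j))) \<partial>?P)" by (simp add: prod_norm)
  also have "(\<integral>y. (\<Prod>j\<in>UNIV. norm (\<phi> j (y j))) \<partial>?P) = (\<Prod>j\<in>UNIV. \<integral>y. norm (\<phi> j y) \<partial>lborel)"
    using \<phi>(1) by (intro lborel_product.product_integral_prod) auto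
  finally show "norm ((\<integral>y. K x y * ?f y \<partial>?P) - \<kappa> * (\<Prod>j\<in>UNIV. \<integral>y. \<phi> j y \<partial>lborel))
     \<le> \<epsilon> * (\<Prod>j\<in>UNIV. \<integral>y. norm (\<phi> j y) \<partial>lborel)" .
qed

lemma L1_tendsto_integral:
  fixes f :: "'b \<Rightarrow> complex"
  assumes "\<And>s. integrable M (\<phi> s)" "integrable M f" "(\<lambda>s. \<integral>x. norm (\<phi> s x - f x) \<partial>M) \<longlonglongrightarrow> 0"
  shows "(\<lambda>s. \<integral>x. \<phi> s x \<partial>M) \<longlonglongrightarrow> (\<integral>x. f x \<partial>M)" "(\<lambda>s. \<integral>x. norm (\<phi> s x) \<partial>M) \<longlonglongrightarrow> (\<integral>x. norm (f x) \<partial>M)"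
proof -
  have "norm ((\<integral>x. \<phi> s x \<partial>M) - (\<integral>x. f x \<partial>M)) \<le> (\<integral>x. norm (\<phi> s x - f x) \<partial>M)" for s
    using assms(1,2) integral_norm_bound[of M "\<lambda>x. \<phi> s x - f x"] by simp
  then show "(\<lambda>s. \<integral>x. \<phi> s x \<partial>M) \<longlonglongrightarrow> (\<integral>x. f x \<partial>M)"
    by (intro LIM_zero_cancel[OF Lim_null_comparison[OF always_eventually assms(3)]]) auto
  have "norm ((\<integral>x. norm (\<phi> s x) \<partial>M) - (\<integral>x. norm (f x) \<partial>M)) \<le> (\<integral>x. norm (\<phi> s x - f x) \<partial>M)" for s
  proof -
    have "norm (\<integral>x. norm (\<phi> s x) - norm (f x) \<partial>M) \<le> (\<integral>x. norm (\<phi> s x - f x) \<partial>M)"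
      using assms(1,2) by (intro norm_integral_le) (auto simp: norm_triangle_ineq3)
    then show ?thesis using assms(1,2) by simp
  qed
  then show "(\<lambda>s. \<integral>x. norm (\<phi> s x) \<partial>M) \<longlonglongrightarrow> (\<integral>x. norm (f x) \<partial>M)"
    by (intro LIM_zero_cancel[OF Lim_null_comparison[OF always_eventually assms(3)]]) auto
qed

text \<open>
  Smooth functions that approximate the entries \<open>b\<^sup>m f\<^sub>i\<close> and
  \<open>f\<^sub>j\<close> are inserted into the binomial expansion. For fixed \<open>x\<close>
  the expansion is then one integral against the kernel, whose \<open>i\<close>-th entry is
  close to \<open>(b x - b)\<^sup>k f\<^sub>i\<close>, and the estimate for an almost constant
  kernel passes to the limit. The approximants do not depend on \<open>x\<close>, so that only
  countably many exceptional null sets occur.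
\<close>

proposition commutator_off_support_estimate:
  fixes T :: "('n::finite, 'a::euclidean_space) operator" and K :: "'a \<Rightarrow> ('n \<Rightarrow> 'a) \<Rightarrow> complex"
  assumes K: "kernel_regular C \<omega> K" "modulus \<omega>" "0 \<le> C" and rep: "kernel_represents K T" and ext: "off_support_extension T"
    and f: "f \<in> commutator_domain i k b" "\<And>j y. y \<notin> cbox u v \<Longrightarrow> f j y = 0"
    and X: "\<And>x. x \<in> X \<Longrightarrow> x \<notin> cbox u v"
    and const: "\<And>x y. x \<in> X \<Longrightarrow> (\<forall>j. y j \<in> cbox u v) \<Longrightarrow> norm (K x y - \<kappa>) \<le> \<epsilon>"
  shows "AE x in lebesgue. x \<in> X \<longrightarrow>
    norm (iterated_commutator i k b T f x - \<kappa> * ((\<Prod>j\<in>UNIV - {i}. \<integral>y. f j y \<partial>lebesgue) * (\<integral>y. (b x - b y) ^ k * f i y \<partial>lebesgue)))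
     \<le> \<epsilon> * ((\<Prod>j\<in>UNIV - {i}. \<integral>y. norm (f j y) \<partial>lebesgue) * (\<integral>y. norm ((b x - b y) ^ k * f i y) \<partial>lebesgue))"
proof -
  let ?Q = "cbox u v"
  define F where "F m = f(i := \<lambda>y. b y ^ m * f i y)" for m
  have FL: "F m j \<in> L1_c" if "m \<le> k" for m j
    using f(1) that unfolding commutator_domain_def F_def by auto
  have Fi: "integrable lebesgue (F m j)" if "m \<le> k" for m j using FL[OF that, of j] by (simp add: L1_c_def)
  have F0: "F m j y = 0" if "y \<notin> ?Q" for m j y using f(2)[OF that] by (simp add: F_def)
  define approx where "approx m j \<phi> \<longleftrightarrow> (\<forall>s. \<phi> s \<in> Cc_inf \<and> spt (\<phi> s) \<subseteq> ?Q) \<and>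
      (\<lambda>s::nat. \<integral>x. norm (\<phi> s x - F m j x) \<partial>lebesgue) \<longlonglongrightarrow> 0" for m j \<phi>
  have "\<exists>\<phi>. approx m j \<phi>" if m: "m \<le> k" for m j
    unfolding approx_def
  proof (rule L1_smooth_sequence[OF Fi[OF m] F0])
    fix \<phi> assume h: "\<And>s. \<phi> s \<in> Cc_inf" "\<And>s. spt (\<phi> s) \<subseteq> ?Q" "(\<lambda>s. \<integral>x. norm (\<phi> s x - F m j x) \<partial>lebesgue) \<longlonglongrightarrow> 0"
    show "\<exists>\<phi>. (\<forall>s. \<phi> s \<in> Cc_inf \<and> spt (\<phi> s) \<subseteq> ?Q) \<and> (\<lambda>s::nat. \<integral>x. norm (\<phi> s x - F m j x) \<partial>lebesgue) \<longlonglongrightarrow> 0"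
      by (rule exI[of _ \<phi>]) (intro conjI allI h)
  qed
  then obtain \<Phi> where "\<And>m j. m \<le> k \<Longrightarrow> approx m j (\<Phi> m j)" by metis
  then have \<Phi>: "\<Phi> m j s \<in> Cc_inf" "spt (\<Phi> m j s) \<subseteq> ?Q"
    "(\<lambda>s. \<integral>x. norm (\<Phi> m j s x - F m j x) \<partial>lebesgue) \<longlonglongrightarrow> 0" if "m \<le> k" for m j s
    using that unfolding approx_def by blast+
  define \<phi> where "\<phi> m s = (\<lambda>j. if j = i then \<Phi> m i s else \<Phi> 0 j s)" for m s
  have F0j: "F m j = F 0 j" if "j \<noteq> i" for m j using that by (simp add: F_def)
  have \<phi>: "\<phi> m s j \<in> Cc_inf" "spt (\<phi> m s j) \<subseteq> ?Q" "(\<lambda>s. \<integral>x. norm (\<phi> m s j x - F m j x) \<partial>lebesgue) \<longlonglongrightarrow> 0"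
    if "m \<le> k" for m s j
  proof -
    show "\<phi> m s j \<in> Cc_inf" "spt (\<phi> m s j) \<subseteq> ?Q" unfolding \<phi>_def using \<Phi>(1,2) that by auto
    show "(\<lambda>s. \<integral>x. norm (\<phi> m s j x - F m j x) \<partial>lebesgue) \<longlonglongrightarrow> 0"
    proof (cases "j = i")
      case True then show ?thesis using \<Phi>(3)[OF that, of i] by (simp add: \<phi>_def)
    next
      case False then show ?thesis using \<Phi>(3)[of 0 j] F0j[OF False, of m] by (simp add: \<phi>_def)
    qed
  qed
  have A: "AE x in lebesgue. \<forall>m\<in>{..k}. x \<notin> ?Q \<longrightarrow> (\<lambda>s. T (\<phi> m s) x) \<longlonglongrightarrow> T (F m) x"
  proof (rule AE_finite_allI)
    fix m assume "m \<in> {..k}"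
    then have m: "m \<le> k" by simp
    have 1: "(\<forall>j. F m j \<in> L1_c) \<and> (\<forall>j. compact ?Q) \<and> (\<forall>s j. \<phi> m s j \<in> Cc_inf \<and> spt (\<phi> m s j) \<subseteq> ?Q) \<and>
      (\<forall>j. (\<lambda>s. \<integral>x. norm (\<phi> m s j x - F m j x) \<partial>lebesgue) \<longlonglongrightarrow> 0)"
      by (intro conjI allI FL[OF m] \<phi>[OF m] compact_cbox)
    have "AE x in lebesgue. x \<notin> (\<Inter>j\<in>(UNIV::'n set). ?Q) \<longrightarrow> (\<lambda>s. T (\<phi> m s) x) \<longlonglongrightarrow> T (F m) x"
      by (rule mp[OF ext[unfolded off_support_extension_def, THEN spec[of _ "F m"], THEN spec[of _ "\<phi> m"], THEN spec[of _ "\<lambda>_. ?Q"]] 1])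
    then show "AE x in lebesgue. x \<notin> ?Q \<longrightarrow> (\<lambda>s. T (\<phi> m s) x) \<longlonglongrightarrow> T (F m) x" by simp
  qed simp
  have B: "AE x in lebesgue. \<forall>s. \<forall>m\<in>{..k}. x \<notin> ?Q \<longrightarrow>
      T (\<phi> m s) x = (\<integral>y. K x y * (\<Prod>j\<in>UNIV. \<phi> m s j (y j)) \<partial>(\<Pi>\<^sub>M j\<in>UNIV. lborel))"
    unfolding AE_all_countable
  proof (intro allI AE_finite_allI)
    fix s m assume "m \<in> {..k}"
    then have "AE x in lebesgue. x \<notin> (\<Inter>j. spt (\<phi> m s j)) \<longrightarrow>
        T (\<phi> m s) x = (\<integral>y. K x y * (\<Prod>j\<in>UNIV. \<phi> m s j (y j)) \<partial>(\<Pi>\<^sub>M j\<in>UNIV. lborel))"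
      using rep \<phi>(1) unfolding kernel_represents_def by blast
    then show "AE x in lebesgue. x \<notin> ?Q \<longrightarrow>
        T (\<phi> m s) x = (\<integral>y. K x y * (\<Prod>j\<in>UNIV. \<phi> m s j (y j)) \<partial>(\<Pi>\<^sub>M j\<in>UNIV. lborel))"
      by eventually_elim (use \<phi>(2)[of m s i] \<open>m \<in> {..k}\<close> in auto)
  qed simp
  show ?thesis using A B
  proof eventually_elim
    case (elim x)
    show ?case
    proof
      assume xX: "x \<in> X"
      have xQ: "x \<notin> ?Q" using X xX by blast
      define c where "c m = of_nat (k choose m) * (-1) ^ m * b x ^ (k - m)" for m
      \<comment> \<open>For fixed \<open>x\<close> the binomial sum of tuples is one tuple with
        this function as its \<open>i\<close>-th entry.\<close>
      define g where "g s y = (\<Sum>m\<le>k. c m * \<phi> m s i y)" for s y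
      define G where "G y = (\<Sum>m\<le>k. c m * F m i y)" for y
      have G: "G y = (b x - b y) ^ k * f i y" for y
        unfolding G_def c_def F_def binomial_difference[symmetric] by (simp add: sum_distrib_right mult.assoc)
      define \<psi> where "\<psi> s = (\<lambda>j. if j = i then g s else \<Phi> 0 j s)" for s
      have \<phi>int: "integrable lebesgue (\<phi> m s j)" "integrable lborel (\<phi> m s j)" "\<phi> m s j \<in> borel_measurable borel" if "m \<le> k" for m s j
        using Cc_inf_integrable[OF \<phi>(1)[OF that, of s j]] by (auto simp: integrable_completion)
      have gint: "integrable lebesgue (g s)" "integrable lborel (g s)" "g s \<in> borel_measurable borel" for s
        unfolding g_def[abs_def] using \<phi>int by auto
      have \<psi>int: "integrable lborel (\<psi> s j)" "\<psi> s j \<in> borel_measurable borel" "integrable lebesgue (\<psi> s j)" for s j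
        using gint[of s] \<phi>int[of 0 s j] by (auto simp: \<psi>_def \<phi>_def split: if_splits)
      have \<phi>zero: "\<phi> m s j y = 0" if "y \<notin> ?Q" "m \<le> k" for m s j y
        using zero_outside_spt[OF \<phi>(2)[OF that(2)] that(1)] .
      have \<psi>zero: "\<psi> s j y = 0" if "y \<notin> ?Q" for s j y
      proof (cases "j = i")
        case True
        have "g s y = (\<Sum>m\<le>k. c m * 0)" unfolding g_def by (intro sum.cong) (use \<phi>zero[OF that] in auto)
        then show ?thesis using True by (simp add: \<psi>_def)
      next
        case False
        then show ?thesis using \<phi>zero[OF that, of 0 s j] by (simp add: \<psi>_def \<phi>_def)
      qed
      have est: "norm ((\<Sum>m\<le>k. c m * T (\<phi> m s) x) - \<kappa> * (\<Prod>j\<in>UNIV. \<integral>y. \<psi> s j y \<partial>lebesgue))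
          \<le> \<epsilon> * (\<Prod>j\<in>UNIV. \<integral>y. norm (\<psi> s j y) \<partial>lebesgue)" for s
      proof -
        let ?P = "\<Pi>\<^sub>M j\<in>(UNIV::'n set). (lborel :: 'a measure)"
        have factor: "(\<Prod>j\<in>UNIV. h j) = h i * (\<Prod>j\<in>UNIV - {i}. h j)" for h :: "'n \<Rightarrow> complex"
          by (rule prod.remove) auto
        have "(\<Sum>m\<le>k. c m * T (\<phi> m s) x) = (\<Sum>m\<le>k. c m * (\<integral>y. K x y * (\<Prod>j\<in>UNIV. \<phi> m s j (y j)) \<partial>?P))"
          using elim(2) xQ by (intro sum.cong) auto
        also have "\<dots> = (\<integral>y. (\<Sum>m\<le>k. c m * (K x y * (\<Prod>j\<in>UNIV. \<phi> m s j (y j)))) \<partial>?P)"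
        proof -
          have "integrable ?P (\<lambda>y. K x y * (\<Prod>j\<in>UNIV. \<phi> m s j (y j)))" if "m \<le> k" for m
            by (rule kernel_integral_estimate(1)[OF K closed_cbox xQ, where \<kappa> = \<kappa> and \<epsilon> = \<epsilon>])
              (use \<phi>int(2) \<phi>zero const[OF xX] that in auto)
          then show ?thesis by (subst Bochner_Integration.integral_sum) auto
        qed
        also have "\<dots> = (\<integral>y. K x y * (\<Prod>j\<in>UNIV. \<psi> s j (y j)) \<partial>?P)"
        proof (rule Bochner_Integration.integral_cong[OF refl])
          fix y :: "'n \<Rightarrow> 'a"
          define R where "R = (\<Prod>j\<in>UNIV - {i}. \<Phi> 0 j s (y j))"
          have "(\<Prod>j\<in>UNIV - {i}. \<phi> m s j (y j)) = R" for m
            unfolding R_def by (intro prod.cong) (auto simp: \<phi>_def)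
          then have 1: "(\<Prod>j\<in>UNIV. \<phi> m s j (y j)) = \<phi> m s i (y i) * R" for m
            using factor[of "\<lambda>j. \<phi> m s j (y j)"] by simp
          have "(\<Prod>j\<in>UNIV - {i}. \<psi> s j (y j)) = R"
            unfolding R_def by (intro prod.cong) (auto simp: \<psi>_def)
          then have 2: "(\<Prod>j\<in>UNIV. \<psi> s j (y j)) = g s (y i) * R"
            using factor[of "\<lambda>j. \<psi> s j (y j)"] by (simp add: \<psi>_def)
          have "(\<Sum>m\<le>k. c m * (K x y * (\<phi> m s i (y i) * R))) = (\<Sum>m\<le>k. (K x y * R) * (c m * \<phi> m s i (y i)))"
            by (intro sum.cong) (auto simp: mult_ac)
          also have "\<dots> = K x y * (g s (y i) * R)" unfolding g_def sum_distrib_left[symmetric] by (simp only: mult_ac)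
          finally show "(\<Sum>m\<le>k. c m * (K x y * (\<Prod>j\<in>UNIV. \<phi> m s j (y j)))) = K x y * (\<Prod>j\<in>UNIV. \<psi> s j (y j))"
            unfolding 1 2 .
        qed
        finally have eq: "(\<Sum>m\<le>k. c m * T (\<phi> m s) x) = (\<integral>y. K x y * (\<Prod>j\<in>UNIV. \<psi> s j (y j)) \<partial>?P)" .
        have "norm ((\<integral>y. K x y * (\<Prod>j\<in>UNIV. \<psi> s j (y j)) \<partial>?P) - \<kappa> * (\<Prod>j\<in>UNIV. \<integral>y. \<psi> s j y \<partial>lborel))
           \<le> \<epsilon> * (\<Prod>j\<in>UNIV. \<integral>y. norm (\<psi> s j y) \<partial>lborel)"
          by (rule kernel_integral_estimate(2)[OF K closed_cbox xQ]) (use \<psi>int \<psi>zero const[OF xX] in auto)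
        moreover have "(\<integral>y. \<psi> s j y \<partial>lborel) = (\<integral>y. \<psi> s j y \<partial>lebesgue)"
          "(\<integral>y. norm (\<psi> s j y) \<partial>lborel) = (\<integral>y. norm (\<psi> s j y) \<partial>lebesgue)" for j
          using \<psi>int(2)[of s j] by (simp_all add: integral_completion)
        ultimately show ?thesis unfolding eq by simp
      qed
      define H where "H j = (if j = i then G else f j)" for j
      have Gi: "integrable lebesgue G" unfolding G_def[abs_def] using Fi by auto
      have Hint: "integrable lebesgue (H j)" for j
        using Gi Fi[of 0 j] by (auto simp: H_def F_def split: if_splits)
      have conv: "(\<lambda>s. \<integral>y. norm (\<psi> s j y - H j y) \<partial>lebesgue) \<longlonglongrightarrow> 0" for j
      proof (cases "j = i")
        case False
        then show ?thesis using \<phi>(3)[of 0 j] by (simp add: \<psi>_def \<phi>_def H_def F_def)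
      next
        case True
        have "(\<lambda>s. \<Sum>m\<le>k. norm (c m) * (\<integral>y. norm (\<phi> m s i y - F m i y) \<partial>lebesgue)) \<longlonglongrightarrow> (\<Sum>m\<le>k. norm (c m) * 0)"
          by (intro tendsto_sum tendsto_mult tendsto_const \<phi>(3)) auto
        then have lim: "(\<lambda>s. \<Sum>m\<le>k. norm (c m) * (\<integral>y. norm (\<phi> m s i y - F m i y) \<partial>lebesgue)) \<longlonglongrightarrow> 0" by simp
        have "(\<integral>y. norm (g s y - G y) \<partial>lebesgue) \<le> (\<Sum>m\<le>k. norm (c m) * (\<integral>y. norm (\<phi> m s i y - F m i y) \<partial>lebesgue))" for s
        proof -
          have "(\<integral>y. norm (g s y - G y) \<partial>lebesgue) \<le> (\<integral>y. (\<Sum>m\<le>k. norm (c m) * norm (\<phi> m s i y - F m i y)) \<partial>lebesgue)"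
          proof (rule integral_mono)
            fix y
            have "g s y - G y = (\<Sum>m\<le>k. c m * (\<phi> m s i y - F m i y))"
              by (simp add: g_def G_def sum_subtractf[symmetric] right_diff_distrib)
            also have "norm \<dots> \<le> (\<Sum>m\<le>k. norm (c m * (\<phi> m s i y - F m i y)))" by (rule norm_sum)
            finally show "norm (g s y - G y) \<le> (\<Sum>m\<le>k. norm (c m) * norm (\<phi> m s i y - F m i y))" by (simp add: norm_mult)
          qed (use gint Gi \<phi>int Fi in auto)
          also have "\<dots> = (\<Sum>m\<le>k. norm (c m) * (\<integral>y. norm (\<phi> m s i y - F m i y) \<partial>lebesgue))"
            using \<phi>int Fi by (subst Bochner_Integration.integral_sum) auto
          finally show ?thesis .
        qed
        then have "(\<lambda>s. \<integral>y. norm (g s y - G y) \<partial>lebesgue) \<longlonglongrightarrow> 0"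
          by (intro tendsto_sandwich[OF _ _ tendsto_const lim]) (auto intro!: always_eventually)
        then show ?thesis using True by (simp add: \<psi>_def H_def)
      qed
      have "(\<lambda>s. \<Sum>m\<le>k. c m * T (\<phi> m s) x) \<longlonglongrightarrow> (\<Sum>m\<le>k. c m * T (F m) x)"
        using elim(1) xQ by (intro tendsto_sum tendsto_mult tendsto_const) auto
      also have "(\<Sum>m\<le>k. c m * T (F m) x) = iterated_commutator i k b T f x"
        unfolding iterated_commutator_expand c_def F_def ..
      finally have lim1: "(\<lambda>s. \<Sum>m\<le>k. c m * T (\<phi> m s) x) \<longlonglongrightarrow> iterated_commutator i k b T f x" .
      have "(\<lambda>s. norm ((\<Sum>m\<le>k. c m * T (\<phi> m s) x) - \<kappa> * (\<Prod>j\<in>UNIV. \<integral>y. \<psi> s j y \<partial>lebesgue)))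
          \<longlonglongrightarrow> norm (iterated_commutator i k b T f x - \<kappa> * (\<Prod>j\<in>UNIV. \<integral>y. H j y \<partial>lebesgue))"
        by (intro tendsto_norm tendsto_diff lim1 tendsto_mult tendsto_const tendsto_prod L1_tendsto_integral(1)[OF \<psi>int(3) Hint conv])
      moreover have "(\<lambda>s. \<epsilon> * (\<Prod>j\<in>UNIV. \<integral>y. norm (\<psi> s j y) \<partial>lebesgue)) \<longlonglongrightarrow> \<epsilon> * (\<Prod>j\<in>UNIV. \<integral>y. norm (H j y) \<partial>lebesgue)"
        by (intro tendsto_mult tendsto_const tendsto_prod L1_tendsto_integral(2)[OF \<psi>int(3) Hint conv])
      ultimately have "norm (iterated_commutator i k b T f x - \<kappa> * (\<Prod>j\<in>UNIV. \<integral>y. H j y \<partial>lebesgue))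
          \<le> \<epsilon> * (\<Prod>j\<in>UNIV. \<integral>y. norm (H j y) \<partial>lebesgue)"
        using est by (intro LIMSEQ_le) auto
      moreover have "(\<Prod>j\<in>UNIV. \<integral>y. H j y \<partial>lebesgue) = (\<Prod>j\<in>UNIV - {i}. \<integral>y. f j y \<partial>lebesgue) * (\<integral>y. G y \<partial>lebesgue)"
        by (subst prod.remove[of UNIV i]) (auto simp: H_def mult.commute intro!: prod.cong)
      moreover have "(\<Prod>j\<in>UNIV. \<integral>y. norm (H j y) \<partial>lebesgue) = (\<Prod>j\<in>UNIV - {i}. \<integral>y. norm (f j y) \<partial>lebesgue) * (\<integral>y. norm (G y) \<partial>lebesgue)"
        by (subst prod.remove[of UNIV i]) (auto simp: H_def mult.commute intro!: prod.cong)
      ultimately show "norm (iterated_commutator i k b T f x - \<kappa> * ((\<Prod>j\<in>UNIV - {i}. \<integral>y. f j y \<partial>lebesgue) * (\<integral>y. (b x - b y) ^ k * f i y \<partial>lebesgue)))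
         \<le> \<epsilon> * ((\<Prod>j\<in>UNIV - {i}. \<integral>y. norm (f j y) \<partial>lebesgue) * (\<integral>y. norm ((b x - b y) ^ k * f i y) \<partial>lebesgue))"
        unfolding G by simp
    qed
  qed
qed

section \<open>Norming the functions \<open>(z - b)\<^sup>k\<close> by finitely many multipliers\<close>

lemma norm_power_diff_bound:
  fixes u v :: complex
  assumes "norm u \<le> B" "norm v \<le> B"
  shows "norm (u ^ k - v ^ k) \<le> real k * norm (u - v) * B ^ (k - 1)"
proof (cases k)
  case (Suc n)
  have B: "B \<ge> 0" using assms(1) norm_ge_zero order_trans by blast
  have "u ^ k - v ^ k = (u - v) * (\<Sum>j<Suc n. u ^ j * v ^ (n - j))"
    unfolding Suc using diff_power_eq_sum[of u n v] by simp
  moreover have "norm (\<Sum>j<Suc n. u ^ j * v ^ (n - j)) \<le> (\<Sum>j<Suc n. B ^ n)"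
  proof (rule sum_norm_le)
    fix j assume "j \<in> {..<Suc n}"
    then have "norm (u ^ j * v ^ (n - j)) \<le> B ^ j * B ^ (n - j)"
      unfolding norm_mult norm_power using assms B by (intro mult_mono power_mono) auto
    also have "\<dots> = B ^ n" using \<open>j \<in> {..<Suc n}\<close> by (simp flip: power_add)
    finally show "norm (u ^ j * v ^ (n - j)) \<le> B ^ n" .
  qed
  ultimately have "norm (u ^ k - v ^ k) \<le> norm (u - v) * (\<Sum>j<Suc n. B ^ n)"
    by (simp only: norm_mult) (intro mult_left_mono, auto)
  then show ?thesis using Suc by (simp add: algebra_simps)
qed simp

lemma one_plus_power_le: "0 \<le> (t::real) \<Longrightarrow> (1 + t) ^ k \<le> 2 ^ k * (1 + t ^ k)"
proof -
  assume t: "0 \<le> t"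
  have "(1 + t) ^ k \<le> (2 * max 1 t) ^ k" using t by (intro power_mono) auto
  also have "\<dots> = 2 ^ k * (max 1 t) ^ k" by (simp add: power_mult_distrib)
  also have "(max 1 t) ^ k \<le> 1 + t ^ k" using t by (auto simp: max_def)
  finally show ?thesis by simp
qed

lemma integrable_of_power:
  fixes b :: "'b \<Rightarrow> complex"
  assumes "finite_measure M" "b \<in> borel_measurable M" "integrable M (\<lambda>y. norm (b y) ^ k)"
    and f: "f \<in> borel_measurable M" "\<And>y. norm (f y) \<le> c * (1 + norm (b y) ^ k)"
  shows "integrable M (f :: 'b \<Rightarrow> complex)"
proof -
  interpret finite_measure M by fact
  have 1: "integrable M (\<lambda>y. c * (1 + norm (b y) ^ k))" using assms(3) by auto
  show ?thesis
  proof (rule Bochner_Integration.integrable_bound[OF 1 f(1)], rule AE_I2)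
    show "norm (f y) \<le> norm (c * (1 + norm (b y) ^ k))" for y
      using order_trans[OF f(2)[of y] abs_ge_self] by (simp only: real_norm_def)
  qed
qed

lemma shifted_power_bound:
  fixes b z :: complex
  shows "norm ((z - b) ^ k) \<le> ((1 + norm z) ^ k * 2 ^ k) * (1 + norm b ^ k)"
proof -
  have "norm (z - b) \<le> (1 + norm z) * (1 + norm b)"
    using norm_triangle_ineq4[of z b] by (simp add: algebra_simps) (smt (verit) mult_nonneg_nonneg norm_ge_zero)
  then have "norm ((z - b) ^ k) \<le> ((1 + norm z) * (1 + norm b)) ^ k"
    unfolding norm_power by (intro power_mono) auto
  also have "\<dots> \<le> (1 + norm z) ^ k * (2 ^ k * (1 + norm b ^ k))"
    unfolding power_mult_distrib by (intro mult_left_mono one_plus_power_le) auto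
  finally show ?thesis by (simp add: mult_ac)
qed

lemma integrable_shifted_power:
  fixes b :: "'b \<Rightarrow> complex"
  assumes "finite_measure M" "b \<in> borel_measurable M" "integrable M (\<lambda>y. norm (b y) ^ k)"
    and g: "g \<in> borel_measurable M" "\<And>y. norm (g y) \<le> 1"
  shows "integrable M (\<lambda>y. (g y :: complex) * (z - b y) ^ k)"
proof (rule integrable_of_power[OF assms(1-3)])
  show "norm (g y * (z - b y) ^ k) \<le> ((1 + norm z) ^ k * 2 ^ k) * (1 + norm (b y) ^ k)" for y
    using shifted_power_bound[of z "b y" k] mult_mono[OF g(2)[of y] order_refl, of "norm ((z - b y) ^ k)"]
    by (simp add: norm_mult)
qed (use assms in auto)

lemma integrable_norm_shifted_power:
  fixes b :: "'b \<Rightarrow> complex"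
  assumes "finite_measure M" "b \<in> borel_measurable M" "integrable M (\<lambda>y. norm (b y) ^ k)"
  shows "integrable M (\<lambda>y. norm (z - b y) ^ k)"
  using integrable_norm[OF integrable_shifted_power[OF assms, of "\<lambda>_. 1" z]] by (simp add: norm_power)

text \<open>
  Beyond this radius the function \<open>(z - b)\<^sup>k\<close> is close to the constant
  \<open>z\<^sup>k\<close> in mean, if \<open>b\<close> is normalised so that its
  \<open>k\<close>-th moment is at most 2.
\<close>

definition far_radius :: "nat \<Rightarrow> real" where "far_radius k = 9 * real k * 2 ^ k"
text \<open>
  Below this distance of \<open>z\<close> and \<open>c\<close>, with both in the disc of radius
  \<open>far_radius k\<close>, the functions \<open>(z - b)\<^sup>k\<close> and \<open>(c -
  b)\<^sup>k\<close> differ by at most a quarter in mean.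
\<close>

definition net_mesh :: "nat \<Rightarrow> real" where "net_mesh k = 1 / (12 * real k * far_radius k ^ k * 2 ^ k)"

text \<open>
  For \<open>z\<close> far from the bulk of the values of \<open>b\<close> there is no
  cancellation in \<open>(z - b)\<^sup>k\<close>, and the constant multiplier 1 is good enough.
\<close>

lemma norming_far:
  fixes b :: "'b \<Rightarrow> complex"
  assumes M: "finite_measure M" and b: "b \<in> borel_measurable M" "integrable M (\<lambda>y. norm (b y) ^ k)"
    and m: "m = measure M (space M)" and upper: "(\<integral>y. norm (b y) ^ k \<partial>M) \<le> 2 * m"
    and k: "1 \<le> k" and z: "far_radius k \<le> norm z"
  shows "(\<integral>y. norm (z - b y) ^ k \<partial>M) \<le> 2 * norm (\<integral>y. (z - b y) ^ k \<partial>M)"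
proof -
  interpret finite_measure M by fact
  define r where "r = norm z"
  have r1: "1 \<le> r"
  proof -
    have "1 * 1 \<le> real k * 2 ^ k" using k by (intro mult_mono) auto
    then show ?thesis using z by (simp add: r_def far_radius_def)
  qed
  have i: "integrable M (\<lambda>y. (z - b y) ^ k)"
    using integrable_shifted_power[OF M b, of "\<lambda>_. 1" z] by simp
  have pw: "norm ((z - b y) ^ k - z ^ k) \<le> r ^ (k - 1) * real k * 2 ^ k * (1 + norm (b y) ^ k)" for y
  proof -
    have "norm ((z - b y) ^ k - z ^ k) \<le> real k * norm (z - b y - z) * (r + norm (b y)) ^ (k - 1)"
      using norm_triangle_ineq4[of z "b y"] by (intro norm_power_diff_bound) (auto simp: r_def)
    also have "\<dots> \<le> real k * (1 + norm (b y)) * (r * (1 + norm (b y))) ^ (k - 1)"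
    proof -
      have "norm (b y) \<le> r * norm (b y)" using mult_right_mono[OF r1, of "norm (b y)"] by simp
      then show ?thesis using r1 by (intro mult_mono power_mono) (auto simp: algebra_simps)
    qed
    also have "\<dots> = r ^ (k - 1) * real k * (1 + norm (b y)) ^ k"
      using k by (cases k) (auto simp: power_mult_distrib)
    also have "\<dots> \<le> r ^ (k - 1) * real k * (2 ^ k * (1 + norm (b y) ^ k))"
      using r1 by (intro mult_left_mono one_plus_power_le) auto
    finally show ?thesis by simp
  qed
  have m0: "m \<ge> 0" unfolding m by simp
  have err: "(\<integral>y. norm ((z - b y) ^ k - z ^ k) \<partial>M) \<le> r ^ k * m / 3"
  proof -
    have "(\<integral>y. norm ((z - b y) ^ k - z ^ k) \<partial>M) \<le> (\<integral>y. r ^ (k - 1) * real k * 2 ^ k * (1 + norm (b y) ^ k) \<partial>M)"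
      by (rule integral_mono) (use i b pw in auto)
    also have "\<dots> = r ^ (k - 1) * real k * 2 ^ k * (m + (\<integral>y. norm (b y) ^ k \<partial>M))"
      using b by (simp add: m)
    also have "\<dots> \<le> r ^ (k - 1) * real k * 2 ^ k * (m + 2 * m)"
      using upper r1 by (intro mult_left_mono) auto
    also have "\<dots> = (r ^ (k - 1) * m / 3) * far_radius k" by (simp add: far_radius_def)
    also have "\<dots> \<le> (r ^ (k - 1) * m / 3) * r"
      using z r1 m0 by (intro mult_left_mono) (auto simp: r_def)
    also have "\<dots> = r ^ k * m / 3" using k by (cases k) auto
    finally show ?thesis .
  qed
  have zint: "(\<integral>y. z ^ k \<partial>M) = of_real m * z ^ k" by (simp add: m scaleR_conv_of_real)
  have "norm ((\<integral>y. (z - b y) ^ k \<partial>M) - of_real m * z ^ k) = norm (\<integral>y. (z - b y) ^ k - z ^ k \<partial>M)"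
    using i zint by simp
  also have "\<dots> \<le> r ^ k * m / 3" using integral_norm_bound[of M "\<lambda>y. (z - b y) ^ k - z ^ k"] err by linarith
  finally have "norm (of_real m * z ^ k) - norm (\<integral>y. (z - b y) ^ k \<partial>M) \<le> r ^ k * m / 3"
    using norm_triangle_ineq2[of "of_real m * z ^ k" "\<integral>y. (z - b y) ^ k \<partial>M"] by (simp add: norm_minus_commute)
  then have 1: "norm (\<integral>y. (z - b y) ^ k \<partial>M) \<ge> m * r ^ k * (2/3)"
    using m0 by (simp add: norm_mult norm_power r_def mult.commute)
  have "(\<integral>y. norm (z - b y) ^ k \<partial>M) \<le> (\<integral>y. norm ((z - b y) ^ k - z ^ k) + r ^ k \<partial>M)"
  proof (rule integral_mono)
    show "norm (z - b y) ^ k \<le> norm ((z - b y) ^ k - z ^ k) + r ^ k" for y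
      using norm_triangle_ineq[of "(z - b y) ^ k - z ^ k" "z ^ k"] by (simp add: norm_power r_def)
  qed (use i integrable_norm_shifted_power[OF M b] in auto)
  also have "\<dots> = (\<integral>y. norm ((z - b y) ^ k - z ^ k) \<partial>M) + m * r ^ k" using i by (simp add: m)
  also have "\<dots> \<le> m * r ^ k * (4/3)" using err by (simp add: mult.commute)
  finally show ?thesis using 1 by linarith
qed

text \<open>
  The phase of \<open>(c - b)\<^sup>k\<close> still detects \<open>(z - b)\<^sup>k\<close> when
  \<open>z\<close> is close to \<open>c\<close>, because the mean of \<open>\<bar>z -
  b\<bar>\<^sup>k\<close> is bounded below.
\<close>

lemma norming_near:
  fixes b :: "'b \<Rightarrow> complex"
  assumes M: "finite_measure M" and b: "b \<in> borel_measurable M" "integrable M (\<lambda>y. norm (b y) ^ k)"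
    and m: "m = measure M (space M)" and upper: "(\<integral>y. norm (b y) ^ k \<partial>M) \<le> 2 * m"
    and lower: "m \<le> (\<integral>y. norm (z - b y) ^ k \<partial>M)"
    and k: "1 \<le> k" and z: "norm z \<le> far_radius k" "norm c \<le> far_radius k" "dist z c \<le> net_mesh k"
  shows "(\<integral>y. norm (z - b y) ^ k \<partial>M) \<le> 2 * norm (\<integral>y. cnj (sgn ((c - b y) ^ k)) * (z - b y) ^ k \<partial>M)"
proof -
  interpret finite_measure M by fact
  define r where "r = far_radius k"
  have r1: "1 \<le> r"
  proof -
    have "1 * 1 \<le> real k * 2 ^ k" using k by (intro mult_mono) auto
    then show ?thesis by (simp add: r_def far_radius_def)
  qed
  let ?\<psi> = "\<lambda>y. cnj (sgn ((c - b y) ^ k))"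
  have pm: "?\<psi> \<in> borel_measurable M"
    unfolding sgn_div_norm by (intro measurable_compose[OF _ borel_measurable_continuous_onI[of cnj]] borel_measurable_scaleR continuous_intros)
      (use b(1) in auto)
  have p1: "norm (?\<psi> y) \<le> 1" for y by (simp add: norm_sgn)
  have iz: "integrable M (\<lambda>y. ?\<psi> y * (z - b y) ^ k)" by (rule integrable_shifted_power[OF M b pm p1])
  have ic: "integrable M (\<lambda>y. ?\<psi> y * (c - b y) ^ k)" by (rule integrable_shifted_power[OF M b pm p1])
  have i1: "integrable M (\<lambda>y. (w - b y) ^ k)" for w
    using integrable_shifted_power[OF M b, of "\<lambda>_. 1" w] by simp
  have pc: "?\<psi> y * (c - b y) ^ k = of_real (norm (c - b y) ^ k)" for y
  proof -
    define v where "v = (c - b y) ^ k"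
    have "cnj (sgn v) * v = of_real (norm v)"
    proof (cases "v = 0")
      case False
      have "cnj (sgn v) * v = (v * cnj v) / of_real (norm v)" by (simp add: sgn_eq)
      also have "\<dots> = of_real (norm v)" using False by (simp add: complex_norm_square[symmetric] power2_eq_square)
      finally show ?thesis .
    qed simp
    then show ?thesis unfolding v_def by (simp add: norm_power)
  qed
  have pw: "norm ((z - b y) ^ k - (c - b y) ^ k) \<le> real k * net_mesh k * r ^ k * 2 ^ k * (1 + norm (b y) ^ k)" for y
  proof -
    have "norm ((z - b y) ^ k - (c - b y) ^ k) \<le> real k * norm (z - b y - (c - b y)) * (r + norm (b y)) ^ (k - 1)"
      using norm_triangle_ineq4[of z "b y"] norm_triangle_ineq4[of c "b y"] z
      by (intro norm_power_diff_bound) (auto simp: r_def)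
    also have "\<dots> \<le> real k * net_mesh k * (r + norm (b y)) ^ (k - 1)"
      using z r1 by (intro mult_right_mono mult_left_mono) (auto simp: dist_norm)
    also have "\<dots> \<le> real k * net_mesh k * (r * (1 + norm (b y))) ^ k"
    proof (intro mult_left_mono)
      have a: "norm (b y) \<le> r * norm (b y)" using mult_right_mono[OF r1, of "norm (b y)"] by simp
      then have "(r + norm (b y)) ^ (k - 1) \<le> (r * (1 + norm (b y))) ^ (k - 1)"
        using r1 by (intro power_mono) (auto simp: algebra_simps)
      also have "\<dots> \<le> (r * (1 + norm (b y))) ^ k"
      proof (rule power_increasing)
        show "1 \<le> r * (1 + norm (b y))" using mult_mono[of 1 r 1 "1 + norm (b y)"] r1 by simp
      qed auto
      finally show "(r + norm (b y)) ^ (k - 1) \<le> (r * (1 + norm (b y))) ^ k" .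
      show "0 \<le> real k * net_mesh k" using r1 by (auto simp: net_mesh_def r_def)
    qed
    also have "\<dots> = real k * net_mesh k * r ^ k * (1 + norm (b y)) ^ k"
      by (simp add: power_mult_distrib)
    also have "\<dots> \<le> real k * net_mesh k * r ^ k * (2 ^ k * (1 + norm (b y) ^ k))"
      using r1 by (intro mult_left_mono one_plus_power_le) (auto simp: net_mesh_def r_def)
    finally show ?thesis by simp
  qed
  have err: "(\<integral>y. norm ((z - b y) ^ k - (c - b y) ^ k) \<partial>M) \<le> m / 4"
  proof -
    have "(\<integral>y. norm ((z - b y) ^ k - (c - b y) ^ k) \<partial>M) \<le> (\<integral>y. real k * net_mesh k * r ^ k * 2 ^ k * (1 + norm (b y) ^ k) \<partial>M)"
      by (rule integral_mono) (use i1 b pw in auto)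
    also have "\<dots> = real k * net_mesh k * r ^ k * 2 ^ k * (m + (\<integral>y. norm (b y) ^ k \<partial>M))"
      using b by (simp add: m)
    also have "\<dots> \<le> real k * net_mesh k * r ^ k * 2 ^ k * (m + 2 * m)"
      using upper r1 by (intro mult_left_mono) (auto simp: net_mesh_def r_def)
    also have "\<dots> = m / 4" using r1 k by (simp add: net_mesh_def r_def field_simps)
    finally show ?thesis .
  qed
  have "norm ((\<integral>y. ?\<psi> y * (z - b y) ^ k \<partial>M) - (\<integral>y. ?\<psi> y * (c - b y) ^ k \<partial>M))
      = norm (\<integral>y. ?\<psi> y * (z - b y) ^ k - ?\<psi> y * (c - b y) ^ k \<partial>M)" using iz ic by simp
  also have "\<dots> \<le> (\<integral>y. norm (?\<psi> y * (z - b y) ^ k - ?\<psi> y * (c - b y) ^ k) \<partial>M)" by (rule integral_norm_bound)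
  also have "\<dots> \<le> (\<integral>y. norm ((z - b y) ^ k - (c - b y) ^ k) \<partial>M)"
  proof (rule integral_mono)
    show "norm (?\<psi> y * (z - b y) ^ k - ?\<psi> y * (c - b y) ^ k) \<le> norm ((z - b y) ^ k - (c - b y) ^ k)" for y
      using mult_right_mono[OF p1[of y], of "norm ((z - b y) ^ k - (c - b y) ^ k)"]
      by (simp add: norm_mult flip: right_diff_distrib)
  qed (use iz ic i1 in auto)
  finally have 1: "norm ((\<integral>y. ?\<psi> y * (z - b y) ^ k \<partial>M) - (\<integral>y. ?\<psi> y * (c - b y) ^ k \<partial>M)) \<le> m / 4"
    using err by linarith
  have 2: "(\<integral>y. ?\<psi> y * (c - b y) ^ k \<partial>M) = of_real (\<integral>y. norm (c - b y) ^ k \<partial>M)"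
    unfolding pc by (rule integral_complex_of_real)
  have "(\<integral>y. norm (z - b y) ^ k \<partial>M) \<le> (\<integral>y. norm (c - b y) ^ k + norm ((z - b y) ^ k - (c - b y) ^ k) \<partial>M)"
  proof (rule integral_mono)
    show "norm (z - b y) ^ k \<le> norm (c - b y) ^ k + norm ((z - b y) ^ k - (c - b y) ^ k)" for y
      using norm_triangle_sub[of "(z - b y) ^ k" "(c - b y) ^ k"] by (simp add: norm_power)
  qed (use i1 integrable_norm_shifted_power[OF M b] in auto)
  also have "\<dots> = (\<integral>y. norm (c - b y) ^ k \<partial>M) + (\<integral>y. norm ((z - b y) ^ k - (c - b y) ^ k) \<partial>M)"
    using i1 integrable_norm_shifted_power[OF M b] by simp
  finally have 3: "(\<integral>y. norm (z - b y) ^ k \<partial>M) - m / 4 \<le> (\<integral>y. norm (c - b y) ^ k \<partial>M)" using err by linarith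
  have 4: "(\<integral>y. norm (c - b y) ^ k \<partial>M) \<le> norm (\<integral>y. ?\<psi> y * (c - b y) ^ k \<partial>M)"
    unfolding 2 by simp
  have "norm (\<integral>y. ?\<psi> y * (c - b y) ^ k \<partial>M) \<le> norm (\<integral>y. ?\<psi> y * (z - b y) ^ k \<partial>M) + m / 4"
    using 1 norm_triangle_sub[of "\<integral>y. ?\<psi> y * (c - b y) ^ k \<partial>M" "\<integral>y. ?\<psi> y * (z - b y) ^ k \<partial>M"]
    by (simp add: norm_minus_commute)
  then show ?thesis using 3 4 lower by linarith
qed

text \<open>
  The number of discs in the net is chosen before \<open>b\<close>, so that the final constant
  depends on \<open>k\<close> only.
\<close>

definition norming_number :: "nat \<Rightarrow> nat" where
  "norming_number k = (SOME N. \<exists>c. (\<forall>l<N. norm (c l :: complex) \<le> far_radius k) \<and> cball 0 (far_radius k) \<subseteq> (\<Union>l<N. cball (c l) (net_mesh k)))"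

lemma norming_net:
  assumes "1 \<le> k"
  shows "\<exists>c. (\<forall>l<norming_number k. norm (c l :: complex) \<le> far_radius k) \<and> cball 0 (far_radius k) \<subseteq> (\<Union>l<norming_number k. cball (c l) (net_mesh k))"
  unfolding norming_number_def
proof (rule someI_ex)
  have "net_mesh k > 0" using assms by (simp add: net_mesh_def far_radius_def)
  then obtain S where S: "finite S" "S \<subseteq> cball (0::complex) (far_radius k)" "cball 0 (far_radius k) \<subseteq> (\<Union>x\<in>S. ball x (net_mesh k))"
    using seq_compact_imp_totally_bounded[of "cball (0::complex) (far_radius k)"]
    by (auto simp: compact_cball compact_imp_seq_compact)
  obtain c where c: "bij_betw c {0..<card S} S" using ex_bij_betw_nat_finite[OF S(1)] by blast
  then have Sc: "S = c ` {..<card S}" unfolding bij_betw_def by (auto simp: lessThan_atLeast0)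
  have "norm (c l) \<le> far_radius k" if "l < card S" for l
    using S(2) that Sc by (metis imageI in_mono lessThan_iff mem_cball_0)
  moreover have "cball 0 (far_radius k) \<subseteq> (\<Union>l<card S. cball (c l) (net_mesh k))"
  proof
    fix x :: complex assume "x \<in> cball 0 (far_radius k)"
    then obtain s where "s \<in> S" "x \<in> ball s (net_mesh k)" using S(3) by blast
    moreover obtain l where "l < card S" "s = c l" using \<open>s \<in> S\<close> Sc by blast
    ultimately show "x \<in> (\<Union>l<card S. cball (c l) (net_mesh k))" by (intro UN_I[of l]) auto
  qed
  ultimately show "\<exists>(N::nat) c. (\<forall>l<N. norm (c l) \<le> far_radius k) \<and> cball 0 (far_radius k) \<subseteq> (\<Union>l<N. cball (c l :: complex) (net_mesh k))"
    by (intro exI[of _ "card S"] exI[of _ c]) simp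
qed

text \<open>
  For complex \<open>b\<close> the numbers \<open>(b x - b y)\<^sup>k\<close> have no common
  sign that a median could exploit. But the functions \<open>(z - b)\<^sup>k\<close>,
  \<open>z\<close> complex, are after a translation by \<open>a\<close> and a dilation a compact
  family together with a part at infinity, so that finitely many bounded multipliers norm all of
  them up to the factor 2. The hypothesis on \<open>D\<close> says that it is the infimum of the
  \<open>k\<close>-th moments up to the factor 2; it fixes the scale of the dilation.
\<close>

proposition norming_family:
  fixes b :: "'b \<Rightarrow> complex"
  assumes M: "finite_measure M" and b: "b \<in> borel_measurable M" "integrable M (\<lambda>y. norm (b y) ^ k)"
    and k: "1 \<le> k" and D: "0 < D" and lower: "\<And>z. D \<le> (\<integral>y. norm (z - b y) ^ k \<partial>M)"
    and a: "(\<integral>y. norm (a - b y) ^ k \<partial>M) \<le> 2 * D"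
  shows "\<exists>(\<psi> :: nat \<Rightarrow> 'b \<Rightarrow> complex) (Z :: nat \<Rightarrow> complex set).
    (\<forall>l. \<psi> l \<in> borel_measurable M) \<and> (\<forall>l y. norm (\<psi> l y) \<le> 1) \<and>
    (\<forall>l. closed (Z l)) \<and> (\<Union>l\<le>norming_number k. Z l) = UNIV \<and>
    (\<forall>l\<le>norming_number k. \<forall>z\<in>Z l.
      (\<integral>y. norm (z - b y) ^ k \<partial>M) \<le> 2 * norm (\<integral>y. \<psi> l y * (z - b y) ^ k \<partial>M))"
proof -
  interpret finite_measure M by fact
  define m where "m = measure M (space M)"
  have m: "m > 0"
  proof (rule ccontr)
    assume "\<not> m > 0"
    then have "emeasure M (space M) = 0" unfolding m_def
      using measure_nonneg[of M "space M"] by (simp add: emeasure_eq_measure)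
    then have "AE y in M. False" using emeasure_eq_0_AE by (intro AE_I[of _ _ "space M"]) auto
    then have "(\<integral>y. norm (a - b y) ^ k \<partial>M) = (\<integral>y. 0 \<partial>M)"
      by (intro integral_cong_AE) (use b in auto)
    then show False using lower[of a] D by simp
  qed
  define R where "R = root k (D / m)"
  have R: "R > 0" "R ^ k = D / m" using k D m by (auto simp: R_def)
  \<comment> \<open>Normalised so that all moments about a point are at least \<open>m\<close>,
    and the one about 0 is at most \<open>2 m\<close>.\<close>
  define b' where "b' y = (b y - a) / of_real R" for y
  have b': "b' \<in> borel_measurable M" unfolding b'_def using b by auto
  have sc: "(of_real R * (z - b' y)) = (a + of_real R * z) - b y" for z y
    using R by (simp add: b'_def field_simps)
  have scn: "norm (z - b' y) ^ k = norm ((a + of_real R * z) - b y) ^ k / (D / m)" for z y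
  proof -
    have "norm ((a + of_real R * z) - b y) ^ k = R ^ k * norm (z - b' y) ^ k"
      unfolding sc[symmetric] using R(1) by (simp add: norm_mult power_mult_distrib)
    then show ?thesis unfolding R(2) using D m by simp
  qed
  have bi: "integrable M (\<lambda>y. norm (b' y) ^ k)"
    using scn[of 0] integrable_norm_shifted_power[OF M b, of a] by simp
  have sci: "(\<integral>y. norm (z - b' y) ^ k \<partial>M) = (\<integral>y. norm ((a + of_real R * z) - b y) ^ k \<partial>M) / (D / m)" for z
    unfolding scn by simp
  have upper': "(\<integral>y. norm (b' y) ^ k \<partial>M) \<le> 2 * m"
  proof -
    have "(\<integral>y. norm (b' y) ^ k \<partial>M) = (\<integral>y. norm (a - b y) ^ k \<partial>M) / (D / m)" using sci[of 0] by simp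
    also have "\<dots> \<le> (2 * D) / (D / m)" using a D m by (intro divide_right_mono) auto
    finally show ?thesis using D m by simp
  qed
  have lower': "m \<le> (\<integral>y. norm (z - b' y) ^ k \<partial>M)" for z
    using lower[of "a + of_real R * z"] D m by (simp add: sci field_simps)
  obtain c where c: "\<forall>l<norming_number k. norm (c l :: complex) \<le> far_radius k"
    "cball 0 (far_radius k) \<subseteq> (\<Union>l<norming_number k. cball (c l) (net_mesh k))"
    using norming_net[OF k] by blast
  let ?N = "norming_number k"
  define \<psi> where "\<psi> l y = (if l < ?N then cnj (sgn ((c l - b' y) ^ k)) else 1)" for l y
  define Z' where "Z' l = (if l < ?N then cball (c l) (net_mesh k) \<inter> cball 0 (far_radius k) else {z. far_radius k \<le> norm z})" for l
  define Z where "Z l = (\<lambda>z. (z - a) / of_real R) -` Z' l" for l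
  have main: "(\<integral>y. norm (z - b y) ^ k \<partial>M) \<le> 2 * norm (\<integral>y. \<psi> l y * (z - b y) ^ k \<partial>M)"
    if "l \<le> ?N" "z \<in> Z l" for l z
  proof -
    define z' where "z' = (z - a) / of_real R"
    have z: "z = a + of_real R * z'" using R by (simp add: z'_def)
    have "z' \<in> Z' l" using that by (simp add: Z_def z'_def)
    then have "(\<integral>y. norm (z' - b' y) ^ k \<partial>M) \<le> 2 * norm (\<integral>y. \<psi> l y * (z' - b' y) ^ k \<partial>M)"
      using that(1) norming_far[OF M b' bi m_def upper' k, of z'] c(1)
        norming_near[OF M b' bi m_def upper' lower'[of z'] k, of "c l"]
      by (auto simp: Z'_def \<psi>_def dist_commute split: if_splits)
    moreover have "\<psi> l y * (z - b y) ^ k = of_real (R ^ k) * (\<psi> l y * (z' - b' y) ^ k)" for y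
      unfolding z sc[symmetric] by (simp add: power_mult_distrib)
    then have "norm (\<integral>y. \<psi> l y * (z - b y) ^ k \<partial>M) = R ^ k * norm (\<integral>y. \<psi> l y * (z' - b' y) ^ k \<partial>M)"
      using R(1) by (simp only: integral_mult_right_zero norm_mult norm_of_real) simp
    ultimately have "(\<integral>y. norm (z - b y) ^ k \<partial>M) / (D / m) \<le> 2 * norm (\<integral>y. \<psi> l y * (z' - b' y) ^ k \<partial>M)"
      and J: "norm (\<integral>y. \<psi> l y * (z - b y) ^ k \<partial>M) = (D / m) * norm (\<integral>y. \<psi> l y * (z' - b' y) ^ k \<partial>M)"
      unfolding sci[of z'] z[symmetric] R(2) by simp_all
    moreover have "0 < D / m" using D m by simp
    ultimately have "(\<integral>y. norm (z - b y) ^ k \<partial>M) \<le> 2 * norm (\<integral>y. \<psi> l y * (z' - b' y) ^ k \<partial>M) * (D / m)"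
      using pos_divide_le_eq by blast
    then show ?thesis unfolding J by (simp only: mult_ac)
  qed
  show ?thesis
  proof (intro exI[of _ \<psi>] exI[of _ Z] conjI allI impI ballI)
    show "\<psi> l \<in> borel_measurable M" for l
    proof (cases "l < ?N")
      case True
      have "(\<lambda>y. cnj (sgn ((c l - b' y) ^ k))) \<in> borel_measurable M"
        unfolding sgn_div_norm by (intro measurable_compose[OF _ borel_measurable_continuous_onI[of cnj]] borel_measurable_scaleR continuous_intros)
          (use b' in auto)
      then show ?thesis using True by (simp add: \<psi>_def[abs_def])
    qed (simp add: \<psi>_def[abs_def])
    show "norm (\<psi> l y) \<le> 1" for l y by (simp add: \<psi>_def norm_sgn)
    show "closed (Z l)" for l
      unfolding Z_def
    proof (rule closed_vimage)
      show "closed (Z' l)" unfolding Z'_def by (auto intro!: closed_Collect_le continuous_intros)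
      show "continuous_on UNIV (\<lambda>z. (z - a) / of_real R)"
        using R(1) by (intro continuous_intros) auto
    qed
    show "(\<Union>l\<le>?N. Z l) = UNIV"
    proof -
      have "\<exists>l\<le>?N. z' \<in> Z' l" for z'
      proof (cases "norm z' \<le> far_radius k")
        case True
        then obtain l where "l < ?N" "z' \<in> cball (c l) (net_mesh k)" using c(2) by (auto simp: subset_iff)
        then show ?thesis using True by (intro exI[of _ l]) (auto simp: Z'_def)
      next
        case False then show ?thesis by (intro exI[of _ ?N]) (auto simp: Z'_def)
      qed
      then show ?thesis by (force simp: Z_def)
    qed
  qed (use main in auto)
qed

section \<open>Dyadic cubes and stopping times\<close>

\<comment> \<open>As a simplification rule this equation rewrites the Lebesgue measure of every
  set that is not syntactically Borel to that of an unspecified Borel part, and hides the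
  measure of the half-open cubes.\<close>
declare emeasure_completion [simp del]

definition ccube :: "'a::euclidean_space \<Rightarrow> real \<Rightarrow> 'a set" where
  "ccube c r = cbox (c - r *\<^sub>R (\<Sum>e\<in>Basis. e)) (c + r *\<^sub>R (\<Sum>e\<in>Basis. e))"

lemma cubes_eq: "cubes = {ccube c r | c r. 0 < r}"
  by (simp add: cubes_def ccube_def)

lemma mem_ccube: "x \<in> ccube c r \<longleftrightarrow> (\<forall>e\<in>Basis. c \<bullet> e - r \<le> x \<bullet> e \<and> x \<bullet> e \<le> c \<bullet> e + r)"
  by (simp add: ccube_def mem_box inner_diff_left inner_add_left inner_sum_left_Basis)

text \<open>
  Half-open cubes, given by centre and half the side length. Unlike closed cubes, the
  \<open>2\<^sup>d\<close> halves of such a cube are disjoint and cover it exactly.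
\<close>

definition cell :: "'a::euclidean_space \<times> real \<Rightarrow> 'a set" where
  "cell q = {x. \<forall>e\<in>Basis. fst q \<bullet> e - snd q \<le> x \<bullet> e \<and> x \<bullet> e < fst q \<bullet> e + snd q}"

definition vol :: "'a::euclidean_space \<times> real \<Rightarrow> real" where "vol q = (2 * snd q) ^ DIM('a)"

lemma cell_subset_ccube: "cell q \<subseteq> ccube (fst q) (snd q)"
  by (auto simp: cell_def mem_ccube less_imp_le)

lemma AE_ccube_cell: "AE x in lebesgue. x \<in> ccube (fst q) (snd q) \<longrightarrow> x \<in> cell q"
proof -
  let ?u = "fst q - snd q *\<^sub>R (\<Sum>e\<in>Basis. e)" and ?v = "fst q + snd q *\<^sub>R (\<Sum>e\<in>Basis. e)"
  have "negligible (cbox ?u ?v - box ?u ?v)" by (rule negligible_frontier_interval)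
  then have "AE x in lebesgue. x \<notin> cbox ?u ?v - box ?u ?v"
    using AE_not_in by (auto simp only: negligible_iff_null_sets)
  moreover have "box ?u ?v \<subseteq> cell q"
    by (auto simp: cell_def mem_box inner_diff_left inner_add_left inner_sum_left_Basis less_imp_le)
  ultimately show ?thesis unfolding ccube_def by (auto elim!: eventually_mono)
qed

lemma cell_sets: "cell q \<in> sets borel"
proof -
  have "cell q = (\<Inter>e\<in>Basis. {x. fst q \<bullet> e - snd q \<le> x \<bullet> e} \<inter> {x. x \<bullet> e < fst q \<bullet> e + snd q})"
    by (auto simp: cell_def)
  also have "\<dots> \<in> sets borel"
    by (intro sets.countable_INT'' sets.Int borel_closed borel_open closed_Collect_le open_Collect_less continuous_intros)
      (auto simp: countable_finite)
  finally show ?thesis .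
qed

lemma cell_sets_lebesgue [simp, measurable]: "cell q \<in> sets lebesgue"
  using cell_sets[of q] by (simp add: sets_completionI_sets)

lemma ccube_sets_lebesgue [simp, measurable]: "ccube c r \<in> sets lebesgue"
  unfolding ccube_def by simp

lemma emeasure_ccube: "0 \<le> r \<Longrightarrow> emeasure lebesgue (ccube c r :: 'a::euclidean_space set) = ennreal ((2 * r) ^ DIM('a))"
  unfolding ccube_def
  by (auto simp: emeasure_completion emeasure_lborel_cbox_eq inner_diff_left inner_add_left inner_sum_left_Basis prod_constant)

lemma emeasure_cell: "0 \<le> snd q \<Longrightarrow> emeasure lebesgue (cell q) = ennreal (vol q)"
proof -
  assume q: "0 \<le> snd q"
  have "emeasure lebesgue (cell q) = emeasure lebesgue (ccube (fst q) (snd q))"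
    by (rule emeasure_eq_AE) (use AE_ccube_cell[of q] cell_subset_ccube[of q] in \<open>auto elim!: eventually_mono\<close>)
  then show ?thesis using emeasure_ccube[OF q] by (simp add: vol_def)
qed

lemma vol_pos: "0 < snd q \<Longrightarrow> 0 < vol q" by (simp add: vol_def)

definition sgnvec :: "'a::euclidean_space \<Rightarrow> 'a \<Rightarrow> 'a" where
  "sgnvec x c = (\<Sum>e\<in>Basis. (if c \<bullet> e \<le> x \<bullet> e then 1 else -1) *\<^sub>R e)"

lemma sgnvec_inner: "e \<in> Basis \<Longrightarrow> sgnvec x c \<bullet> e = (if c \<bullet> e \<le> x \<bullet> e then 1 else -1)"
  by (simp add: sgnvec_def inner_sum_left_Basis)

text \<open>
  The child of \<open>q\<close> that contains \<open>x\<close>, if \<open>q\<close> contains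
  \<open>x\<close>.
\<close>

definition half :: "'a::euclidean_space \<Rightarrow> 'a \<times> real \<Rightarrow> 'a \<times> real" where
  "half x q = (fst q + (snd q / 2) *\<^sub>R sgnvec x (fst q), snd q / 2)"

text \<open>
  The dyadic descendant of \<open>q\<close> in generation \<open>n\<close> in the direction of
  \<open>x\<close>. Indexing the descendants by points makes nestedness and disjointness
  consequences of \<open>dyadic_eq\<close>.
\<close>

primrec dyadic :: "'a::euclidean_space \<times> real \<Rightarrow> 'a \<Rightarrow> nat \<Rightarrow> 'a \<times> real" where
  "dyadic q x 0 = q"
| "dyadic q x (Suc n) = half x (dyadic q x n)"

lemma mem_cell_half: "x \<in> cell q \<Longrightarrow> x \<in> cell (half x q)"
  by (auto simp: cell_def half_def inner_add_left sgnvec_inner)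

lemma mem_cell_halfD:
  assumes "x \<in> cell (half y q)" "e \<in> Basis"
  shows "fst q \<bullet> e + snd q / 2 * (if fst q \<bullet> e \<le> y \<bullet> e then 1 else -1) - snd q / 2 \<le> x \<bullet> e"
    "x \<bullet> e < fst q \<bullet> e + snd q / 2 * (if fst q \<bullet> e \<le> y \<bullet> e then 1 else -1) + snd q / 2"
proof -
  have "fst (half y q) \<bullet> e - snd (half y q) \<le> x \<bullet> e \<and> x \<bullet> e < fst (half y q) \<bullet> e + snd (half y q)"
    using assms unfolding cell_def by blast
  then have *: "fst q \<bullet> e + snd q / 2 * (sgnvec y (fst q) \<bullet> e) - snd q / 2 \<le> x \<bullet> e \<and>
      x \<bullet> e < fst q \<bullet> e + snd q / 2 * (sgnvec y (fst q) \<bullet> e) + snd q / 2"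
    by (simp add: half_def inner_add_left)
  show "fst q \<bullet> e + snd q / 2 * (if fst q \<bullet> e \<le> y \<bullet> e then 1 else -1) - snd q / 2 \<le> x \<bullet> e"
    "x \<bullet> e < fst q \<bullet> e + snd q / 2 * (if fst q \<bullet> e \<le> y \<bullet> e then 1 else -1) + snd q / 2"
    using * unfolding sgnvec_inner[OF assms(2)] by blast+
qed

lemma cell_half_subset: assumes "0 < snd q" shows "cell (half y q) \<subseteq> cell q"
proof
  fix x assume x: "x \<in> cell (half y q)"
  have "fst q \<bullet> e - snd q \<le> x \<bullet> e \<and> x \<bullet> e < fst q \<bullet> e + snd q" if "e \<in> Basis" for e
    using mem_cell_halfD[OF x that] assms by (cases "fst q \<bullet> e \<le> y \<bullet> e") auto
  then show "x \<in> cell q" by (simp add: cell_def)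
qed

lemma half_eq: "x \<in> cell (half y q) \<Longrightarrow> half x q = half y q"
proof -
  assume x: "x \<in> cell (half y q)"
  have "(fst q \<bullet> e \<le> x \<bullet> e) = (fst q \<bullet> e \<le> y \<bullet> e)" if "e \<in> Basis" for e
    using mem_cell_halfD[OF x that] by (cases "fst q \<bullet> e \<le> y \<bullet> e") auto
  then have "sgnvec x (fst q) = sgnvec y (fst q)" unfolding sgnvec_def by (intro sum.cong) auto
  then show ?thesis by (simp add: half_def)
qed

lemma snd_dyadic: "snd (dyadic q x n) = snd q / 2 ^ n"
  by (induction n) (auto simp: half_def)

lemma mem_cell_dyadic: "x \<in> cell q \<Longrightarrow> x \<in> cell (dyadic q x n)"
  by (induction n) (auto intro: mem_cell_half)

lemma cell_dyadic_Suc: "0 < snd q \<Longrightarrow> cell (dyadic q x (Suc n)) \<subseteq> cell (dyadic q x n)"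
  by (simp add: cell_half_subset snd_dyadic)

lemma cell_dyadic_subset: "0 < snd q \<Longrightarrow> cell (dyadic q x n) \<subseteq> cell q"
proof (induction n)
  case (Suc n) then show ?case using cell_dyadic_Suc[of q x n] by blast
qed simp

text \<open>
  A dyadic cube determines its ancestors: two points in a common descendant have the same cubes
  in all earlier generations.
\<close>

lemma dyadic_eq: "0 < snd q \<Longrightarrow> y \<in> cell (dyadic q x n) \<Longrightarrow> m \<le> n \<Longrightarrow> dyadic q y m = dyadic q x m"
proof (induction n arbitrary: m)
  case (Suc n)
  have y: "y \<in> cell (dyadic q x n)" using Suc.prems cell_dyadic_Suc by blast
  show ?case
  proof (cases "m = Suc n")
    case True
    have "dyadic q y n = dyadic q x n" using Suc.IH[OF Suc.prems(1) y] by blast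
    then show ?thesis using half_eq[of y x "dyadic q x n"] Suc.prems True by simp
  qed (use Suc y in auto)
qed simp

lemma finite_dyadic: "finite (range (\<lambda>x. dyadic q x n))"
proof (induction n)
  case 0 then show ?case by (auto intro: finite_subset[of _ "{q}"])
next
  case (Suc n)
  have "finite (Basis \<rightarrow>\<^sub>E {1, -1::real})" by (intro finite_PiE) auto
  let ?V = "(\<lambda>f. \<Sum>e\<in>Basis. f e *\<^sub>R e) ` ((Basis :: 'a set) \<rightarrow>\<^sub>E {1, -1::real})"
  have "sgnvec x c \<in> ?V" for x c :: 'a
  proof (rule image_eqI)
    show "sgnvec x c = (\<Sum>e\<in>Basis. (\<lambda>e\<in>Basis. if c \<bullet> e \<le> x \<bullet> e then 1 else -1) e *\<^sub>R e)"
      unfolding sgnvec_def by (intro sum.cong) auto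
  qed auto
  then have sv: "sgnvec x c \<in> ?V" for x c :: 'a .
  have "range (\<lambda>x. dyadic q x (Suc n)) \<subseteq> (\<lambda>(p, v). (fst p + (snd p / 2) *\<^sub>R v, snd p / 2)) ` (range (\<lambda>x. dyadic q x n) \<times> ?V)"
  proof (rule image_subsetI)
    fix x
    show "dyadic q x (Suc n) \<in> (\<lambda>(p, v). (fst p + (snd p / 2) *\<^sub>R v, snd p / 2)) ` (range (\<lambda>x. dyadic q x n) \<times> ?V)"
      by (rule image_eqI[where x = "(dyadic q x n, sgnvec x (fst (dyadic q x n)))"])
        (use sv in \<open>simp_all add: half_def\<close>)
  qed
  moreover have "finite ?V" by (intro finite_imageI finite_PiE) auto
  ultimately show ?case using Suc by (meson finite_SigmaI finite_imageI finite_subset)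
qed

text \<open>
  The maximal dyadic subcubes of \<open>q\<close> with the property \<open>H\<close>.
\<close>

definition stopped :: "'a::euclidean_space \<times> real \<Rightarrow> ('a \<times> real \<Rightarrow> bool) \<Rightarrow> ('a \<times> real) set" where
  "stopped q H = {dyadic q x n | x n. x \<in> cell q \<and> H (dyadic q x n) \<and> (\<forall>m<n. \<not> H (dyadic q x m))}"

lemma countable_stopped: "countable (stopped q H)"
proof (rule countable_subset)
  show "stopped q H \<subseteq> (\<Union>n. range (\<lambda>x. dyadic q x n))" unfolding stopped_def by blast
  show "countable (\<Union>n. range (\<lambda>x. dyadic q x n))" by (rule countable_UN) (simp_all only: countable_finite[OF finite_dyadic] uncountable_def countableI_type)
qed

text \<open>
  If two stopped cubes meet, then the common point has the same history as either of them, so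
  both stop at its first time.
\<close>

lemma stopped_disjoint:
  assumes "0 < snd q" shows "disjoint_family_on cell (stopped q H)"
  unfolding disjoint_family_on_def
proof (intro ballI impI)
  fix P P' assume P: "P \<in> stopped q H" "P' \<in> stopped q H" and ne: "P \<noteq> P'"
  obtain x n where x: "P = dyadic q x n" "H (dyadic q x n)" "\<forall>m<n. \<not> H (dyadic q x m)" using P unfolding stopped_def by blast
  obtain y k where y: "P' = dyadic q y k" "H (dyadic q y k)" "\<forall>m<k. \<not> H (dyadic q y m)" using P unfolding stopped_def by blast
  show "cell P \<inter> cell P' = {}"
  proof (rule ccontr)
    assume "cell P \<inter> cell P' \<noteq> {}"
    then obtain z where z: "z \<in> cell P" "z \<in> cell P'" by blast
    have zx: "dyadic q z m = dyadic q x m" if "m \<le> n" for m using dyadic_eq[OF assms _ that] z x by blast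
    have zy: "dyadic q z m = dyadic q y m" if "m \<le> k" for m using dyadic_eq[OF assms _ that] z y by blast
    have "n = k" using x y zx zy by (metis le_eq_less_or_eq linorder_neqE_nat)
    then show False using ne x y zx[of n] zy[of k] by simp
  qed
qed

lemma stopped_cover:
  assumes "x \<in> cell q" "H (dyadic q x n)" shows "\<exists>P\<in>stopped q H. x \<in> cell P"
proof -
  define k where "k = (LEAST k. H (dyadic q x k))"
  have "H (dyadic q x k)" unfolding k_def using assms(2) by (rule LeastI)
  moreover have "\<forall>m<k. \<not> H (dyadic q x m)" unfolding k_def using not_less_Least by blast
  ultimately have "dyadic q x k \<in> stopped q H" using assms(1) unfolding stopped_def by blast
  then show ?thesis using mem_cell_dyadic[OF assms(1)] by blast
qed

lemma stopped_props:
  assumes "0 < snd q" "P \<in> stopped q H"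
  shows "0 < snd P" "cell P \<subseteq> cell q" "H P"
  using assms cell_dyadic_subset[OF assms(1)] unfolding stopped_def by (auto simp: snd_dyadic)

lemma nn_integral_countable_union_mono:
  assumes "countable I" "disjoint_family_on X I" "\<And>i. i \<in> I \<Longrightarrow> X i \<in> sets M"
    and f: "f \<in> borel_measurable M" "g \<in> borel_measurable M"
    and le: "\<And>i. i \<in> I \<Longrightarrow> (\<integral>\<^sup>+x\<in>X i. f x \<partial>M) \<le> (\<integral>\<^sup>+x\<in>X i. g x \<partial>M)"
  shows "(\<integral>\<^sup>+x\<in>(\<Union>i\<in>I. X i). f x \<partial>M) \<le> (\<integral>\<^sup>+x\<in>(\<Union>i\<in>I. X i). g x \<partial>M)"
proof -
  have U: "(\<Union>i\<in>I. X i) \<in> sets M" using assms by (intro sets.countable_UN') auto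
  have eq: "(\<integral>\<^sup>+x\<in>(\<Union>i\<in>I. X i). h x \<partial>M) = (\<integral>\<^sup>+i. (\<integral>\<^sup>+x\<in>X i. h x \<partial>M) \<partial>count_space I)"
    if h: "h \<in> borel_measurable M" for h
  proof -
    have "(\<integral>\<^sup>+x\<in>(\<Union>i\<in>I. X i). h x \<partial>M) = emeasure (density M h) (\<Union>i\<in>I. X i)"
      using h U by (simp add: emeasure_density)
    also have "\<dots> = (\<integral>\<^sup>+i. emeasure (density M h) (X i) \<partial>count_space I)"
      using assms by (intro emeasure_UN_countable) auto
    also have "\<dots> = (\<integral>\<^sup>+i. (\<integral>\<^sup>+x\<in>X i. h x \<partial>M) \<partial>count_space I)"
      using h assms by (intro nn_integral_cong) (simp add: emeasure_density)
    finally show ?thesis .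
  qed
  show ?thesis unfolding eq[OF f(1)] eq[OF f(2)] by (rule nn_integral_mono) (simp add: le)
qed

lemma emeasure_countable_union_mono:
  assumes "countable I" "disjoint_family_on X I" "\<And>i. i \<in> I \<Longrightarrow> X i \<in> sets M" "A \<in> sets M" "B \<in> sets M"
    and le: "\<And>i. i \<in> I \<Longrightarrow> emeasure M (A \<inter> X i) \<le> c * emeasure M (B \<inter> X i)"
  shows "emeasure M (A \<inter> (\<Union>i\<in>I. X i)) \<le> c * emeasure M (B \<inter> (\<Union>i\<in>I. X i))"
proof -
  have U: "(\<Union>i\<in>I. X i) \<in> sets M" using assms by (intro sets.countable_UN') auto
  have 1: "(\<integral>\<^sup>+x\<in>Y. indicator A x \<partial>M) = emeasure M (A \<inter> Y)" "(\<integral>\<^sup>+x\<in>Y. c * indicator B x \<partial>M) = c * emeasure M (B \<inter> Y)"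
    if "Y \<in> sets M" for Y
    using that assms by (simp_all add: indicator_inter_arith[symmetric] nn_integral_cmult mult.assoc)
  have "(\<integral>\<^sup>+x\<in>(\<Union>i\<in>I. X i). indicator A x \<partial>M) \<le> (\<integral>\<^sup>+x\<in>(\<Union>i\<in>I. X i). c * indicator B x \<partial>M)"
    by (rule nn_integral_countable_union_mono) (use assms 1 in auto)
  then show ?thesis using 1[OF U] by simp
qed

lemma norm_in_cell: "x \<in> cell q \<Longrightarrow> y \<in> cell q \<Longrightarrow> norm (x - y :: 'a::euclidean_space) \<le> real DIM('a) * (2 * snd q)"
proof -
  assume xy: "x \<in> cell q" "y \<in> cell q"
  have "norm (x - y) \<le> (\<Sum>e\<in>Basis. \<bar>(x - y) \<bullet> e\<bar>)" by (rule norm_le_l1)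
  also have "\<dots> \<le> (\<Sum>e\<in>(Basis::'a set). 2 * snd q)"
  proof (rule sum_mono)
    fix e :: 'a assume "e \<in> Basis"
    then show "\<bar>(x - y) \<bullet> e\<bar> \<le> 2 * snd q" using xy by (force simp: cell_def inner_diff_left abs_le_iff)
  qed
  finally show ?thesis by simp
qed

text \<open>
  A dyadic density argument: cover \<open>A\<close> by an open set of hardly larger measure, and
  decompose that set into maximal dyadic cubes. In each of them that meets \<open>A\<close>, the
  part of \<open>A\<close> has proportion at most \<open>\<theta>\<close>, hence
  \<open>\<bar>A\<bar> \<le> \<theta> \<bar>A\<bar>\<close>.
\<close>

lemma nowhere_heavy_null:
  fixes q :: "'a::euclidean_space \<times> real"
  assumes q: "0 < snd q" and E: "A \<in> sets lebesgue" "A \<subseteq> cell q" "A \<subseteq> E" "E \<in> sets lebesgue"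
    and \<theta>: "\<theta> < 1" "0 \<le> \<theta>"
    and light: "\<And>x n. x \<in> A \<Longrightarrow> emeasure lebesgue (E \<inter> cell (dyadic q x n)) \<le> ennreal \<theta> * emeasure lebesgue (cell (dyadic q x n))"
  shows "A \<in> null_sets lebesgue"
proof -
  have fin: "emeasure lebesgue A < \<infinity>"
    using emeasure_mono[OF E(2), of lebesgue] emeasure_cell[of q] q by (simp add: order_le_less_trans)
  then obtain a where a: "emeasure lebesgue A = ennreal a" "a \<ge> 0" by (cases "emeasure lebesgue A") auto
  have key: "a \<le> \<theta> * (a + \<delta>)" if \<delta>: "\<delta> > 0" for \<delta>
  proof -
    obtain U where U: "open U" "A \<subseteq> U" "U - A \<in> lmeasurable" "emeasure lebesgue (U - A) < ennreal \<delta>"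
      using sets_lebesgue_outer_open[OF E(1) \<delta>] by blast
    let ?I = "stopped q (\<lambda>P. cell P \<subseteq> U) \<inter> {P. cell P \<inter> A \<noteq> {}}"
    have cov: "A \<subseteq> (\<Union>P\<in>?I. cell P)"
    proof
      fix x assume x: "x \<in> A"
      then obtain e where e: "e > 0" "ball x e \<subseteq> U" using U by (meson open_contains_ball subsetD)
      obtain n where n: "real DIM('a) * (2 * snd q) / e < 2 ^ n" using real_arch_pow[of 2] by auto
      have "cell (dyadic q x n) \<subseteq> ball x e"
      proof
        fix y assume "y \<in> cell (dyadic q x n)"
        then have "norm (x - y) \<le> real DIM('a) * (2 * (snd q / 2 ^ n))"
          using norm_in_cell[of x "dyadic q x n" y] mem_cell_dyadic[of x q n] x E by (auto simp: snd_dyadic)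
        also have "\<dots> < e" using n e by (simp add: field_simps)
        finally show "y \<in> ball x e" by (simp add: dist_norm)
      qed
      then obtain P where "P \<in> stopped q (\<lambda>P. cell P \<subseteq> U)" "x \<in> cell P"
        using stopped_cover[of x q "\<lambda>P. cell P \<subseteq> U" n] x E e by blast
      then show "x \<in> (\<Union>P\<in>?I. cell P)" using x by blast
    qed
    have Usets: "U \<in> sets lebesgue" using U by simp
    have "emeasure lebesgue (E \<inter> (\<Union>P\<in>?I. cell P)) \<le> ennreal \<theta> * emeasure lebesgue (U \<inter> (\<Union>P\<in>?I. cell P))"
    proof (rule emeasure_countable_union_mono)
      show "countable ?I" using countable_stopped[of q] by (rule countable_subset[rotated]) auto
      show "disjoint_family_on cell ?I" using stopped_disjoint[OF q] by (rule disjoint_family_on_mono[rotated]) auto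
      fix P assume P: "P \<in> ?I"
      then obtain x where x: "x \<in> A" "x \<in> cell P" by blast
      obtain y n where y: "P = dyadic q y n" using P unfolding stopped_def by blast
      have "P = dyadic q x n" using dyadic_eq[OF q, of x y n n] x y by simp
      moreover have "U \<inter> cell P = cell P" using P stopped_props(3)[OF q, of P "\<lambda>P. cell P \<subseteq> U"] by blast
      ultimately show "emeasure lebesgue (E \<inter> cell P) \<le> ennreal \<theta> * emeasure lebesgue (U \<inter> cell P)"
        using light[OF x(1), of n] by simp
    qed (use E Usets in auto)
    also have "\<dots> \<le> ennreal \<theta> * ennreal (a + \<delta>)"
    proof (rule mult_left_mono)
      have "emeasure lebesgue (U \<inter> (\<Union>P\<in>?I. cell P)) \<le> emeasure lebesgue U"
        using Usets by (intro emeasure_mono) auto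
      also have "\<dots> \<le> emeasure lebesgue A + emeasure lebesgue (U - A)"
      proof -
        have "A \<union> (U - A) = U" "U - A \<in> sets lebesgue" using U(2) Usets E(1) by auto
        then show ?thesis using emeasure_subadditive[OF E(1), of "U - A"] by simp
      qed
      also have "\<dots> \<le> ennreal a + ennreal \<delta>" unfolding a(1) using U(4) by (intro add_left_mono less_imp_le)
      also have "\<dots> = ennreal (a + \<delta>)" using a(2) \<delta> by simp
      finally show "emeasure lebesgue (U \<inter> (\<Union>P\<in>?I. cell P)) \<le> ennreal (a + \<delta>)" .
    qed simp
    finally have 1: "emeasure lebesgue (E \<inter> (\<Union>P\<in>?I. cell P)) \<le> ennreal \<theta> * ennreal (a + \<delta>)" .
    have c: "countable ?I" using countable_stopped[of q] by (rule countable_subset[rotated]) auto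
    have "(\<Union>P\<in>?I. cell P) \<in> sets lebesgue" by (rule sets.countable_UN'[OF c]) auto
    then have "emeasure lebesgue A \<le> emeasure lebesgue (E \<inter> (\<Union>P\<in>?I. cell P))"
      using cov E(3,4) by (intro emeasure_mono sets.Int) blast+
    also note 1
    finally have "ennreal a \<le> ennreal (\<theta> * (a + \<delta>))" using a \<theta>(2) by (simp add: ennreal_mult')
    then show ?thesis using a \<theta> \<delta> by (simp add: ennreal_le_iff)
  qed
  then have "a \<le> \<theta> * a + e" if "e > 0" for e
  proof -
    have "a \<le> \<theta> * (a + e)" using key that by blast
    also have "\<dots> \<le> \<theta> * a + 1 * e" using \<theta> that by (simp add: distrib_left mult_right_mono)
    finally show ?thesis by simp
  qed
  then have "a \<le> \<theta> * a" by (rule field_le_epsilon)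
  then have "(1 - \<theta>) * a \<le> 0" by (simp add: algebra_simps)
  then have "a = 0" using a(2) \<theta>(1) by (simp add: mult_le_0_iff)
  then show ?thesis using a E by (simp add: null_setsI)
qed

text \<open>
  The Calderon--Zygmund decomposition of \<open>E\<close> at height
  \<open>2\<^sup>-\<^sup>d\<^sup>-\<^sup>1\<close>. The parent of a selected cube is not
  selected, so that a selected cube is at most half filled by \<open>E\<close>; and since
  \<open>E\<close> has a proportion of only \<open>2\<^sup>-\<^sup>d\<^sup>-\<^sup>2\<close>,
  the selected cubes fill at most half of \<open>q\<close>.
\<close>

proposition dyadic_stopping:
  fixes q :: "'a::euclidean_space \<times> real"
  assumes q: "0 < snd q" and E: "E \<in> sets lebesgue" 
    and small: "emeasure lebesgue (E \<inter> cell q) \<le> ennreal (vol q / 2 ^ (DIM('a) + 2))"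
  obtains \<D> where "countable \<D>" "disjoint_family_on cell \<D>" "\<And>P. P \<in> \<D> \<Longrightarrow> 0 < snd P" "\<And>P. P \<in> \<D> \<Longrightarrow> cell P \<subseteq> cell q"
    "\<And>P. P \<in> \<D> \<Longrightarrow> emeasure lebesgue (E \<inter> cell P) \<le> ennreal (vol P / 2)"
    "emeasure lebesgue (\<Union>P\<in>\<D>. cell P) \<le> ennreal (vol q / 2)"
    "E \<inter> cell q - (\<Union>P\<in>\<D>. cell P) \<in> null_sets lebesgue"
proof -
  \<comment> \<open>A child has proportion \<open>2\<^sup>-\<^sup>d\<close> of its parent, which
    makes \<open>\<theta>\<close> times the parent half of the child.\<close>
  define \<theta> :: real where "\<theta> = 1 / 2 ^ (DIM('a) + 1)"
  have \<theta>: "0 < \<theta>" "\<theta> < 1" unfolding \<theta>_def using one_less_power[of "2::real" "DIM('a) + 1"] by auto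
  define heavy where "heavy P \<longleftrightarrow> ennreal (\<theta> * vol P) < emeasure lebesgue (E \<inter> cell P)" for P
  define \<D> where "\<D> = stopped q heavy"
  have c: "countable \<D>" unfolding \<D>_def by (rule countable_stopped)
  have d: "disjoint_family_on cell \<D>" unfolding \<D>_def by (rule stopped_disjoint[OF q])
  have nq: "\<not> heavy q"
  proof -
    have "vol q / 2 ^ (DIM('a) + 2) \<le> \<theta> * vol q" using vol_pos[OF q] by (simp add: \<theta>_def field_simps)
    then show ?thesis using small unfolding heavy_def by (meson ennreal_leI not_less order_trans)
  qed
  have half_le: "emeasure lebesgue (E \<inter> cell P) \<le> ennreal (vol P / 2)" if P: "P \<in> \<D>" for P
  proof -
    obtain x n where x: "P = dyadic q x n" "heavy P" "\<forall>m<n. \<not> heavy (dyadic q x m)"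
      using P unfolding \<D>_def stopped_def by blast
    obtain m where n: "n = Suc m" using x nq by (cases n) auto
    have "emeasure lebesgue (E \<inter> cell P) \<le> emeasure lebesgue (E \<inter> cell (dyadic q x m))"
      using cell_dyadic_Suc[OF q, of x m] E x n by (intro emeasure_mono) auto
    also have "\<dots> \<le> ennreal (\<theta> * vol (dyadic q x m))" using x n by (simp add: heavy_def not_less)
    also have "\<theta> * vol (dyadic q x m) = vol P / 2"
      unfolding x(1) n vol_def \<theta>_def by (simp add: half_def power_mult_distrib power_divide)
    finally show ?thesis .
  qed
  have U: "(\<Union>P\<in>\<D>. cell P) \<in> sets lebesgue" using c by (intro sets.countable_UN') auto
  have sum: "emeasure lebesgue (\<Union>P\<in>\<D>. cell P) \<le> ennreal (vol q / 2)"
  proof -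
    have "emeasure lebesgue (UNIV \<inter> (\<Union>P\<in>\<D>. cell P)) \<le> ennreal (1 / \<theta>) * emeasure lebesgue (E \<inter> (\<Union>P\<in>\<D>. cell P))"
    proof (rule emeasure_countable_union_mono[OF c d])
      fix P assume P: "P \<in> \<D>"
      have p: "0 < snd P" "heavy P" using stopped_props[OF q] P unfolding \<D>_def by blast+
      have "ennreal (vol P) = ennreal (1 / \<theta>) * ennreal (\<theta> * vol P)"
        using \<theta> vol_pos[OF p(1)] by (simp add: ennreal_mult[symmetric])
      also have "\<dots> \<le> ennreal (1 / \<theta>) * emeasure lebesgue (E \<inter> cell P)"
        using p(2) by (intro mult_left_mono) (auto simp: heavy_def)
      finally show "emeasure lebesgue (UNIV \<inter> cell P) \<le> ennreal (1 / \<theta>) * emeasure lebesgue (E \<inter> cell P)"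
        using emeasure_cell[of P] p(1) by (simp only: Int_UNIV_left less_imp_le)
    qed (use E in auto)
    also have "\<dots> \<le> ennreal (1 / \<theta>) * emeasure lebesgue (E \<inter> cell q)"
      using stopped_props(2)[OF q] E unfolding \<D>_def by (intro mult_left_mono emeasure_mono) auto
    also have "\<dots> \<le> ennreal (1 / \<theta>) * ennreal (vol q / 2 ^ (DIM('a) + 2))"
      using small by (intro mult_left_mono) auto
    also have "\<dots> = ennreal (vol q / 2)"
      using vol_pos[OF q] \<theta> by (simp add: ennreal_mult[symmetric] \<theta>_def)
    finally show ?thesis by simp
  qed
  have "E \<inter> cell q - (\<Union>P\<in>\<D>. cell P) \<in> null_sets lebesgue"
  proof (rule nowhere_heavy_null[OF q])
    show "emeasure lebesgue (E \<inter> cell (dyadic q x n)) \<le> ennreal \<theta> * emeasure lebesgue (cell (dyadic q x n))"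
      if "x \<in> E \<inter> cell q - (\<Union>P\<in>\<D>. cell P)" for x n
    proof -
      have "\<not> heavy (dyadic q x n)" using that stopped_cover[of x q heavy n] unfolding \<D>_def by blast
      then show ?thesis using q \<theta> by (simp add: heavy_def not_less emeasure_cell snd_dyadic ennreal_mult' vol_def)
    qed
  qed (use E U \<theta> in auto)
  then show ?thesis using that[OF c d _ _ half_le sum] stopped_props[OF q] unfolding \<D>_def by blast
qed

section \<open>From local oscillation to mean oscillation\<close>

text \<open>
  A weight is only assumed to be integrable on compact sets; exhaust the space by balls.
\<close>

lemma weight_measurable:
  assumes "weight w" shows "w \<in> borel_measurable lebesgue"
proof -
  have i: "set_integrable lebesgue (cball 0 (real n)) w" for n
    using assms unfolding weight_def by (simp add: compact_cball)
  have "(\<lambda>n. indicat_real (cball 0 (real n)) x *\<^sub>R w x) \<longlonglongrightarrow> w x" for x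
  proof (rule tendsto_eventually)
    obtain N where N: "norm x \<le> real N" using real_arch_simple by blast
    have "indicat_real (cball 0 (real n)) x *\<^sub>R w x = w x" if "n \<ge> N" for n
      using that N by (simp add: indicator_def)
    then show "\<forall>\<^sub>F n in sequentially. indicat_real (cball 0 (real n)) x *\<^sub>R w x = w x"
      unfolding eventually_sequentially by blast
  qed
  then show ?thesis
    by (rule borel_measurable_LIMSEQ_metric[rotated]) (use i in \<open>auto simp: set_integrable_def\<close>)
qed

lemma weight_mass_finite:
  assumes "weight w" "S \<subseteq> ccube c r" shows "weight_mass w S < \<infinity>"
proof -
  have "set_integrable lebesgue (ccube c r) w" using assms(1) unfolding weight_def ccube_def by simp
  then have i: "integrable lebesgue (\<lambda>x. indicat_real (ccube c r) x *\<^sub>R w x)" by (simp add: set_integrable_def)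
  have "weight_mass w S \<le> (\<integral>\<^sup>+x. ennreal (norm (indicat_real (ccube c r) x *\<^sub>R w x)) \<partial>lebesgue)"
    unfolding weight_mass_def
  proof (rule nn_integral_mono)
    fix x show "ennreal (w x) * indicator S x \<le> ennreal (norm (indicat_real (ccube c r) x *\<^sub>R w x))"
      using assms by (auto simp: indicator_def weight_def less_imp_le)
  qed
  also have "\<dots> < \<infinity>" using i by (simp add: integrable_iff_bounded)
  finally show ?thesis .
qed

lemma nn_integral_ccube_cell:
  "(\<integral>\<^sup>+x\<in>ccube (fst q) (snd q). f x \<partial>lebesgue) = (\<integral>\<^sup>+x\<in>cell q. f x \<partial>lebesgue)"
  by (rule nn_integral_cong_AE) (use AE_ccube_cell[of q] cell_subset_ccube[of q] in \<open>auto elim!: eventually_mono simp: indicator_def\<close>)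

text \<open>
  A weighted John--Stromberg inequality. On each cube \<open>q\<close>, \<open>b\<close> is
  within \<open>B a(q)\<close> of \<open>\<alpha> q\<close> off a small subset, where
  \<open>a(q)\<close> is the average of \<open>\<nu>\<close>. Selecting dyadic stopping cubes
  for the exceptional set, and repeating this inside the selected cubes, gives generations
  \<open>S m\<close> of cubes with unions \<open>\<Omega> m\<close> whose measure halves at each
  step. Following a point through its cubes until it drops out bounds \<open>\<bar>b - \<alpha>
  q0\<bar>\<close> by \<open>2 B\<close> times the sum of the averages \<open>g m\<close> of
  \<open>\<nu>\<close> along the way. Each stopping cube has half of its measure outside the
  next generation, and these halves are disjoint; on them the average of \<open>\<nu>\<close> is
  at most the maximal function, whose integral is what \<open>Ainf_const\<close> controls.
\<close>

proposition sparse_oscillation_bound: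
  fixes b :: "'a::euclidean_space \<Rightarrow> complex" and q0 :: "'a \<times> real"
  assumes w: "weight \<nu>" and A: "Ainf_const \<nu> \<le> ennreal A" and b: "b \<in> borel_measurable lebesgue" and B: "0 \<le> B"
    and a: "\<And>q. 0 < snd q \<Longrightarrow> ennreal (a q) * ennreal (vol q) = weight_mass \<nu> (cell q)" "\<And>q. 0 \<le> a q"
    and osc: "\<And>q. 0 < snd q \<Longrightarrow> emeasure lebesgue {x \<in> cell q. B * a q < norm (b x - \<alpha> q)} \<le> ennreal (vol q / 2 ^ (DIM('a) + 2))"
    and q0: "0 < snd q0"
  shows "(\<integral>\<^sup>+x\<in>cell q0. ennreal (norm (b x - \<alpha> q0)) \<partial>lebesgue) \<le> ennreal (4 * B) * (ennreal A * weight_mass \<nu> (cell q0))"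
proof -
  define E where "E q = {x. B * a q < norm (b x - \<alpha> q)}" for q
  have E: "E q \<in> sets lebesgue" for q
  proof -
    have "{x \<in> space lebesgue. B * a q < norm (b x - \<alpha> q)} \<in> sets lebesgue" using b by measurable
    then show ?thesis by (simp add: E_def)
  qed
  have Eq: "E q \<inter> cell q = {x \<in> cell q. B * a q < norm (b x - \<alpha> q)}" for q by (auto simp: E_def)
  define good where "good q \<D> \<longleftrightarrow> countable \<D> \<and> disjoint_family_on cell \<D> \<and> (\<forall>P\<in>\<D>. 0 < snd P \<and> cell P \<subseteq> cell q \<and>
      emeasure lebesgue (E q \<inter> cell P) \<le> ennreal (vol P / 2)) \<and> emeasure lebesgue (\<Union>P\<in>\<D>. cell P) \<le> ennreal (vol q / 2) \<and>
      E q \<inter> cell q - (\<Union>P\<in>\<D>. cell P) \<in> null_sets lebesgue" for q \<D>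
  have "\<exists>\<D>. good q \<D>" if "0 < snd q" for q
  proof -
    have "emeasure lebesgue (E q \<inter> cell q) \<le> ennreal (vol q / 2 ^ (DIM('a) + 2))" unfolding Eq using osc[OF that] .
    from dyadic_stopping[OF that E this] show ?thesis unfolding good_def by (metis (no_types, lifting))
  qed
  then obtain st where st: "\<And>q. 0 < snd q \<Longrightarrow> good q (st q)" by metis
  define S where "S = rec_nat {q0} (\<lambda>_ X. \<Union>q\<in>X. st q)"
  have S0: "S 0 = {q0}" and SS: "S (Suc m) = (\<Union>q\<in>S m. st q)" for m by (simp_all add: S_def)
  have pos: "0 < snd q \<and> cell q \<subseteq> cell q0" if "q \<in> S m" for q m
    using that
  proof (induction m arbitrary: q)
    case 0 then show ?case using q0 S0 by simp
  next
    case (Suc m)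
    then obtain q' where q': "q' \<in> S m" "q \<in> st q'" by (auto simp: SS)
    then show ?case using Suc.IH[OF q'(1)] st[of q'] unfolding good_def by blast
  qed
  have cS: "countable (S m)" for m
  proof (induction m)
    case (Suc m)
    have "countable (st q)" if "q \<in> S m" for q using st[of q] pos[OF that] unfolding good_def by blast
    then show ?case unfolding SS using Suc by (intro countable_UN) auto
  qed (simp add: S0)
  have dS: "disjoint_family_on cell (S m)" for m
  proof (induction m)
    case (Suc m)
    show ?case unfolding disjoint_family_on_def
    proof (intro ballI impI)
      fix P P' assume P: "P \<in> S (Suc m)" "P' \<in> S (Suc m)" "P \<noteq> P'"
      obtain q q' where q: "q \<in> S m" "P \<in> st q" and q': "q' \<in> S m" "P' \<in> st q'" using P by (auto simp: SS)
      have g: "good q (st q)" "good q' (st q')" using st pos q q' by blast+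
      show "cell P \<inter> cell P' = {}"
      proof (cases "q = q'")
        case True
        then show ?thesis using g(1) q(2) q'(2) P(3) unfolding good_def disjoint_family_on_def by blast
      next
        case False
        then have "cell q \<inter> cell q' = {}" using Suc q q' unfolding disjoint_family_on_def by blast
        then show ?thesis using g q(2) q'(2) unfolding good_def by blast
      qed
    qed
  qed (simp add: S0 disjoint_family_on_def)
  define \<Omega> where "\<Omega> m = (\<Union>q\<in>S m. cell q)" for m
  have \<Omega>s: "\<Omega> m \<in> sets lebesgue" for m unfolding \<Omega>_def by (rule sets.countable_UN'[OF cS]) auto
  have uniq: "q = q'" if "q \<in> S m" "q' \<in> S m" "x \<in> cell q" "x \<in> cell q'" for q q' m x
    using dS[of m] that unfolding disjoint_family_on_def by blast
  have next_part: "\<Omega> (Suc m) \<inter> cell q = (\<Union>P\<in>st q. cell P)" if q: "q \<in> S m" for m q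
  proof
    show "(\<Union>P\<in>st q. cell P) \<subseteq> \<Omega> (Suc m) \<inter> cell q"
      using q st[of q] pos[OF q] unfolding \<Omega>_def SS good_def by blast
    show "\<Omega> (Suc m) \<inter> cell q \<subseteq> (\<Union>P\<in>st q. cell P)"
    proof
      fix x assume x: "x \<in> \<Omega> (Suc m) \<inter> cell q"
      then obtain q' P where P: "q' \<in> S m" "P \<in> st q'" "x \<in> cell P" unfolding \<Omega>_def SS by blast
      then have "x \<in> cell q'" using st[of q'] pos[OF P(1)] unfolding good_def by blast
      then have "q' = q" using uniq[OF P(1) q] x by blast
      then show "x \<in> (\<Union>P\<in>st q. cell P)" using P by blast
    qed
  qed
  have \<Omega>dec: "\<Omega> (Suc m) \<subseteq> \<Omega> m" for m
  proof
    fix x assume "x \<in> \<Omega> (Suc m)"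
    then obtain q P where "q \<in> S m" "P \<in> st q" "x \<in> cell P" unfolding \<Omega>_def SS by blast
    then show "x \<in> \<Omega> m" using st[of q] pos[of q m] unfolding \<Omega>_def good_def by blast
  qed
  have \<Omega>0: "\<Omega> 0 = cell q0" by (simp add: \<Omega>_def S0)
  have half_mass: "emeasure lebesgue (\<Omega> (Suc m) \<inter> cell q) \<le> ennreal (vol q / 2)" if "q \<in> S m" for m q
    unfolding next_part[OF that] using st[of q] pos[OF that] unfolding good_def by blast
  have \<Omega>half: "emeasure lebesgue (\<Omega> (Suc m)) \<le> ennreal (1/2) * emeasure lebesgue (\<Omega> m)" for m
  proof -
    have "emeasure lebesgue (\<Omega> (Suc m) \<inter> (\<Union>q\<in>S m. cell q)) \<le> ennreal (1/2) * emeasure lebesgue (UNIV \<inter> (\<Union>q\<in>S m. cell q))"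
    proof (rule emeasure_countable_union_mono[OF cS dS])
      fix q assume q: "q \<in> S m"
      have "ennreal (vol q / 2) = ennreal (1/2) * emeasure lebesgue (cell q)"
        using pos[OF q] vol_pos[of q] emeasure_cell[of q] ennreal_mult'[of "1/2" "vol q"] by (metis (no_types, lifting) divide_inverse inverse_eq_divide less_eq_real_def mult.commute zero_le_divide_1_iff zero_le_numeral)
      then show "emeasure lebesgue (\<Omega> (Suc m) \<inter> cell q) \<le> ennreal (1/2) * emeasure lebesgue (UNIV \<inter> cell q)"
        using half_mass[OF q] by (simp only: Int_UNIV_left)
    qed (use \<Omega>s in auto)
    moreover have "\<Omega> (Suc m) \<inter> (\<Union>q\<in>S m. cell q) = \<Omega> (Suc m)" using \<Omega>dec[of m] unfolding \<Omega>_def by blast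
    ultimately show ?thesis by (simp only: Int_UNIV_left \<Omega>_def[symmetric])
  qed
  have \<Omega>small: "emeasure lebesgue (\<Omega> m) \<le> ennreal (vol q0 / 2 ^ m)" for m
  proof (induction m)
    case 0 then show ?case using emeasure_cell[of q0] q0 by (simp only: \<Omega>0) simp
  next
    case (Suc m)
    have "emeasure lebesgue (\<Omega> (Suc m)) \<le> ennreal (1/2) * ennreal (vol q0 / 2 ^ m)"
      using \<Omega>half[of m] Suc by (meson mult_left_mono order_trans zero_le)
    also have "\<dots> = ennreal (1/2 * (vol q0 / 2 ^ m))" by (rule ennreal_mult'[symmetric]) simp
    also have "\<dots> = ennreal (vol q0 / 2 ^ Suc m)" by (simp add: field_simps)
    finally show ?case .
  qed
  have "emeasure lebesgue (\<Inter>m. \<Omega> m) = 0"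
  proof -
    have "emeasure lebesgue (\<Inter>m. \<Omega> m) \<le> ennreal (vol q0 * (1/2) ^ m)" for m
      using emeasure_mono[of "\<Inter>m. \<Omega> m" "\<Omega> m" lebesgue] \<Omega>s \<Omega>small[of m]
      by (auto simp: power_divide intro: order_trans)
    moreover have "(\<lambda>m. ennreal (vol q0 * (1/2) ^ m)) \<longlonglongrightarrow> ennreal (vol q0 * 0)"
      by (intro tendsto_ennrealI tendsto_mult tendsto_const LIMSEQ_power_zero) auto
    ultimately have "emeasure lebesgue (\<Inter>m. \<Omega> m) \<le> ennreal (vol q0 * 0)"
      by (intro LIMSEQ_le_const) auto
    then show ?thesis by simp
  qed
  then have "(\<Inter>m. \<Omega> m) \<in> null_sets lebesgue" using \<Omega>s by (intro null_setsI) auto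
  then have ends: "AE x in lebesgue. \<exists>m. x \<notin> \<Omega> m" by (auto dest: AE_not_in)
  define g where "g m x = (if x \<in> \<Omega> m then a (THE q. q \<in> S m \<and> x \<in> cell q) else 0)" for m x
  have g_eq: "g m x = a q" if "q \<in> S m" "x \<in> cell q" for m x q
  proof -
    have "(THE q. q \<in> S m \<and> x \<in> cell q) = q" using uniq that by (intro the_equality) blast+
    then show ?thesis using that by (auto simp: g_def \<Omega>_def)
  qed
  have g0: "0 \<le> g m x" for m x using a(2) by (simp add: g_def)
  have gm: "g m \<in> borel_measurable lebesgue" for m
  proof (rule borel_measurableI_greater)
    fix y
    have "{x \<in> space lebesgue. y < g m x} = (\<Union>q\<in>{q\<in>S m. y < a q}. cell q) \<union> (if y < 0 then - \<Omega> m else {})" (is "?L = ?R")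
    proof (intro set_eqI)
      fix x show "x \<in> ?L \<longleftrightarrow> x \<in> ?R"
      proof (cases "x \<in> \<Omega> m")
        case True
        then obtain q where q: "q \<in> S m" "x \<in> cell q" by (auto simp: \<Omega>_def)
        have "x \<in> ?L \<longleftrightarrow> y < a q" using g_eq[OF q] by simp
        moreover have "x \<in> ?R \<longleftrightarrow> y < a q"
        proof
          assume "x \<in> ?R"
          then obtain q' where q': "q' \<in> S m" "y < a q'" "x \<in> cell q'" using True by (auto split: if_splits)
          then show "y < a q" using uniq[OF q'(1) q(1) q'(3) q(2)] by simp
        qed (use q in blast)
        ultimately show ?thesis by simp
      next
        case False
        then show ?thesis by (auto simp: g_def \<Omega>_def)
      qed
    qed
    moreover have "(\<Union>q\<in>{q\<in>S m. y < a q}. cell q) \<in> sets lebesgue"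
      by (rule sets.countable_UN'[OF countable_Collect[OF cS]]) auto
    moreover have "- \<Omega> m \<in> sets lebesgue" using sets.compl_sets[OF \<Omega>s[of m]] by (simp add: Compl_eq_Diff_UNIV)
    ultimately show "{x \<in> space lebesgue. y < g m x} \<in> sets lebesgue" by (simp add: sets.Un)
  qed
  have step: "norm (\<alpha> P - \<alpha> q) \<le> B * a q + B * a P" if q: "q \<in> S m" "P \<in> st q" for m q P
  proof -
    have gq: "good q (st q)" using st pos[OF q(1)] by blast
    have P: "0 < snd P" "emeasure lebesgue (E q \<inter> cell P) \<le> ennreal (vol P / 2)" using gq q(2) unfolding good_def by blast+
    \<comment> \<open>The exceptional sets of \<open>q\<close> and of \<open>P\<close> together
      do not fill \<open>P\<close>.\<close>
    have "\<exists>x\<in>cell P. x \<notin> E q \<and> x \<notin> E P"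
    proof (rule ccontr)
      assume "\<not> (\<exists>x\<in>cell P. x \<notin> E q \<and> x \<notin> E P)"
      then have "cell P \<subseteq> (E q \<inter> cell P) \<union> (E P \<inter> cell P)" by blast
      then have "emeasure lebesgue (cell P) \<le> emeasure lebesgue ((E q \<inter> cell P) \<union> (E P \<inter> cell P))"
        using E by (intro emeasure_mono) auto
      also have "\<dots> \<le> emeasure lebesgue (E q \<inter> cell P) + emeasure lebesgue (E P \<inter> cell P)"
        using E by (intro emeasure_subadditive) auto
      also have "\<dots> \<le> ennreal (vol P / 2) + ennreal (vol P / 2 ^ (DIM('a) + 2))"
        using P(2) osc[OF P(1)] unfolding Eq by (rule add_mono)
      also have "\<dots> = ennreal (vol P / 2 + vol P / 2 ^ (DIM('a) + 2))"
        using vol_pos[OF P(1)] by (simp add: ennreal_plus)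
      finally have "ennreal (vol P) \<le> ennreal (vol P / 2 + vol P / 2 ^ (DIM('a) + 2))"
        using P(1) by (simp only: emeasure_cell less_imp_le)
      then have "vol P \<le> vol P / 2 + vol P / 2 ^ (DIM('a) + 2)"
        by (subst (asm) ennreal_le_iff) (use vol_pos[OF P(1)] in auto)
      moreover have "vol P / 2 ^ (DIM('a) + 2) \<le> vol P / 4"
        using vol_pos[OF P(1)] by (intro divide_left_mono) auto
      ultimately show False using vol_pos[OF P(1)] by linarith
    qed
    then obtain x where "norm (b x - \<alpha> q) \<le> B * a q" "norm (b x - \<alpha> P) \<le> B * a P" by (auto simp: E_def not_less)
    then show ?thesis using norm_triangle_ineq4[of "b x - \<alpha> q" "b x - \<alpha> P"] by simp
  qed
  \<comment> \<open>The extra term \<open>B a(q)\<close> on the left makes room for both halves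
    of the next step.\<close>
  have chain: "norm (\<alpha> q - \<alpha> q0) + B * a q \<le> 2 * B * (\<Sum>j\<le>m. g j x)" if "q \<in> S m" "x \<in> cell q" for m q x
    using that
  proof (induction m arbitrary: q)
    case 0
    then have "q = q0" using S0 by simp
    then show ?case using g_eq[OF 0] B a(2)[of q] by (simp add: mult_right_mono)
  next
    case (Suc m)
    then obtain q' where q': "q' \<in> S m" "q \<in> st q'" by (auto simp: SS)
    then have x: "x \<in> cell q'" using st[of q'] pos[OF q'(1)] Suc.prems unfolding good_def by blast
    have "norm (\<alpha> q - \<alpha> q0) \<le> norm (\<alpha> q - \<alpha> q') + norm (\<alpha> q' - \<alpha> q0)"
      using norm_triangle_ineq[of "\<alpha> q - \<alpha> q'" "\<alpha> q' - \<alpha> q0"] by simp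
    then show ?case using Suc.IH[OF q'(1) x] step[OF q'] g_eq[OF Suc.prems] by (simp add: algebra_simps)
  qed
  have ae: "AE x in lebesgue. \<forall>m. \<forall>q\<in>S m. x \<in> cell q \<and> x \<notin> (\<Union>P\<in>st q. cell P) \<longrightarrow> norm (b x - \<alpha> q) \<le> B * a q"
  proof -
    have "AE x in lebesgue. x \<in> cell q \<and> x \<notin> (\<Union>P\<in>st q. cell P) \<longrightarrow> norm (b x - \<alpha> q) \<le> B * a q" if "q \<in> S m" for m q
    proof -
      have "E q \<inter> cell q - (\<Union>P\<in>st q. cell P) \<in> null_sets lebesgue" using st[of q] pos[OF that] unfolding good_def by blast
      then have "AE x in lebesgue. x \<notin> E q \<inter> cell q - (\<Union>P\<in>st q. cell P)" by (rule AE_not_in)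
      then show ?thesis by eventually_elim (auto simp: E_def)
    qed
    then show ?thesis by (simp add: AE_all_countable AE_ball_countable[OF cS])
  qed
  have pointwise: "AE x in lebesgue. x \<in> cell q0 \<longrightarrow> ennreal (norm (b x - \<alpha> q0)) \<le> (\<Sum>m. ennreal (2 * B) * ennreal (g m x))"
    using ends ae
  proof eventually_elim
    case (elim x)
    show ?case
    proof
      assume x0: "x \<in> cell q0"
      define k where "k = (LEAST m. x \<notin> \<Omega> m)"
      have k: "x \<notin> \<Omega> k" unfolding k_def using elim(1) by (rule LeastI_ex)
      then have "k \<noteq> 0" using x0 \<Omega>0 by metis
      then obtain m where m: "k = Suc m" by (cases k) auto
      then have "x \<in> \<Omega> m" using not_less_Least[of m "\<lambda>m. x \<notin> \<Omega> m"] k_def by auto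
      then obtain q where q: "q \<in> S m" "x \<in> cell q" by (auto simp: \<Omega>_def)
      have "x \<notin> (\<Union>P\<in>st q. cell P)" using next_part[OF q(1)] k m q(2) by blast
      then have "norm (b x - \<alpha> q) \<le> B * a q" using elim(2) q by blast
      then have "norm (b x - \<alpha> q0) \<le> 2 * B * (\<Sum>j\<le>m. g j x)"
        using chain[OF q] norm_triangle_ineq[of "b x - \<alpha> q" "\<alpha> q - \<alpha> q0"] by simp
      then have "ennreal (norm (b x - \<alpha> q0)) \<le> ennreal (\<Sum>j\<le>m. 2 * B * g j x)"
        by (intro ennreal_leI) (simp add: sum_distrib_left)
      also have "\<dots> = (\<Sum>j\<le>m. ennreal (2 * B) * ennreal (g j x))"
        using B g0 by (subst sum_ennreal[symmetric]) (auto simp: ennreal_mult)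
      also have "\<dots> \<le> (\<Sum>m. ennreal (2 * B) * ennreal (g m x))" by (rule sum_le_suminf) auto
      finally show "ennreal (norm (b x - \<alpha> q0)) \<le> (\<Sum>m. ennreal (2 * B) * ennreal (g m x))" .
    qed
  qed
  define h where "h m x = ennreal (g m x) * indicator (\<Omega> m - \<Omega> (Suc m)) x" for m x
  have hm: "h m \<in> borel_measurable lebesgue" for m
    unfolding h_def using gm \<Omega>s by (intro borel_measurable_times_ennreal borel_measurable_indicator measurable_compose[OF gm measurable_ennreal] sets.Diff)
  \<comment> \<open>At least half of each cube of generation \<open>m\<close> lies outside the
    next generation.\<close>
  have carleson: "(\<integral>\<^sup>+x. ennreal (g m x) \<partial>lebesgue) \<le> 2 * (\<integral>\<^sup>+x. h m x \<partial>lebesgue)" for m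
  proof -
    have "(\<integral>\<^sup>+x\<in>\<Omega> m. ennreal (g m x) \<partial>lebesgue) \<le> (\<integral>\<^sup>+x\<in>\<Omega> m. 2 * h m x \<partial>lebesgue)"
      unfolding \<Omega>_def
    proof (rule nn_integral_countable_union_mono[OF cS dS])
      fix q assume q: "q \<in> S m"
      have p: "0 < snd q" using pos[OF q] by blast
      have "(\<integral>\<^sup>+x\<in>cell q. ennreal (g m x) \<partial>lebesgue) = (\<integral>\<^sup>+x. ennreal (a q) * indicator (cell q) x \<partial>lebesgue)"
        using g_eq[OF q] by (intro nn_integral_cong) (auto simp: indicator_def)
      also have "\<dots> = ennreal (a q) * ennreal (vol q)" using p by (simp add: nn_integral_cmult emeasure_cell)
      also have "\<dots> \<le> ennreal (a q) * (2 * emeasure lebesgue (cell q - \<Omega> (Suc m)))"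
      proof (rule mult_left_mono)
        have "emeasure lebesgue (cell q) = emeasure lebesgue (\<Omega> (Suc m) \<inter> cell q) + emeasure lebesgue (cell q - \<Omega> (Suc m))"
          using \<Omega>s[of "Suc m"] by (subst plus_emeasure) (auto intro!: arg_cong[where f = "emeasure lebesgue"])
        also have "\<dots> \<le> ennreal (vol q / 2) + emeasure lebesgue (cell q - \<Omega> (Suc m))"
          using half_mass[OF q] by (rule add_right_mono)
        finally have 1: "ennreal (vol q) \<le> ennreal (vol q / 2) + emeasure lebesgue (cell q - \<Omega> (Suc m))"
          using p by (simp add: emeasure_cell)
        have "emeasure lebesgue (cell q - \<Omega> (Suc m)) \<le> emeasure lebesgue (cell q)" using \<Omega>s by (intro emeasure_mono) auto
        then obtain t where t: "emeasure lebesgue (cell q - \<Omega> (Suc m)) = ennreal t" "0 \<le> t"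
          using p by (cases "emeasure lebesgue (cell q - \<Omega> (Suc m))") (auto simp: emeasure_cell top_unique)
        have "vol q \<le> vol q / 2 + t"
          using 1 vol_pos[OF p] t by (simp add: ennreal_plus[symmetric] ennreal_le_iff del: ennreal_plus)
        then have "ennreal (vol q) \<le> ennreal (2 * t)" by (intro ennreal_leI) simp
        then show "ennreal (vol q) \<le> 2 * emeasure lebesgue (cell q - \<Omega> (Suc m))"
          using t by (simp add: ennreal_mult)
      qed simp
      also have "\<dots> = (\<integral>\<^sup>+x. ennreal (a q) * 2 * indicator (cell q - \<Omega> (Suc m)) x \<partial>lebesgue)"
        using \<Omega>s by (subst nn_integral_cmult_indicator) (auto simp: mult.assoc)
      also have "\<dots> \<le> (\<integral>\<^sup>+x\<in>cell q. 2 * h m x \<partial>lebesgue)"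
      proof (rule nn_integral_mono)
        fix x show "ennreal (a q) * 2 * indicator (cell q - \<Omega> (Suc m)) x \<le> 2 * h m x * indicator (cell q) x"
          using g_eq[OF q, of x] q by (auto simp: h_def indicator_def \<Omega>_def mult.commute)
      qed
      finally show "(\<integral>\<^sup>+x\<in>cell q. ennreal (g m x) \<partial>lebesgue) \<le> (\<integral>\<^sup>+x\<in>cell q. 2 * h m x \<partial>lebesgue)" .
    qed (use gm hm in auto)
    also have "\<dots> \<le> (\<integral>\<^sup>+x. 2 * h m x \<partial>lebesgue)" by (intro nn_integral_mono) (auto simp: indicator_def)
    also have "\<dots> = 2 * (\<integral>\<^sup>+x. h m x \<partial>lebesgue)" by (rule nn_integral_cmult[OF hm])
    also have "(\<integral>\<^sup>+x\<in>\<Omega> m. ennreal (g m x) \<partial>lebesgue) = (\<integral>\<^sup>+x. ennreal (g m x) \<partial>lebesgue)"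
      by (intro nn_integral_cong) (auto simp: indicator_def g_def)
    finally show ?thesis .
  qed
  let ?Q = "ccube (fst q0) (snd q0)"
  let ?M = "HL_maximal (\<lambda>y. \<nu> y * indicator ?Q y)"
  \<comment> \<open>At most one term is nonzero, since the sets \<open>\<Omega> m - \<Omega>
    (Suc m)\<close> are disjoint; it is an average over a cube that contains
    \<open>x\<close>.\<close>
  have maxi: "(\<Sum>m. h m x) \<le> ?M x * indicator ?Q x" for x
  proof (cases "\<exists>m. x \<in> \<Omega> m - \<Omega> (Suc m)")
    case False
    then have "h m x = 0" for m by (auto simp: h_def indicator_def)
    then show ?thesis by simp
  next
    case True
    then obtain m where m: "x \<in> \<Omega> m" "x \<notin> \<Omega> (Suc m)" by blast
    have "antimono \<Omega>" using \<Omega>dec by (rule decseq_SucI)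
    then have le: "\<Omega> j \<subseteq> \<Omega> i" if "i \<le> j" for i j using that by (rule antimonoD)
    have "h j x = 0" if "j \<noteq> m" for j
    proof (cases "j < m")
      case True then show ?thesis using le[of "Suc j" m] m by (auto simp: h_def indicator_def)
    next
      case False
      then have "Suc m \<le> j" using that by simp
      then show ?thesis using le[of "Suc m" j] m by (auto simp: h_def indicator_def)
    qed
    then have "(\<Sum>j. h j x) = (\<Sum>j\<in>{m}. h j x)" by (intro suminf_finite) auto
    also have "\<dots> \<le> ?M x"
    proof -
      obtain q where q: "q \<in> S m" "x \<in> cell q" using m by (auto simp: \<Omega>_def)
      have p: "0 < snd q" "cell q \<subseteq> cell q0" using pos[OF q(1)] by auto
      have "ennreal (a q) = weight_mass \<nu> (cell q) / ennreal (vol q)"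
        unfolding a(1)[OF p(1), symmetric] using vol_pos[OF p(1)]
        by (simp add: ennreal_mult_divide_eq)
      also have "\<dots> \<le> avg (ccube (fst q) (snd q)) (\<lambda>y. ennreal \<bar>\<nu> y * indicator ?Q y\<bar>)"
        unfolding avg_def
      proof -
        have "weight_mass \<nu> (cell q) \<le> (\<integral>\<^sup>+y\<in>ccube (fst q) (snd q). ennreal \<bar>\<nu> y * indicator ?Q y\<bar> \<partial>lebesgue)"
          unfolding weight_mass_def
          using p(2) cell_subset_ccube[of q] cell_subset_ccube[of q0]
          by (intro nn_integral_mono) (auto simp: indicator_def intro!: ennreal_leI)
        then show "weight_mass \<nu> (cell q) / ennreal (vol q)
          \<le> (\<integral>\<^sup>+y\<in>ccube (fst q) (snd q). ennreal \<bar>\<nu> y * indicator ?Q y\<bar> \<partial>lebesgue) / emeasure lebesgue (ccube (fst q) (snd q))"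
          using p(1) by (simp add: emeasure_ccube vol_def divide_right_mono_ennreal)
      qed
      also have "\<dots> \<le> ?M x"
        unfolding HL_maximal_def
        by (rule SUP_upper) (use q p cell_subset_ccube[of q] in \<open>auto simp: cubes_eq\<close>)
      finally have "ennreal (a q) \<le> ?M x" .
      then show ?thesis using g_eq[OF q] m by (simp add: h_def)
    qed
    also have "x \<in> ?Q" using m(1) le[of 0 m] \<Omega>0 cell_subset_ccube[of q0] by blast
    then have "?M x = ?M x * indicator ?Q x" by simp
    finally show ?thesis .
  qed
  have wm: "weight_mass \<nu> ?Q = weight_mass \<nu> (cell q0)" unfolding weight_mass_def by (rule nn_integral_ccube_cell)
  have "(\<integral>\<^sup>+x\<in>?Q. ?M x \<partial>lebesgue) / weight_mass \<nu> ?Q \<le> ennreal A"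
  proof -
    have "(\<integral>\<^sup>+x\<in>?Q. ?M x \<partial>lebesgue) / weight_mass \<nu> ?Q \<le> Ainf_const \<nu>"
      unfolding Ainf_const_def by (rule SUP_upper2[of ?Q]) (use q0 in \<open>auto simp: cubes_eq\<close>)
    then show ?thesis using A by (rule order_trans)
  qed
  moreover have "weight_mass \<nu> ?Q \<noteq> \<infinity>" using weight_mass_finite[OF w order_refl] by (simp add: less_top)
  moreover have "weight_mass \<nu> ?Q \<noteq> 0"
  proof
    assume z: "weight_mass \<nu> ?Q = 0"
    have "AE x in lebesgue. ennreal (\<nu> x) * indicator ?Q x = 0"
      using z weight_measurable[OF w] unfolding weight_mass_def
      by (subst (asm) nn_integral_0_iff_AE) auto
    then have "AE x in lebesgue. x \<notin> ?Q"
    proof eventually_elim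
      case (elim x)
      have "0 < \<nu> x" using w by (simp add: weight_def)
      then have "ennreal (\<nu> x) \<noteq> 0" by (simp add: ennreal_eq_0_iff not_le)
      then show ?case using elim by (auto simp: indicator_def split: if_splits)
    qed
    then have "emeasure lebesgue ?Q = 0" using emeasure_eq_0_AE[of "\<lambda>x. x \<in> ?Q" lebesgue] by simp
    then show False using emeasure_ccube[of "snd q0" "fst q0"] q0 by simp
  qed
  ultimately have "(\<integral>\<^sup>+x\<in>?Q. ?M x \<partial>lebesgue) \<le> ennreal A * weight_mass \<nu> (cell q0)"
  proof -
    assume *: "(\<integral>\<^sup>+x\<in>?Q. ?M x \<partial>lebesgue) / weight_mass \<nu> ?Q \<le> ennreal A"
      "weight_mass \<nu> ?Q \<noteq> \<infinity>" "weight_mass \<nu> ?Q \<noteq> 0"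
    have "(\<integral>\<^sup>+x\<in>?Q. ?M x \<partial>lebesgue) = (\<integral>\<^sup>+x\<in>?Q. ?M x \<partial>lebesgue) / weight_mass \<nu> ?Q * weight_mass \<nu> ?Q"
    proof -
      have "weight_mass \<nu> ?Q / weight_mass \<nu> ?Q = 1" using *(2,3) by (intro ennreal_divide_self) (auto simp: less_top)
      then show ?thesis by (simp add: ennreal_divide_times)
    qed
    also have "\<dots> \<le> ennreal A * weight_mass \<nu> ?Q" using *(1) by (rule mult_right_mono) simp
    finally show ?thesis unfolding wm .
  qed
  then have fin: "(\<Sum>m. \<integral>\<^sup>+x. h m x \<partial>lebesgue) \<le> ennreal A * weight_mass \<nu> (cell q0)"
    using nn_integral_mono[of lebesgue "\<lambda>x. \<Sum>m. h m x" "\<lambda>x. ?M x * indicator ?Q x"] maxi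
    by (simp add: nn_integral_suminf[OF hm, symmetric] order_trans)
  have "(\<integral>\<^sup>+x\<in>cell q0. ennreal (norm (b x - \<alpha> q0)) \<partial>lebesgue) \<le> (\<integral>\<^sup>+x. (\<Sum>m. ennreal (2 * B) * ennreal (g m x)) \<partial>lebesgue)"
    by (rule nn_integral_mono_AE) (use pointwise in \<open>auto elim!: eventually_mono simp: indicator_def\<close>)
  also have "\<dots> = (\<Sum>m. \<integral>\<^sup>+x. ennreal (2 * B) * ennreal (g m x) \<partial>lebesgue)"
    using gm by (intro nn_integral_suminf) auto
  also have "\<dots> = (\<Sum>m. ennreal (2 * B) * \<integral>\<^sup>+x. ennreal (g m x) \<partial>lebesgue)"
    using gm by (intro suminf_cong nn_integral_cmult) auto
  also have "\<dots> \<le> (\<Sum>m. ennreal (2 * B) * (2 * \<integral>\<^sup>+x. h m x \<partial>lebesgue))"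
    by (intro suminf_le mult_left_mono carleson) auto
  also have "\<dots> = ennreal (4 * B) * (\<Sum>m. \<integral>\<^sup>+x. h m x \<partial>lebesgue)"
  proof -
    have "ennreal (2 * B) * 2 = ennreal (4 * B)" using B by (simp add: ennreal_mult'[symmetric] flip: ennreal_numeral)
    then show ?thesis by (simp add: mult.assoc[symmetric])
  qed
  also have "\<dots> \<le> ennreal (4 * B) * (ennreal A * weight_mass \<nu> (cell q0))" using fin by (rule mult_left_mono) simp
  finally show ?thesis .
qed

section \<open>A cube on which the kernel is almost constant\<close>

lemma ccube_norm: "x \<in> ccube c r \<Longrightarrow> norm (x - c :: 'a::euclidean_space) \<le> real DIM('a) * r"
proof -
  assume x: "x \<in> ccube c r"
  have "norm (x - c) \<le> (\<Sum>e\<in>Basis. \<bar>(x - c) \<bullet> e\<bar>)" by (rule norm_le_l1)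
  also have "\<dots> \<le> (\<Sum>e\<in>(Basis::'a set). r)"
  proof (rule sum_mono)
    fix e :: 'a assume e: "e \<in> Basis"
    have "c \<bullet> e - r \<le> x \<bullet> e \<and> x \<bullet> e \<le> c \<bullet> e + r" using x e unfolding mem_ccube by blast
    then show "\<bar>(x - c) \<bullet> e\<bar> \<le> r" unfolding inner_diff_left by linarith
  qed
  finally show ?thesis by simp
qed

lemma ccube_subset:
  assumes "norm (x - y :: 'a::euclidean_space) + r \<le> s" shows "ccube x r \<subseteq> ccube y s"
proof
  fix z assume z: "z \<in> ccube x r"
  show "z \<in> ccube y s" unfolding mem_ccube
  proof
    fix e :: 'a assume e: "e \<in> Basis"
    have "\<bar>(x - y) \<bullet> e\<bar> \<le> norm (x - y)" using Basis_le_norm[OF e] .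
    moreover have "x \<bullet> e - r \<le> z \<bullet> e \<and> z \<bullet> e \<le> x \<bullet> e + r" using z e unfolding mem_ccube by blast
    ultimately show "y \<bullet> e - s \<le> z \<bullet> e \<and> z \<bullet> e \<le> y \<bullet> e + s" using assms unfolding inner_diff_left by linarith
  qed
qed

text \<open>
  Non-degeneracy is applied with the radius \<open>\<Lambda> l\<close>. The size condition
  bounds the distance of the point found from above by a multiple of \<open>\<Lambda> l\<close>,
  hence both cubes lie in a cube of side comparable to \<open>l\<close>; and the regularity
  condition bounds the variation of the kernel by its lower bound times a multiple of
  \<open>\<omega> (2 d / \<Lambda>)\<close>, which is small for large \<open>\<Lambda>\<close>.
\<close>

lemma kernel_almost_constant:
  fixes \<omega> :: "real \<Rightarrow> real" and C c :: real
  assumes C: "0 < C" and c: "0 < c" and \<omega>: "modulus \<omega>"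
  shows "\<exists>\<Lambda> \<rho>. 0 < \<Lambda> \<and> 1 \<le> \<rho> \<and> (\<forall>(K :: 'a::euclidean_space \<Rightarrow> ('n::finite \<Rightarrow> 'a) \<Rightarrow> complex) y0 l.
     kernel_size C K \<and> kernel_regular C \<omega> K \<and> kernel_nondegenerate c K \<and> 0 < l \<longrightarrow>
     (\<exists>x0 \<kappa>. c / (\<Lambda> * l) ^ (CARD('n) * DIM('a)) \<le> norm \<kappa> \<and> ccube x0 l \<inter> ccube y0 l = {} \<and> ccube x0 l \<subseteq> ccube y0 (\<rho> * l) \<and>
        (\<forall>x\<in>ccube x0 l. \<forall>y. (\<forall>j. y j \<in> ccube y0 l) \<longrightarrow> norm (K x y - \<kappa>) \<le> norm \<kappa> / 4)))"
proof -
  let ?N = "CARD('n) * DIM('a)"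
  define d where "d = real DIM('a)"
  have d: "1 \<le> d" unfolding d_def using DIM_positive[where 'a = 'a] by (simp add: Suc_le_eq)
  have n: "1 \<le> real CARD('n)" by (simp add: Suc_le_eq)
  \<comment> \<open>There are \<open>n + 1\<close> changes of variable, each at distance at
    least \<open>\<Lambda> l / 2\<close>; the factor 4 leaves a quarter of
    \<open>\<kappa>\<close>.\<close>
  define e where "e = c / (4 * (real CARD('n) + 1) * C * 2 ^ ?N)"
  have e: "0 < e" unfolding e_def using c C n by (auto intro!: divide_pos_pos mult_pos_pos)
  obtain t where t: "0 < t" "\<omega> t < e" using modulus_small[OF \<omega> e] .
  define \<Lambda> where "\<Lambda> = max (4 * d) (2 * d / t)"
  have \<Lambda>: "4 * d \<le> \<Lambda>" "2 * d / t \<le> \<Lambda>" "0 < \<Lambda>" using d by (auto simp: \<Lambda>_def)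
  define M where "M = max 1 (C / c)"
  have M: "1 \<le> M" "C / c \<le> M" by (auto simp: M_def)
  define \<rho> where "\<rho> = M * \<Lambda> + 1"
  have \<rho>: "1 \<le> \<rho>" using M \<Lambda> by (simp add: \<rho>_def)
  have "\<exists>x0 \<kappa>. c / (\<Lambda> * l) ^ ?N \<le> norm \<kappa> \<and> ccube x0 l \<inter> ccube y0 l = {} \<and> ccube x0 l \<subseteq> ccube y0 (\<rho> * l) \<and>
        (\<forall>x\<in>ccube x0 l. \<forall>y. (\<forall>j. y j \<in> ccube y0 l) \<longrightarrow> norm (K x y - \<kappa>) \<le> norm \<kappa> / 4)"
    if K: "kernel_size C K" "kernel_regular C \<omega> K" "kernel_nondegenerate c K" and l: "0 < l"
    for K :: "'a \<Rightarrow> ('n \<Rightarrow> 'a) \<Rightarrow> complex" and y0 :: 'a and l :: real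
  proof -
    have Ll: "0 < \<Lambda> * l" using \<Lambda> l by simp
    obtain x0 where x0: "x0 \<notin> ball y0 (\<Lambda> * l)" "c / (\<Lambda> * l) ^ ?N \<le> norm (K x0 (\<lambda>_. y0))"
      using K(3) Ll unfolding kernel_nondegenerate_def by blast
    define \<kappa> where "\<kappa> = K x0 (\<lambda>_. y0)"
    have far: "\<Lambda> * l \<le> norm (x0 - y0)" using x0(1) by (simp add: dist_norm norm_minus_commute)
    have off: "off_diag x0 (\<lambda>_::'n. y0)" using far Ll by (auto simp: off_diag_def)
    define D where "D = real CARD('n) * norm (x0 - y0)"
    have D: "norm (x0 - y0) \<le> D" "0 < D" unfolding D_def using n far Ll mult_right_mono[OF n, of "norm (x0 - y0)"] by (auto intro!: mult_pos_pos)
    have "norm \<kappa> \<le> C / D ^ ?N"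
      using K(1) off unfolding kernel_size_def \<kappa>_def D_def kernel_dist_def by force
    then have "c / (\<Lambda> * l) ^ ?N \<le> C / D ^ ?N" using x0(2) unfolding \<kappa>_def by linarith
    moreover have "Y \<le> (C / c) * X" if "0 < X" "0 < Y" "c / X \<le> C / Y" for X Y
      using that c by (simp add: field_simps)
    ultimately have "D ^ ?N \<le> (C / c) * (\<Lambda> * l) ^ ?N" using Ll D(2) by simp
    also have "\<dots> \<le> M ^ ?N * (\<Lambda> * l) ^ ?N"
    proof (rule mult_right_mono)
      have "M ^ 1 \<le> M ^ ?N" using M by (intro power_increasing) (auto simp: Suc_le_eq)
      then show "C / c \<le> M ^ ?N" using M by simp
    qed (use Ll in simp)
    also have "\<dots> = (M * (\<Lambda> * l)) ^ ?N" by (simp only: power_mult_distrib)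
    finally have "D \<le> M * (\<Lambda> * l)"
      using power_mono_iff[of D "M * (\<Lambda> * l)" ?N] D M Ll by simp
    then have near: "norm (x0 - y0) + l \<le> \<rho> * l" using D by (simp add: \<rho>_def algebra_simps)
    define \<delta> where "\<delta> = \<Lambda> * l / 2"
    have \<delta>: "0 < \<delta>" using Ll by (simp add: \<delta>_def)
    have dl: "d * l \<le> \<delta> / 2" using \<Lambda>(1) l mult_right_mono[OF \<Lambda>(1), of l] by (simp add: \<delta>_def)
    have sep: "\<delta> \<le> norm (x - y)" if "norm (x - x0) \<le> d * l" "norm (y - y0) \<le> d * l" for x y
    proof -
      have "norm (x0 - y0) \<le> norm (x - y) + norm (x - x0) + norm (y - y0)"
        using norm_triangle_ineq4[of "x - y" "x - x0"] norm_triangle_ineq[of "x0 - y" "y - y0"] by simp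
      then show ?thesis using that far dl unfolding \<delta>_def by linarith
    qed
    have "d * l / \<delta> \<le> t"
    proof -
      have "2 * d \<le> \<Lambda> * t" using \<Lambda>(2) t(1) by (simp add: field_simps)
      then show ?thesis using l \<Lambda>(3) by (simp add: \<delta>_def field_simps)
    qed
    then have \<omega>t: "\<omega> (d * l / \<delta>) \<le> e"
      using modulus_mono[OF \<omega>, of "d * l / \<delta>" t] t d l \<delta> by simp
    have small: "norm (K x y - \<kappa>) \<le> norm \<kappa> / 4" if x: "x \<in> ccube x0 l" and y: "\<forall>j. y j \<in> ccube y0 l" for x y
    proof -
      have nx: "norm (x - x0) \<le> d * l" using ccube_norm[OF x] by (simp add: d_def)
      have ny: "norm (y j - y0) \<le> d * l" for j using ccube_norm y unfolding d_def by blast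
      have z: "norm (y0 - y0) \<le> d * l" "norm (x0 - x0) \<le> d * l" using d l by simp_all
      have 1: "norm (K x y - K x (\<lambda>_. y0)) \<le> real CARD('n) * (C / \<delta> ^ ?N * \<omega> (d * l / \<delta>))"
        by (rule kernel_slots_change[OF K(2) \<omega> less_imp_le[OF C] \<delta>]) (use sep[OF nx] ny z dl in auto)
      have 2: "norm (K x (\<lambda>_. y0) - K x0 (\<lambda>_. y0)) \<le> C / \<delta> ^ ?N * \<omega> (d * l / \<delta>)"
        by (rule kernel_base_change[OF K(2) \<omega> less_imp_le[OF C] \<delta>]) (use sep[OF z(2) z(1)] nx dl in auto)
      have "norm (K x y - \<kappa>) \<le> norm (K x y - K x (\<lambda>_. y0)) + norm (K x (\<lambda>_. y0) - K x0 (\<lambda>_. y0))"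
        unfolding \<kappa>_def using norm_triangle_ineq[of "K x y - K x (\<lambda>_. y0)" "K x (\<lambda>_. y0) - K x0 (\<lambda>_. y0)"] by simp
      also have "\<dots> \<le> real CARD('n) * (C / \<delta> ^ ?N * \<omega> (d * l / \<delta>)) + C / \<delta> ^ ?N * \<omega> (d * l / \<delta>)"
        using 1 2 by (rule add_mono)
      also have "\<dots> = (real CARD('n) + 1) * (C / \<delta> ^ ?N * \<omega> (d * l / \<delta>))" by (simp only: distrib_right mult_1)
      also have "\<dots> \<le> (real CARD('n) + 1) * (C / \<delta> ^ ?N * e)"
        using C \<delta> \<omega>t by (intro mult_left_mono) auto
      also have "\<dots> = c / (\<Lambda> * l) ^ ?N / 4"
      proof -
        have gen: "m * (C / X * (c / (4 * m * C * Y))) = c / (X * Y) / 4" if "0 < m" "X \<noteq> 0" "Y \<noteq> 0" for m X Y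
          using that C by (simp add: field_simps)
        have "(real CARD('n) + 1) * (C / \<delta> ^ ?N * e) = c / (\<delta> ^ ?N * 2 ^ ?N) / 4"
          unfolding e_def by (rule gen) (use \<delta> n in auto)
        moreover have "\<delta> ^ ?N * 2 ^ ?N = (\<Lambda> * l) ^ ?N" unfolding \<delta>_def by (simp add: power_mult_distrib[symmetric])
        ultimately show ?thesis by simp
      qed
      also have "\<dots> \<le> norm \<kappa> / 4" using x0(2) by (simp add: \<kappa>_def)
      finally show ?thesis .
    qed
    have disj: "ccube x0 l \<inter> ccube y0 l = {}"
    proof (rule ccontr)
      assume "ccube x0 l \<inter> ccube y0 l \<noteq> {}"
      then obtain z where "z \<in> ccube x0 l" "z \<in> ccube y0 l" by blast
      then have "\<delta> \<le> norm (z - z)" using ccube_norm unfolding d_def by (intro sep) (auto simp: d_def)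
      then show False using \<delta> by simp
    qed
    show ?thesis
      using x0(2) disj ccube_subset[OF near] small unfolding \<kappa>_def by blast
  qed
  then show ?thesis using \<Lambda>(3) \<rho> by blast
qed

section \<open>Muckenhoupt weights are almost constant on most of a cube\<close>

lemma Chebyshev_cube:
  assumes "h \<in> borel_measurable lebesgue" "\<And>x. 0 \<le> h x" "0 < r" "0 < T" "0 < s"
    and "avg (ccube c r) (\<lambda>x. ennreal (h x)) = ennreal s"
  shows "emeasure lebesgue {x \<in> ccube c r. T * s < h x} \<le> ennreal (1 / T) * emeasure lebesgue (ccube c r :: 'a::euclidean_space set)"
proof -
  let ?R = "ccube c r"
  define V where "V = (2 * r) ^ DIM('a)"
  have V: "0 < V" "emeasure lebesgue ?R = ennreal V" using assms(3) emeasure_ccube[of r c] by (auto simp: V_def)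
  have I: "(\<integral>\<^sup>+x\<in>?R. ennreal (h x) \<partial>lebesgue) = ennreal (s * V)"
  proof -
    have "(\<integral>\<^sup>+x\<in>?R. ennreal (h x) \<partial>lebesgue) / ennreal V = ennreal s" using assms(6) V by (simp add: avg_def)
    then have "(\<integral>\<^sup>+x\<in>?R. ennreal (h x) \<partial>lebesgue) / ennreal V * ennreal V = ennreal s * ennreal V" by simp
    moreover have "X / ennreal V * ennreal V = X" for X
      using V(1) ennreal_divide_self[of "ennreal V"] by (simp add: ennreal_divide_times)
    ultimately show ?thesis using assms(5) V(1) by (simp add: ennreal_mult)
  qed
  have "emeasure lebesgue {x \<in> ?R. T * s < h x} \<le> emeasure lebesgue {x \<in> ?R. 1 \<le> ennreal (1 / (T * s)) * ennreal (h x)}"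
  proof (rule emeasure_mono)
    show "{x \<in> ?R. T * s < h x} \<subseteq> {x \<in> ?R. 1 \<le> ennreal (1 / (T * s)) * ennreal (h x)}"
    proof safe
      fix x assume "T * s < h x"
      then have "1 \<le> 1 / (T * s) * h x" using assms by (simp add: field_simps)
      then have "ennreal 1 \<le> ennreal (1 / (T * s) * h x)" by (rule ennreal_leI)
      also have "\<dots> = ennreal (1 / (T * s)) * ennreal (h x)" using assms(4,5) by (intro ennreal_mult') simp
      finally show "1 \<le> ennreal (1 / (T * s)) * ennreal (h x)" by simp
    qed
    have "{x \<in> space lebesgue. x \<in> ?R \<and> 1 \<le> ennreal (1 / (T * s)) * ennreal (h x)} \<in> sets lebesgue" using assms(1) by measurable
    then show "{x \<in> ?R. 1 \<le> ennreal (1 / (T * s)) * ennreal (h x)} \<in> sets lebesgue" by simp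
  qed
  also have "\<dots> \<le> ennreal (1 / (T * s)) * (\<integral>\<^sup>+x\<in>?R. ennreal (h x) \<partial>lebesgue)"
    by (rule nn_integral_Markov_inequality) (use assms(1) in auto)
  also have "\<dots> = ennreal (1 / T) * emeasure lebesgue ?R"
    unfolding I V(2) using assms V(1) by (simp add: ennreal_mult[symmetric])
  finally show ?thesis .
qed

lemma total_exp_pos: "(\<And>j. 1 < p j) \<Longrightarrow> 0 < total_exp (p :: 'n::finite \<Rightarrow> real)"
  unfolding total_exp_def using less_trans[OF zero_less_one] by (auto intro!: sum_pos divide_pos_pos)

lemma inverse_total_exp: "1 / total_exp p = (\<Sum>j\<in>UNIV. 1 / p j)" by (simp add: total_exp_def)

text \<open>
  The last identity says that \<open>w powr (1 / q)\<close> is the dual weight to the power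
  \<open>- 1 / conj_exp q\<close>.
\<close>

lemma conj_exp_props:
  assumes "1 < q"
  shows "1 < conj_exp q" "1 / conj_exp q = 1 - 1 / q" "(1 - conj_exp q) * (1 / conj_exp q) = - (1 / q)"
  using assms by (simp_all add: conj_exp_def field_simps)

lemma avg_pos:
  assumes "h \<in> borel_measurable lebesgue" "\<And>x. 0 < h x" "0 < r"
  shows "avg (ccube c r) (\<lambda>x. ennreal (h x)) \<noteq> 0"
proof
  assume "avg (ccube c r) (\<lambda>x. ennreal (h x)) = 0"
  then have "(\<integral>\<^sup>+x\<in>ccube c r. ennreal (h x) \<partial>lebesgue) = 0"
    using assms(3) by (auto simp: avg_def ennreal_divide_eq_0_iff emeasure_ccube)
  then have "AE x in lebesgue. ennreal (h x) * indicator (ccube c r) x = 0"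
    using assms(1) by (subst (asm) nn_integral_0_iff_AE) auto
  then have "AE x in lebesgue. x \<notin> ccube c r"
  proof eventually_elim
    case (elim x)
    have "ennreal (h x) \<noteq> 0" using assms(2)[of x] by (simp add: ennreal_eq_0_iff not_le)
    then show ?case using elim by (auto simp: indicator_def split: if_splits)
  qed
  then have "emeasure lebesgue (ccube c r) = 0" using emeasure_eq_0_AE[of "\<lambda>x. x \<in> ccube c r" lebesgue] by simp
  then show False using assms(3) by (simp add: emeasure_ccube)
qed

lemma epowr_pos: "x \<noteq> 0 \<Longrightarrow> epowr x a \<noteq> 0"
  by (cases x) (auto simp: epowr_def ennreal_eq_0_iff)

text \<open>
  All factors of the product defining the constant are nonzero, so that its finiteness makes
  each of them finite.
\<close>

lemma Ap_averages:
  fixes p :: "'n::finite \<Rightarrow> real" and w :: "'n \<Rightarrow> 'a::euclidean_space \<Rightarrow> real"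
  assumes p: "\<And>j. 1 < p j" and w: "in_Ap p w" "Ap_const p w \<le> ennreal A" and r: "0 < r"
  shows "\<exists>S s. 0 < S \<and> (\<forall>j. 0 < s j) \<and>
    avg (ccube c r) (\<lambda>x. ennreal (\<Prod>j\<in>UNIV. w j x powr (total_exp p / p j))) = ennreal S \<and>
    (\<forall>j. avg (ccube c r) (\<lambda>x. ennreal (w j x powr (1 - conj_exp (p j)))) = ennreal (s j)) \<and>
    S * (\<Prod>j\<in>UNIV. s j powr (total_exp p / conj_exp (p j))) \<le> A"
proof -
  let ?P = "total_exp p"
  let ?R = "ccube c r"
  have wj: "weight (w j)" for j using w(1) by (simp add: in_Ap_def)
  have wm: "w j \<in> borel_measurable lebesgue" for j using weight_measurable[OF wj] .
  have wp: "0 < w j x" for j x using wj unfolding weight_def by blast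
  have wn: "w j x \<noteq> 0" for j x using wp[of j x] by simp
  define a where "a = avg ?R (\<lambda>x. ennreal (\<Prod>j\<in>UNIV. w j x powr (?P / p j)))"
  define b where "b j = avg ?R (\<lambda>x. ennreal (w j x powr (1 - conj_exp (p j))))" for j
  have a0: "a \<noteq> 0" unfolding a_def by (rule avg_pos[OF _ _ r]) (use wm wn in \<open>auto intro!: prod_pos\<close>)
  have b0: "b j \<noteq> 0" for j unfolding b_def by (rule avg_pos[OF _ _ r]) (use wm wn in auto)
  have le: "a * (\<Prod>j\<in>UNIV. epowr (b j) (?P / conj_exp (p j))) \<le> ennreal A"
  proof -
    have "a * (\<Prod>j\<in>UNIV. epowr (b j) (?P / conj_exp (p j))) \<le> Ap_const p w"
      unfolding Ap_const_def a_def b_def by (rule SUP_upper) (use r in \<open>auto simp: cubes_eq\<close>)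
    then show ?thesis using w(2) by (rule order_trans)
  qed
  have prod0: "(\<Prod>j\<in>I. epowr (b j) (?P / conj_exp (p j))) \<noteq> 0" if "finite I" for I
    using that epowr_pos[OF b0] by (simp add: prod_zero_iff)
  have atop: "a \<noteq> \<infinity>"
  proof
    assume "a = \<infinity>"
    then have "a * (\<Prod>j\<in>UNIV. epowr (b j) (?P / conj_exp (p j))) = \<infinity>" using prod0[of UNIV] by (simp add: ennreal_top_mult)
    then show False using le by (simp add: top_unique)
  qed
  have btop: "b j \<noteq> \<infinity>" for j
  proof
    assume "b j = \<infinity>"
    then have "(\<Prod>j\<in>UNIV. epowr (b j) (?P / conj_exp (p j))) = \<infinity>"
      using prod0[of "UNIV - {j}"] by (subst prod.remove[of UNIV j]) (auto simp: epowr_def ennreal_top_mult)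
    then have "a * (\<Prod>j\<in>UNIV. epowr (b j) (?P / conj_exp (p j))) = \<infinity>" using a0 by (simp add: ennreal_mult_top)
    then show False using le by (simp add: top_unique)
  qed
  define S where "S = enn2real a"
  define s where "s j = enn2real (b j)" for j
  have S: "a = ennreal S" "0 < S" using a0 atop unfolding S_def
    by (auto simp: enn2real_positive_iff less_top zero_less_iff_neq_zero)
  have s: "b j = ennreal (s j)" "0 < s j" for j using b0[of j] btop[of j] unfolding s_def
    by (auto simp: enn2real_positive_iff less_top zero_less_iff_neq_zero)
  have "(\<Prod>j\<in>UNIV. epowr (b j) (?P / conj_exp (p j))) = ennreal (\<Prod>j\<in>UNIV. s j powr (?P / conj_exp (p j)))"
    using s(2) unfolding s(1) by (simp add: epowr_def prod_ennreal less_imp_le)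
  then have "ennreal (S * (\<Prod>j\<in>UNIV. s j powr (?P / conj_exp (p j)))) \<le> ennreal A"
    using le S by (simp add: ennreal_mult prod_nonneg)
  moreover have pos: "0 < S * (\<Prod>j\<in>UNIV. s j powr (?P / conj_exp (p j)))"
    using S(2) s(2) less_imp_neq[OF s(2)] by (intro mult_pos_pos prod_pos) auto
  ultimately have "S * (\<Prod>j\<in>UNIV. s j powr (?P / conj_exp (p j))) \<le> A"
    by (metis ennreal_le_iff2 less_eq_real_def not_le)
  then show ?thesis
    using S(2) s(2) S(1)[unfolded a_def] s(1)[unfolded b_def] by (intro exI[of _ S] exI[of _ s] conjI allI)
qed

text \<open>
  With \<open>v\<close> the product weight and \<open>\<sigma>\<^sub>j\<close> the dual weights,
  \<open>v\<^bsup>1/p\<^esup>\<close> times the product of the \<open>\<sigma>\<^sub>j\<close>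
  to the powers \<open>1 / conj_exp (p j)\<close> is identically 1, while the weight condition
  says that the same product of averages is at most \<open>A\<^bsup>1/p\<^esup>\<close>. By
  Chebyshev's inequality each factor is at most \<open>T\<close> times its average off a small
  set. As the product is 1, each factor is then also bounded below by a multiple of its average.
\<close>

lemma weights_almost_constant:
  fixes p :: "'n::finite \<Rightarrow> real" and w :: "'n \<Rightarrow> 'a::euclidean_space \<Rightarrow> real"
  assumes p: "\<And>j. 1 < p j" and w: "in_Ap p w" "Ap_const p w \<le> ennreal A" and r: "0 < r" and T: "1 \<le> T"
  obtains W B where "\<And>j. 0 < W j" "B \<in> sets lebesgue"
    "emeasure lebesgue B \<le> ennreal ((real CARD('n) + 1) / T) * emeasure lebesgue (ccube c r)"
    "\<And>x j. x \<in> ccube c r \<Longrightarrow> x \<notin> B \<Longrightarrow> W j / T \<le> w j x powr (1 / p j)"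
    "\<And>x j. x \<in> ccube c r \<Longrightarrow> x \<notin> B \<Longrightarrow>
      w j x powr (1 / p j) \<le> T ^ CARD('n) * A powr (1 / total_exp p) * W j"
proof -
  let ?P = "total_exp p"
  let ?R = "ccube c r"
  have P: "0 < ?P" using total_exp_pos p by blast
  have wj: "weight (w j)" for j using w(1) by (simp add: in_Ap_def)
  have wm: "w j \<in> borel_measurable lebesgue" for j using weight_measurable[OF wj] .
  have wp: "0 < w j x" for j x using wj unfolding weight_def by blast
  have wn: "w j x \<noteq> 0" for j x using wp[of j x] by simp
  define v where "v x = (\<Prod>j\<in>UNIV. w j x powr (?P / p j))" for x
  define \<sigma> where "\<sigma> j x = w j x powr (1 - conj_exp (p j))" for j x
  define q where "q j = 1 / conj_exp (p j)" for j
  have q: "0 < q j" "q j \<le> 1" "q j = 1 - 1 / p j" for j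
    using conj_exp_props[OF p[of j]] p[of j] unfolding q_def by auto
  obtain S s where S: "0 < S" and s: "\<And>j. 0 < s j"
    and av: "avg ?R (\<lambda>x. ennreal (\<Prod>j\<in>UNIV. w j x powr (?P / p j))) = ennreal S"
    and as: "\<And>j. avg ?R (\<lambda>x. ennreal (w j x powr (1 - conj_exp (p j)))) = ennreal (s j)"
    and le: "S * (\<Prod>j\<in>UNIV. s j powr (?P / conj_exp (p j))) \<le> A"
    using Ap_averages[OF p w r, of c] by blast
  note av = av[folded v_def] and as = as[folded \<sigma>_def]
  define W where "W j = s j powr (- q j)" for j
  have W: "0 < W j" for j using s[of j] by (simp add: W_def)
  have vm: "v \<in> borel_measurable lebesgue" unfolding v_def[abs_def] using wm by measurable
  have \<sigma>m: "\<sigma> j \<in> borel_measurable lebesgue" for j unfolding \<sigma>_def[abs_def] using wm by measurable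
  have vp: "0 < v x" for x unfolding v_def using wn by (intro prod_pos) auto
  have \<sigma>p: "0 < \<sigma> j x" for j x unfolding \<sigma>_def using wn by auto
  have \<sigma>n: "\<sigma> j x \<noteq> 0" for j x using \<sigma>p[of j x] by simp
  have \<sigma>w: "w j x powr (1 / p j) = \<sigma> j x powr (- q j)" for j x
  proof -
    have "\<sigma> j x powr (- q j) = w j x powr (- ((1 - conj_exp (p j)) * (1 / conj_exp (p j))))"
      unfolding \<sigma>_def q_def by (simp add: powr_powr)
    also have "\<dots> = w j x powr (1 / p j)" unfolding conj_exp_props(3)[OF p] by simp
    finally show ?thesis by simp
  qed
  have vw: "v x powr (1 / ?P) = (\<Prod>j\<in>UNIV. w j x powr (1 / p j))" for x
  proof -
    have "v x powr (1 / ?P) = (\<Prod>j\<in>UNIV. (w j x powr (?P / p j)) powr (1 / ?P))"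
      unfolding v_def by (rule prod_powr_distrib)
    also have "\<dots> = (\<Prod>j\<in>UNIV. w j x powr (1 / p j))"
      using P by (intro prod.cong refl) (simp only: powr_powr, simp)
    finally show ?thesis .
  qed
  have good: "W j / T \<le> w j x powr (1 / p j) \<and> w j x powr (1 / p j) \<le> T ^ CARD('n) * A powr (1 / ?P) * W j"
    if v: "v x \<le> T * S" and \<sigma>: "\<And>l. \<sigma> l x \<le> T * s l" for x j
  proof
    have "W j / T = W j * T powr (- 1)" using T by (simp add: powr_minus divide_inverse)
    also have "\<dots> \<le> W j * T powr (- q j)" using T q(2)[of j] W[of j] by (intro mult_left_mono powr_mono) auto
    also have "\<dots> = (T * s j) powr (- q j)" unfolding W_def using T s[of j] by (simp add: powr_mult mult.commute)
    also have "\<dots> \<le> \<sigma> j x powr (- q j)" using \<sigma>[of j] \<sigma>p[of j x] q(1)[of j] by (intro powr_mono2') auto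
    finally show "W j / T \<le> w j x powr (1 / p j)" unfolding \<sigma>w .
    \<comment> \<open>The pointwise identity, solved for the power of \<open>w
      j\<close>.\<close>
    have e1: "w j x powr (1 / p j) = v x powr (1 / ?P) * (\<Prod>l\<in>UNIV - {j}. \<sigma> l x powr q l)"
    proof -
      have "(\<Prod>l\<in>UNIV - {j}. w l x powr (1 / p l)) * (\<Prod>l\<in>UNIV - {j}. \<sigma> l x powr q l) = (\<Prod>l\<in>UNIV - {j}. 1)"
        unfolding prod.distrib[symmetric] \<sigma>w using \<sigma>n by (intro prod.cong) (auto simp: powr_minus)
      then show ?thesis unfolding vw using prod.remove[of UNIV j "\<lambda>l. w l x powr (1 / p l)"] by (simp add: mult.assoc)
    qed
    also have "\<dots> \<le> (T * S) powr (1 / ?P) * (\<Prod>l\<in>UNIV - {j}. (T * s l) powr q l)"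
    proof (rule mult_mono)
      show "v x powr (1 / ?P) \<le> (T * S) powr (1 / ?P)" using v vp[of x] P by (intro powr_mono2) auto
      show "(\<Prod>l\<in>UNIV - {j}. \<sigma> l x powr q l) \<le> (\<Prod>l\<in>UNIV - {j}. (T * s l) powr q l)"
      proof (rule prod_mono)
        fix l
        have "\<sigma> l x powr q l \<le> (T * s l) powr q l"
          using \<sigma>[of l] \<sigma>p[of l x] q(1)[of l] by (intro powr_mono2) auto
        then show "0 \<le> \<sigma> l x powr q l \<and> \<sigma> l x powr q l \<le> (T * s l) powr q l" by simp
      qed
    qed (auto intro!: prod_nonneg)
    also have "\<dots> = (T powr (1 / ?P) * (\<Prod>l\<in>UNIV - {j}. T powr q l)) * (S powr (1 / ?P) * (\<Prod>l\<in>UNIV - {j}. s l powr q l))"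
      using T S s by (simp add: powr_mult prod.distrib less_imp_le)
    also have "\<dots> \<le> T ^ CARD('n) * (A powr (1 / ?P) * W j)"
    proof (rule mult_mono)
      have "T powr (1 / ?P) * (\<Prod>l\<in>UNIV - {j}. T powr q l) = T powr (1 / ?P + (\<Sum>l\<in>UNIV - {j}. q l))"
        using T by (simp add: powr_add powr_sum)
      also have "\<dots> \<le> T powr (real CARD('n))"
      proof (rule powr_mono)
        have "(\<Sum>l\<in>UNIV - {j}. q l) \<le> (\<Sum>l\<in>UNIV. q l)" using q(1) by (intro sum_mono2) (auto intro: less_imp_le)
        then show "1 / ?P + (\<Sum>l\<in>UNIV - {j}. q l) \<le> real CARD('n)"
          unfolding inverse_total_exp q(3) by (simp add: sum_subtractf)
      qed (use T in auto)
      also have "\<dots> = T ^ CARD('n)" using T by (simp add: powr_realpow)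
      finally show "T powr (1 / ?P) * (\<Prod>l\<in>UNIV - {j}. T powr q l) \<le> T ^ CARD('n)" .
      have pw: "(s l powr (?P / conj_exp (p l))) powr (1 / ?P) = s l powr q l" for l
        using P by (simp add: powr_powr q_def)
      have "S powr (1 / ?P) * (\<Prod>l\<in>UNIV. s l powr q l) = (S * (\<Prod>j\<in>UNIV. s j powr (?P / conj_exp (p j)))) powr (1 / ?P)"
      proof -
        have "(\<Prod>l\<in>UNIV. s l powr q l) = (\<Prod>j\<in>UNIV. s j powr (?P / conj_exp (p j))) powr (1 / ?P)"
          unfolding pw[symmetric] by (rule prod_powr_distrib[symmetric])
        then show ?thesis using S by (simp add: powr_mult prod_nonneg)
      qed
      also have "\<dots> \<le> A powr (1 / ?P)" using le S P by (intro powr_mono2) (auto intro!: mult_nonneg_nonneg prod_nonneg)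
      finally have "S powr (1 / ?P) * (s j powr q j * (\<Prod>l\<in>UNIV - {j}. s l powr q l)) \<le> A powr (1 / ?P)"
        by (simp add: prod.remove[of UNIV j])
      then have "(S powr (1 / ?P) * (\<Prod>l\<in>UNIV - {j}. s l powr q l)) * s j powr q j * W j \<le> A powr (1 / ?P) * W j"
        using W[of j] by (intro mult_right_mono) (auto simp: mult_ac)
      moreover have "s j powr q j * W j = 1" unfolding W_def using s[of j] by (simp add: powr_minus)
      ultimately show "S powr (1 / ?P) * (\<Prod>l\<in>UNIV - {j}. s l powr q l) \<le> A powr (1 / ?P) * W j"
        by (simp add: mult.assoc)
    qed (use T W[of j] in \<open>auto intro!: prod_nonneg mult_nonneg_nonneg\<close>)
    finally show "w j x powr (1 / p j) \<le> T ^ CARD('n) * A powr (1 / ?P) * W j" by (simp add: mult.assoc)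
  qed
  let ?V = "{x \<in> ?R. T * S < v x}" and ?S = "\<lambda>l. {x \<in> ?R. T * s l < \<sigma> l x}"
  let ?B = "?V \<union> (\<Union>l\<in>UNIV. ?S l)"
  have outside: "v x \<le> T * S" "\<sigma> l x \<le> T * s l" if "x \<in> ?R" "x \<notin> ?B" for x l
    using that by (auto simp: not_less)
  have Vs: "?V \<in> sets lebesgue"
  proof -
    have "{x \<in> space lebesgue. x \<in> ?R \<and> T * S < v x} \<in> sets lebesgue" using vm by measurable
    then show ?thesis by simp
  qed
  have Ss: "?S l \<in> sets lebesgue" for l
  proof -
    have "{x \<in> space lebesgue. x \<in> ?R \<and> T * s l < \<sigma> l x} \<in> sets lebesgue" using \<sigma>m[of l] by measurable
    then show ?thesis by simp
  qed
  have Bs: "?B \<in> sets lebesgue" using Vs Ss by (intro sets.Un sets.finite_UN) auto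
  have "emeasure lebesgue ?B \<le> emeasure lebesgue ?V + emeasure lebesgue (\<Union>l\<in>UNIV. ?S l)"
    using Vs Ss by (intro emeasure_subadditive) auto
  also have "\<dots> \<le> emeasure lebesgue ?V + (\<Sum>l\<in>UNIV. emeasure lebesgue (?S l))"
    using Ss by (intro add_left_mono emeasure_subadditive_finite) auto
  also have "\<dots> \<le> ennreal (1 / T) * emeasure lebesgue ?R + (\<Sum>l\<in>(UNIV::'n set). ennreal (1 / T) * emeasure lebesgue ?R)"
  proof (intro add_mono sum_mono)
    have T0: "0 < T" using T by simp
    show "emeasure lebesgue ?V \<le> ennreal (1 / T) * emeasure lebesgue ?R"
      by (rule Chebyshev_cube[OF vm less_imp_le[OF vp] r T0 S av])
    show "emeasure lebesgue (?S l) \<le> ennreal (1 / T) * emeasure lebesgue ?R" for l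
      by (rule Chebyshev_cube[OF \<sigma>m less_imp_le[OF \<sigma>p] r T0 s as])
  qed
  also have "\<dots> = ennreal ((real CARD('n) + 1) / T) * emeasure lebesgue ?R"
  proof -
    have "ennreal ((real CARD('n) + 1) / T) = ennreal (1 / T) + of_nat CARD('n) * ennreal (1 / T)"
      using T by (simp add: add_divide_distrib ennreal_plus ennreal_of_nat_eq_real_of_nat ennreal_mult[symmetric])
    then show ?thesis by (simp add: distrib_right mult.assoc)
  qed
  finally have le: "emeasure lebesgue ?B \<le> ennreal ((real CARD('n) + 1) / T) * emeasure lebesgue ?R" .
  show ?thesis
    by (rule that[OF W Bs le]) (use good[OF outside] in blast)+
qed

section \<open>Testing the commutator\<close>

lemma locally_Lp_cube:
  fixes b :: "'a::euclidean_space \<Rightarrow> complex"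
  assumes "locally_Lp k b" "E \<in> sets lebesgue" "E \<subseteq> ccube c r"
  shows "integrable lebesgue (\<lambda>x. indicat_real E x *\<^sub>R (norm (b x) ^ k))"
proof -
  have "set_integrable lebesgue (ccube c r) (\<lambda>x. norm (b x) ^ k)"
    using assms(1) unfolding locally_Lp_def ccube_def by simp
  then have "set_integrable lebesgue E (\<lambda>x. norm (b x) ^ k)" by (rule set_integrable_subset[OF _ assms(2,3)])
  then show ?thesis by (simp add: set_integrable_def)
qed

lemma lmeasurable_subset_ccube:
  assumes "E \<in> sets lebesgue" "E \<subseteq> ccube c r" shows "E \<in> lmeasurable"
proof -
  have "ccube c r \<in> lmeasurable" unfolding ccube_def by simp
  then show ?thesis using assms fmeasurable_Int_fmeasurable[of "ccube c r" lebesgue E] by (simp add: Int_absorb1)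
qed

lemma pigeonhole_cover:
  assumes "\<And>l. l \<le> L \<Longrightarrow> G l \<in> sets M" "F \<subseteq> (\<Union>l\<le>L. G l)"
  obtains l where "l \<le> L" "emeasure M F \<le> of_nat (Suc L) * emeasure M (G l)"
proof -
  define m where "m = Max ((\<lambda>l. emeasure M (G l)) ` {..L})"
  have "m \<in> (\<lambda>l. emeasure M (G l)) ` {..L}" unfolding m_def by (intro Max_in) auto
  then obtain l where l: "l \<le> L" "m = emeasure M (G l)" by auto
  have "emeasure M F \<le> emeasure M (\<Union>l\<in>{..L}. G l)"
    by (rule emeasure_mono[OF assms(2)]) (use assms(1) in auto)
  also have "\<dots> \<le> (\<Sum>l\<in>{..L}. emeasure M (G l))"
    using assms(1) by (intro emeasure_subadditive_finite) auto
  also have "\<dots> \<le> (\<Sum>l\<in>{..L}. m)" unfolding m_def by (intro sum_mono Max_ge) auto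
  also have "\<dots> = of_nat (Suc L) * m" by simp
  finally show ?thesis using that l by simp
qed

lemma indicator_L1_c:
  assumes "E \<in> lmeasurable" "bounded E" "g \<in> borel_measurable lebesgue" "integrable lebesgue h"
    and "\<And>x. norm (g x) \<le> h x" "\<And>x. x \<notin> E \<Longrightarrow> g x = 0"
  shows "g \<in> L1_c"
proof -
  have "integrable lebesgue g"
    by (rule Bochner_Integration.integrable_bound[OF assms(4,3)]) (use assms(5) in \<open>auto intro!: AE_I2 intro: order_trans[OF _ abs_ge_self]\<close>)
  moreover have "{x. g x \<noteq> 0} \<subseteq> E" using assms(6) by blast
  then have "bounded {x. g x \<noteq> 0}" by (rule bounded_subset[OF assms(2)])
  ultimately show ?thesis by (simp add: L1_c_def)
qed

text \<open>
  The test tuple consists of indicators of \<open>E\<close>, with one of the norming multipliers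
  in the \<open>i\<close>-th entry. Which multiplier is right depends on the value \<open>b
  x\<close>; by the pigeonhole principle one of them is right for a fixed proportion
  \<open>G\<close> of \<open>F\<close>.
\<close>

lemma commutator_test_function:
  fixes T :: "('n::finite, 'a::euclidean_space) operator" and K :: "'a \<Rightarrow> ('n \<Rightarrow> 'a) \<Rightarrow> complex"
  assumes K: "kernel_regular C \<omega> K" "modulus \<omega>" "0 \<le> C" and rep: "kernel_represents K T" and ext: "off_support_extension T"
    and k: "1 \<le> k" and b: "locally_Lp k b"
    and E: "E \<in> sets lebesgue" "E \<subseteq> ccube y0 r" and F: "F \<in> sets lebesgue" "F \<inter> ccube y0 r = {}"
    and const: "\<And>x y. x \<in> F \<Longrightarrow> (\<forall>j. y j \<in> ccube y0 r) \<Longrightarrow> norm (K x y - \<kappa>) \<le> norm \<kappa> / 4"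
    and D: "0 < D" "\<And>z. D \<le> (\<integral>y. norm (z - b y) ^ k \<partial>(lebesgue_on E))"
    and a: "(\<integral>y. norm (a - b y) ^ k \<partial>(lebesgue_on E)) \<le> 2 * D"
  shows "\<exists>f G. f \<in> commutator_domain i k b \<and> (\<forall>j y. norm (f j y) \<le> indicator E y) \<and> G \<in> sets lebesgue \<and> G \<subseteq> F \<and>
    emeasure lebesgue F \<le> of_nat (Suc (norming_number k)) * emeasure lebesgue G \<and>
    (AE x in lebesgue. x \<in> G \<longrightarrow> norm \<kappa> / 4 * measure lebesgue E ^ (CARD('n) - 1) * D \<le> norm (iterated_commutator i k b T f x))"
proof -
  let ?M = "lebesgue_on E"
  let ?L = "norming_number k"
  have bm: "b \<in> borel_measurable lebesgue" using b by (simp add: locally_Lp_def)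
  have El: "E \<in> lmeasurable" by (rule lmeasurable_subset_ccube[OF E])
  have Eb: "bounded E" using E(2) bounded_subset bounded_cbox unfolding ccube_def by blast
  have fin: "finite_measure ?M" by (rule finite_measure_lebesgue_on[OF El])
  have int_on: "(\<integral>y. h y \<partial>?M) = (\<integral>y. indicat_real E y *\<^sub>R h y \<partial>lebesgue)" for h :: "'a \<Rightarrow> 'c::{banach, second_countable_topology}"
    using E(1) by (subst integral_restrict_space) auto
  have bM: "b \<in> borel_measurable ?M" using bm by (rule measurable_restrict_space1)
  have bi: "integrable ?M (\<lambda>y. norm (b y) ^ k)"
    using locally_Lp_cube[OF b E] E(1) by (subst integrable_restrict_space) auto
  obtain \<psi> Z where \<psi>: "\<And>l. \<psi> l \<in> borel_measurable ?M" "\<And>l y. norm (\<psi> l y) \<le> 1"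
    and Z: "\<And>l. closed (Z l)" "(\<Union>l\<le>?L. Z l) = UNIV"
    and norming: "\<And>l z. l \<le> ?L \<Longrightarrow> z \<in> Z l \<Longrightarrow>
      (\<integral>y. norm (z - b y) ^ k \<partial>?M) \<le> 2 * norm (\<integral>y. \<psi> l y * (z - b y) ^ k \<partial>?M)"
    using norming_family[OF fin bM bi k D(1) D(2) a] by blast
  define G where "G l = F \<inter> {x. b x \<in> Z l}" for l
  have Gs: "G l \<in> sets lebesgue" for l
  proof -
    have "b -` Z l \<inter> space lebesgue \<in> sets lebesgue" by (rule measurable_sets[OF bm]) (use Z in auto)
    then show ?thesis unfolding G_def using F(1) by (intro sets.Int) (auto simp: vimage_def)
  qed
  have "F \<subseteq> (\<Union>l\<le>?L. G l)"
  proof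
    fix x assume "x \<in> F"
    moreover obtain l where "l \<le> ?L" "b x \<in> Z l" using Z(2) by (metis UNIV_I UN_E atMost_iff)
    ultimately show "x \<in> (\<Union>l\<le>?L. G l)" by (auto simp: G_def)
  qed
  then obtain l where l: "l \<le> ?L" "emeasure lebesgue F \<le> of_nat (Suc ?L) * emeasure lebesgue (G l)"
    using pigeonhole_cover[of ?L G lebesgue F] Gs by blast
  define g where "g y = indicat_real E y *\<^sub>R \<psi> l y" for y
  define f where "f j = (if j = i then g else (\<lambda>y. of_real (indicat_real E y)))" for j
  have gm: "g \<in> borel_measurable lebesgue"
    using \<psi>(1)[of l] E(1) unfolding g_def[abs_def] by (subst (asm) borel_measurable_restrict_space_iff) auto
  have f_le: "norm (f j y) \<le> indicat_real E y" for j y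
    using \<psi>(2)[of l y] by (auto simp: f_def g_def indicator_def)
  have fm: "f j \<in> borel_measurable lebesgue" for j
    unfolding f_def using gm E(1) by auto
  have f0: "f j y = 0" if "y \<notin> E" for j y using f_le[of j y] that by simp
  have Ei: "integrable lebesgue (indicat_real E)" using El lmeasurable_iff_integrable by blast
  have dom: "f \<in> commutator_domain i k b"
    unfolding commutator_domain_def
  proof (intro CollectI conjI allI impI)
    show "f j \<in> L1_c" for j by (rule indicator_L1_c[OF El Eb fm Ei f_le f0])
    fix m assume m: "m \<le> k"
    show "(\<lambda>x. b x ^ m * f i x) \<in> L1_c"
    proof (rule indicator_L1_c[OF El Eb, where h = "\<lambda>x. indicat_real E x + indicat_real E x *\<^sub>R (norm (b x) ^ k)"])
      show "(\<lambda>x. b x ^ m * f i x) \<in> borel_measurable lebesgue" using bm fm[of i] by auto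
      show "integrable lebesgue (\<lambda>x. indicat_real E x + indicat_real E x *\<^sub>R (norm (b x) ^ k))"
        using Ei locally_Lp_cube[OF b E] by auto
      show "norm (b x ^ m * f i x) \<le> indicat_real E x + indicat_real E x *\<^sub>R (norm (b x) ^ k)" for x
      proof (cases "x \<in> E")
        case True
        have "norm (b x) ^ m \<le> 1 + norm (b x) ^ k"
        proof (cases "norm (b x) \<le> 1")
          case True
          then have "norm (b x) ^ m \<le> 1" by (simp add: power_le_one)
          then show ?thesis by (simp add: add_increasing2)
        next
          case False
          then have "norm (b x) ^ m \<le> norm (b x) ^ k" using m by (intro power_increasing) auto
          then show ?thesis by simp
        qed
        moreover have "norm (b x ^ m * f i x) \<le> norm (b x) ^ m * 1"
          unfolding norm_mult norm_power using f_le[of i x] True by (intro mult_left_mono) auto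
        ultimately show ?thesis using True by simp
      qed (simp add: f0)
    qed (simp add: f0)
  qed
  define m where "m = measure lebesgue E"
  have mE: "(\<integral>y. indicat_real E y \<partial>lebesgue) = m" using E(1) by (simp add: m_def)
  have "AE x in lebesgue. x \<in> F \<longrightarrow>
    norm (iterated_commutator i k b T f x - \<kappa> * ((\<Prod>j\<in>UNIV - {i}. \<integral>y. f j y \<partial>lebesgue) * (\<integral>y. (b x - b y) ^ k * f i y \<partial>lebesgue)))
     \<le> norm \<kappa> / 4 * ((\<Prod>j\<in>UNIV - {i}. \<integral>y. norm (f j y) \<partial>lebesgue) * (\<integral>y. norm ((b x - b y) ^ k * f i y) \<partial>lebesgue))"
  proof (rule commutator_off_support_estimate[OF K rep ext dom])
    show "f j y = 0" if "y \<notin> cbox (y0 - r *\<^sub>R (\<Sum>e\<in>Basis. e)) (y0 + r *\<^sub>R (\<Sum>e\<in>Basis. e))" for j y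
      using f0[of y j] E(2) that unfolding ccube_def by blast
    show "x \<notin> cbox (y0 - r *\<^sub>R (\<Sum>e\<in>Basis. e)) (y0 + r *\<^sub>R (\<Sum>e\<in>Basis. e))" if "x \<in> F" for x
      using F(2) that unfolding ccube_def by blast
    show "norm (K x y - \<kappa>) \<le> norm \<kappa> / 4"
      if "x \<in> F" "\<forall>j. y j \<in> cbox (y0 - r *\<^sub>R (\<Sum>e\<in>Basis. e)) (y0 + r *\<^sub>R (\<Sum>e\<in>Basis. e))" for x y
      using const that unfolding ccube_def by blast
  qed
  then have "AE x in lebesgue. x \<in> G l \<longrightarrow> norm \<kappa> / 4 * m ^ (CARD('n) - 1) * D \<le> norm (iterated_commutator i k b T f x)"
  proof eventually_elim
    case (elim x)
    show ?case
    proof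
      assume x: "x \<in> G l"
      then have xF: "x \<in> F" and xZ: "b x \<in> Z l" by (auto simp: G_def)
      define I where "I = (\<integral>y. norm (b x - b y) ^ k \<partial>?M)"
      define J where "J = (\<integral>y. \<psi> l y * (b x - b y) ^ k \<partial>?M)"
      have IJ: "I \<le> 2 * norm J" unfolding I_def J_def by (rule norming[OF l(1) xZ])
      have DI: "D \<le> I" unfolding I_def by (rule D(2))
      have card: "card (UNIV - {i}) = CARD('n) - 1" by (simp add: card_Diff_singleton)
      have P1: "(\<Prod>j\<in>UNIV - {i}. \<integral>y. f j y \<partial>lebesgue) = of_real (m ^ (CARD('n) - 1))"
      proof -
        have "(\<integral>y. f j y \<partial>lebesgue) = of_real m" if "j \<noteq> i" for j
          using that mE by (simp add: f_def integral_complex_of_real)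
        then show ?thesis using card by simp
      qed
      have P2: "(\<Prod>j\<in>UNIV - {i}. \<integral>y. norm (f j y) \<partial>lebesgue) = m ^ (CARD('n) - 1)"
      proof -
        have "(\<integral>y. norm (f j y) \<partial>lebesgue) = m" if "j \<noteq> i" for j
          using that mE by (simp add: f_def)
        then show ?thesis using card by simp
      qed
      have J: "(\<integral>y. (b x - b y) ^ k * f i y \<partial>lebesgue) = J"
        unfolding J_def int_on by (intro Bochner_Integration.integral_cong) (auto simp: f_def g_def indicator_def)
      have I: "(\<integral>y. norm ((b x - b y) ^ k * f i y) \<partial>lebesgue) \<le> I"
        unfolding I_def int_on
      proof (rule integral_mono_AE)
        have ii: "integrable ?M (\<lambda>y. norm (b x - b y) ^ k)" by (rule integrable_norm_shifted_power[OF fin bM bi])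
        then show i1: "integrable lebesgue (\<lambda>y. indicat_real E y *\<^sub>R norm (b x - b y) ^ k)"
          using E(1) by (subst (asm) integrable_restrict_space) auto
        have le: "norm ((b x - b y) ^ k * f i y) \<le> indicat_real E y *\<^sub>R norm (b x - b y) ^ k" for y
          using mult_left_mono[OF f_le[of i y], of "norm (b x - b y) ^ k"] by (simp add: norm_mult norm_power mult.commute)
        show "AE y in lebesgue. norm ((b x - b y) ^ k * f i y) \<le> indicat_real E y *\<^sub>R norm (b x - b y) ^ k"
          using le by simp
        show "integrable lebesgue (\<lambda>y. norm ((b x - b y) ^ k * f i y))"
          by (rule Bochner_Integration.integrable_bound[OF i1]) (use bm fm[of i] le in \<open>auto intro!: AE_I2 intro: order_trans[OF _ abs_ge_self]\<close>)
      qed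
      define X where "X = norm \<kappa> * m ^ (CARD('n) - 1)"
      have X0: "0 \<le> X" by (simp add: X_def m_def)
      have m0: "0 \<le> m" by (simp add: m_def)
      have "norm (iterated_commutator i k b T f x - \<kappa> * (of_real (m ^ (CARD('n) - 1)) * J)) \<le> norm \<kappa> / 4 * (m ^ (CARD('n) - 1) * (\<integral>y. norm ((b x - b y) ^ k * f i y) \<partial>lebesgue))"
        using elim xF unfolding P1 P2 J by blast
      also have "\<dots> \<le> norm \<kappa> / 4 * (m ^ (CARD('n) - 1) * I)"
        using I m0 by (intro mult_left_mono) auto
      also have "\<dots> = X * I / 4" by (simp add: X_def)
      finally have 1: "norm (iterated_commutator i k b T f x - \<kappa> * (of_real (m ^ (CARD('n) - 1)) * J)) \<le> X * I / 4" .
      have 2: "norm (\<kappa> * (of_real (m ^ (CARD('n) - 1)) * J)) = X * norm J"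
        using m0 by (simp add: X_def norm_mult norm_power)
      have "X * I \<le> X * (2 * norm J)" using IJ X0 by (rule mult_left_mono)
      moreover have "X * D \<le> X * I" using DI X0 by (rule mult_left_mono)
      ultimately have "X * D / 4 \<le> norm (iterated_commutator i k b T f x)"
        using 1 2 norm_triangle_ineq2[of "\<kappa> * (of_real (m ^ (CARD('n) - 1)) * J)" "iterated_commutator i k b T f x"]
        by (simp add: norm_minus_commute)
      then show "norm \<kappa> / 4 * m ^ (CARD('n) - 1) * D \<le> norm (iterated_commutator i k b T f x)"
        by (simp add: X_def)
    qed
  qed
  moreover have "G l \<subseteq> F" by (auto simp: G_def)
  ultimately show ?thesis using dom f_le Gs l(2) unfolding m_def by blast
qed

lemma epowr_mono: "x \<le> y \<Longrightarrow> 0 < a \<Longrightarrow> epowr x a \<le> epowr y a"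
  by (cases x; cases y) (auto simp: epowr_def top_unique intro!: ennreal_leI powr_mono2)

lemma epowr_ennreal: "0 \<le> x \<Longrightarrow> epowr (ennreal x) a = ennreal (x powr a)"
  by (simp add: epowr_def)

lemma Lp_norm_lower:
  assumes G: "G \<in> lmeasurable" and q: "0 < q" and s: "0 \<le> s" "0 \<le> u"
    and f: "AE x in lebesgue. x \<in> G \<longrightarrow> s \<le> norm (f x)" and v: "\<And>x. x \<in> G \<Longrightarrow> u powr q \<le> v x"
  shows "ennreal (s * u * measure lebesgue G powr (1 / q)) \<le> Lp_norm q v f"
proof -
  let ?m = "measure lebesgue G"
  have "ennreal (s powr q * u powr q * ?m) = (\<integral>\<^sup>+x. ennreal (s powr q * u powr q) * indicator G x \<partial>lebesgue)"
    using G by (subst nn_integral_cmult_indicator) (auto simp: fmeasurableD emeasure_eq_measure2 ennreal_mult)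
  also have "\<dots> \<le> (\<integral>\<^sup>+x. ennreal (norm (f x) powr q * v x) \<partial>lebesgue)"
  proof (rule nn_integral_mono_AE)
    show "AE x in lebesgue. ennreal (s powr q * u powr q) * indicator G x \<le> ennreal (norm (f x) powr q * v x)"
      using f
    proof eventually_elim
      case (elim x)
      have "s powr q * u powr q \<le> norm (f x) powr q * v x" if "x \<in> G"
        using elim that s q v[OF that] by (intro mult_mono powr_mono2) auto
      then show ?case by (auto simp: indicator_def intro!: ennreal_leI)
    qed
  qed
  finally have "epowr (ennreal (s powr q * u powr q * ?m)) (1 / q) \<le> Lp_norm q v f"
    unfolding Lp_norm_def by (rule epowr_mono) (use q in simp)
  moreover have "(s powr q * u powr q * ?m) powr (1 / q) = s * u * ?m powr (1 / q)"
    using q s by (simp add: powr_mult powr_powr)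
  ultimately show ?thesis using s by (simp add: epowr_ennreal)
qed

lemma Lp_norm_upper:
  assumes E: "E \<in> lmeasurable" and q: "0 < q" and f: "\<And>x. norm (f x) \<le> indicator E x"
    and w: "\<And>x. x \<in> E \<Longrightarrow> w x powr (1 / q) \<le> h" "\<And>x. 0 \<le> w x" and h: "0 \<le> h"
  shows "Lp_norm q w f \<le> ennreal (h * measure lebesgue E powr (1 / q))"
proof -
  let ?m = "measure lebesgue E"
  have "(\<integral>\<^sup>+x. ennreal (norm (f x) powr q * w x) \<partial>lebesgue) \<le> (\<integral>\<^sup>+x. ennreal (h powr q) * indicator E x \<partial>lebesgue)"
  proof (rule nn_integral_mono)
    fix x
    have "norm (f x) powr q * w x \<le> h powr q * indicator E x"
    proof (cases "x \<in> E")
      case True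
      have "w x = (w x powr (1 / q)) powr q" using q w(2)[of x] by (simp add: powr_powr)
      also have "\<dots> \<le> h powr q" using w(1)[OF True] q by (intro powr_mono2) auto
      finally have "w x \<le> h powr q" .
      moreover have "norm (f x) powr q \<le> 1 powr q" using f[of x] True q by (intro powr_mono2) auto
      ultimately have "norm (f x) powr q * w x \<le> 1 * h powr q" using w(2)[of x] by (intro mult_mono) auto
      then show ?thesis using True by simp
    next
      case False
      then have "f x = 0" using f[of x] by simp
      then show ?thesis using q by simp
    qed
    then show "ennreal (norm (f x) powr q * w x) \<le> ennreal (h powr q) * indicator E x"
      by (cases "x \<in> E") (auto simp: ennreal_neg intro!: ennreal_leI)
  qed
  also have "\<dots> = ennreal (h powr q * ?m)"
    using E by (subst nn_integral_cmult_indicator) (auto simp: fmeasurableD emeasure_eq_measure2 ennreal_mult)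
  finally have "Lp_norm q w f \<le> epowr (ennreal (h powr q * ?m)) (1 / q)"
    unfolding Lp_norm_def by (rule epowr_mono) (use q in simp)
  moreover have "(h powr q * ?m) powr (1 / q) = h * ?m powr (1 / q)"
    using q h by (simp add: powr_mult powr_powr)
  ultimately show ?thesis by (simp add: epowr_ennreal)
qed

text \<open>
  The strict bound \<open>N\<close> avoids the question whether the infimum in the operator norm
  is attained, and makes infinite operator norms a trivial case.
\<close>

lemma operator_norm_bound:
  assumes "operator_norm \<D> p w q v S < ennreal N" "f \<in> \<D>" "\<And>j. Lp_norm (p j) (w j) (f j) < \<infinity>"
  shows "Lp_norm q v (S f) \<le> ennreal N * (\<Prod>j\<in>UNIV. Lp_norm (p j) (w j) (f j))"
proof -
  obtain C where C: "C < ennreal N" "\<forall>f\<in>\<D>. (\<forall>j. Lp_norm (p j) (w j) (f j) < \<infinity>) \<longrightarrow>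
      Lp_norm q v (S f) \<le> C * (\<Prod>j\<in>UNIV. Lp_norm (p j) (w j) (f j))"
    using assms(1) unfolding operator_norm_def Inf_less_iff by auto
  have "Lp_norm q v (S f) \<le> C * (\<Prod>j\<in>UNIV. Lp_norm (p j) (w j) (f j))" using C(2) assms(2,3) by blast
  also have "\<dots> \<le> ennreal N * (\<Prod>j\<in>UNIV. Lp_norm (p j) (w j) (f j))"
    using C(1) by (intro mult_right_mono) (auto intro: less_imp_le)
  finally show ?thesis .
qed

text \<open>
  On \<open>E\<close> and \<open>G\<close> the weights are constants up to factors. The
  constants \<open>W j\<close> with \<open>j \<noteq> i\<close> occur on both sides of the norm
  inequality and cancel, and so do the powers of the measure because \<open>1/p\<close> is the
  sum of the \<open>1/p\<^sub>j\<close>. What remains is the quotient \<open>W i / U\<close>,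
  which is the size of \<open>\<nu>\<^sup>k\<close>.
\<close>

lemma test_function_bound:
  fixes p :: "'n::finite \<Rightarrow> real" and w :: "'n \<Rightarrow> 'a::euclidean_space \<Rightarrow> real" and \<mu> :: "'a \<Rightarrow> real"
  assumes p: "\<And>j. 1 < p j" and wp: "\<And>j x. 0 < w j x" "\<And>x. 0 < \<mu> x"
    and N: "operator_norm \<D> p w (total_exp p)
       (\<lambda>x. \<mu> x powr (total_exp p / p i) * (\<Prod>j\<in>UNIV - {i}. w j x powr (total_exp p / p j))) S < ennreal N" "0 < N"
    and E: "E \<in> lmeasurable" and G: "G \<in> lmeasurable" "0 < measure lebesgue G"
    and f: "f \<in> \<D>" "\<And>j y. norm (f j y) \<le> indicator E y"
    and s: "0 \<le> s" "AE x in lebesgue. x \<in> G \<longrightarrow> s \<le> norm (S f x)"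
    and W: "\<And>j. 0 < W j" "0 < U" "0 < H" "0 < \<tau>"
    and wE: "\<And>j x. x \<in> E \<Longrightarrow> w j x powr (1 / p j) \<le> H * W j"
    and wG: "\<And>j x. x \<in> G \<Longrightarrow> W j / \<tau> \<le> w j x powr (1 / p j)" and \<mu>G: "\<And>x. x \<in> G \<Longrightarrow> U / \<tau> \<le> \<mu> x powr (1 / p i)"
  shows "s * U \<le> N * (\<tau> * H) ^ CARD('n) * W i * (measure lebesgue E / measure lebesgue G) powr (1 / total_exp p)"
proof -
  let ?P = "total_exp p"
  let ?v = "\<lambda>x. \<mu> x powr (?P / p i) * (\<Prod>j\<in>UNIV - {i}. w j x powr (?P / p j))"
  define mE where "mE = measure lebesgue E"
  define mG where "mG = measure lebesgue G"
  have m: "0 \<le> mE" "0 < mG" using G(2) by (simp_all add: mE_def mG_def)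
  have P: "0 < ?P" using total_exp_pos p by blast
  have p0: "0 < p j" for j using p[of j] by simp
  have P0: "?P \<noteq> 0" using P by simp
  have pn: "p j \<noteq> 0" for j using p0[of j] by simp
  define W' where "W' = (\<Prod>j\<in>UNIV - {i}. W j)"
  have W': "0 < W'" unfolding W'_def using W(1) by (simp add: prod_pos)
  define n where "n = CARD('n)"
  have card: "card (UNIV - {i}) = n - 1" "1 \<le> n" by (simp_all add: n_def card_Diff_singleton Suc_le_eq)
  define u where "u = U * W' / \<tau> ^ n"
  have u: "0 \<le> u" unfolding u_def using W W' by simp
  have low: "ennreal (s * u * mG powr (1 / ?P)) \<le> Lp_norm ?P ?v (S f)"
    unfolding mG_def
  proof (rule Lp_norm_lower[OF G(1) P s(1) u s(2)])
    fix x assume x: "x \<in> G"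
    have "U / \<tau> * (\<Prod>j\<in>UNIV - {i}. W j / \<tau>) = u"
    proof -
      have "\<tau> * \<tau> ^ (n - 1) = \<tau> ^ n" using card(2) by (cases n) auto
      then show ?thesis using card(1) by (simp add: u_def W'_def prod_dividef)
    qed
    moreover have "U / \<tau> * (\<Prod>j\<in>UNIV - {i}. W j / \<tau>) \<le> \<mu> x powr (1 / p i) * (\<Prod>j\<in>UNIV - {i}. w j x powr (1 / p j))"
      using \<mu>G[OF x] wG[OF x] W less_imp_le[OF W(1)] by (intro mult_mono prod_mono prod_nonneg) auto
    ultimately have "u powr ?P \<le> (\<mu> x powr (1 / p i) * (\<Prod>j\<in>UNIV - {i}. w j x powr (1 / p j))) powr ?P"
      using u P by (intro powr_mono2) auto
    also have "\<dots> = (\<mu> x powr (1 / p i)) powr ?P * (\<Prod>j\<in>UNIV - {i}. (w j x powr (1 / p j)) powr ?P)"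
      by (simp add: powr_mult prod_nonneg prod_powr_distrib)
    also have "\<dots> = ?v x" by (simp add: powr_powr)
    finally show "u powr ?P \<le> ?v x" .
  qed
  have upj: "Lp_norm (p j) (w j) (f j) \<le> ennreal (H * W j * mE powr (1 / p j))" for j
    unfolding mE_def
    by (rule Lp_norm_upper[OF E p0 f(2) wE]) (use wp(1) W in \<open>auto intro: less_imp_le\<close>)
  have "Lp_norm (p j) (w j) (f j) < \<infinity>" for j using upj[of j] by (rule order_le_less_trans) simp
  from operator_norm_bound[OF N(1) f(1) this]
  have "Lp_norm ?P ?v (S f) \<le> ennreal N * (\<Prod>j\<in>UNIV. Lp_norm (p j) (w j) (f j))" .
  also have "\<dots> \<le> ennreal N * (\<Prod>j\<in>UNIV. ennreal (H * W j * mE powr (1 / p j)))"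
    using upj by (intro mult_left_mono prod_mono_ennreal) auto
  also have "\<dots> = ennreal N * ennreal (\<Prod>j\<in>UNIV. H * W j * mE powr (1 / p j))"
    using W less_imp_le[OF W(1)] by (subst prod_ennreal) auto
  also have "\<dots> = ennreal (N * (\<Prod>j\<in>UNIV. H * W j * mE powr (1 / p j)))"
    using N(2) by (intro ennreal_mult'[symmetric]) simp
  also have "(\<Prod>j\<in>UNIV. H * W j * mE powr (1 / p j)) = H ^ n * (W i * W') * mE powr (1 / ?P)"
  proof -
    have "(\<Prod>j\<in>UNIV. mE powr (1 / p j)) = mE powr (\<Sum>j\<in>UNIV. 1 / p j)"
    proof (cases "mE = 0")
      case True then show ?thesis by simp
    next
      case False then show ?thesis by (simp add: powr_sum)
    qed
    moreover have "(\<Prod>j\<in>UNIV. W j) = W i * W'" unfolding W'_def by (rule prod.remove) auto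
    ultimately show ?thesis by (simp add: prod.distrib n_def inverse_total_exp)
  qed
  finally have "ennreal (s * u * mG powr (1 / ?P)) \<le> ennreal (N * (H ^ n * (W i * W') * mE powr (1 / ?P)))"
    using low by (rule order_trans[rotated])
  then have "s * u * mG powr (1 / ?P) \<le> N * (H ^ n * (W i * W') * mE powr (1 / ?P))"
    using N(2) W W' less_imp_le[OF W(1)] by (subst (asm) ennreal_le_iff) auto
  then have "(s * U) * (W' * mG powr (1 / ?P) / \<tau> ^ n) \<le> (N * (\<tau> * H) ^ n * W i * (mE powr (1 / ?P) / mG powr (1 / ?P))) * (W' * mG powr (1 / ?P) / \<tau> ^ n)"
    using W(4) m by (simp add: u_def power_mult_distrib mult_ac)
  moreover have "0 < W' * mG powr (1 / ?P) / \<tau> ^ n" using W' W(4) m by simp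
  ultimately have "s * U \<le> N * (\<tau> * H) ^ n * W i * (mE powr (1 / ?P) / mG powr (1 / ?P))"
    by (rule mult_right_le_imp_le)
  then show ?thesis using m unfolding mE_def mG_def n_def by (simp add: powr_divide)
qed

section \<open>The lower bound\<close>

lemma powr_inverse_power: "0 < x \<Longrightarrow> 1 \<le> k \<Longrightarrow> (x powr (1 / real k)) ^ k = x"
  by (simp add: powr_realpow[symmetric] powr_powr)

lemma Chebyshev_power:
  fixes b :: "'a::euclidean_space \<Rightarrow> complex"
  assumes E: "E \<in> sets lebesgue" and b: "b \<in> borel_measurable lebesgue"
    and i: "integrable (lebesgue_on E) (\<lambda>y. norm (\<alpha> - b y) ^ k)" and t: "0 < t"
    and I: "(\<integral>y. norm (\<alpha> - b y) ^ k \<partial>(lebesgue_on E)) \<le> t ^ k * e"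
  shows "emeasure lebesgue {x \<in> E. t < norm (b x - \<alpha>)} \<le> ennreal e"
proof -
  let ?A = "{x \<in> E. t < norm (b x - \<alpha>)}"
  have A: "?A \<in> sets lebesgue"
  proof -
    have "{x \<in> space lebesgue. x \<in> E \<and> t < norm (b x - \<alpha>)} \<in> sets lebesgue" using b E by measurable
    then show ?thesis by simp
  qed
  have "ennreal (t ^ k) * emeasure lebesgue ?A = (\<integral>\<^sup>+x. ennreal (t ^ k) * indicator ?A x \<partial>lebesgue)"
    using A by (subst nn_integral_cmult_indicator) auto
  also have "\<dots> \<le> (\<integral>\<^sup>+x\<in>E. ennreal (norm (\<alpha> - b x) ^ k) \<partial>lebesgue)"
  proof (rule nn_integral_mono)
    fix x show "ennreal (t ^ k) * indicator ?A x \<le> ennreal (norm (\<alpha> - b x) ^ k) * indicator E x"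
      using t by (auto simp: indicator_def norm_minus_commute intro!: ennreal_leI power_mono)
  qed
  also have "\<dots> = (\<integral>\<^sup>+x. ennreal (norm (\<alpha> - b x) ^ k) \<partial>(lebesgue_on E))"
    using E by (subst nn_integral_restrict_space) auto
  also have "\<dots> = ennreal (\<integral>y. norm (\<alpha> - b y) ^ k \<partial>(lebesgue_on E))"
    by (rule nn_integral_eq_integral[OF i]) simp
  also have "\<dots> \<le> ennreal (t ^ k * e)" by (rule ennreal_leI[OF I])
  also have "\<dots> = ennreal (t ^ k) * ennreal e" using t by (simp add: ennreal_mult')
  finally show ?thesis using t by (subst (asm) ennreal_mult_le_mult_iff) auto
qed

text \<open>
  The weights for both tuples are almost constant off the small set \<open>X\<close>. Let
  \<open>E\<close> and \<open>F\<close> be the rest of the cube and of its companion. Testing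
  the commutator bounds the least \<open>k\<close>-th moment \<open>D\<close> of
  \<open>b\<close> on \<open>E\<close> by \<open>N\<close> times \<open>W i / U\<close> times
  the volume. Chebyshev's inequality turns this into a bound off a small set, and
  \<open>\<nu>\<close> is at least a multiple of \<open>(W i / U)\<^bsup>1/k\<^esup>\<close> on
  \<open>E\<close>, so that the bound is a multiple of the average of \<open>\<nu>\<close> with
  a constant \<open>B\<close> that does not depend on the cube.
\<close>

lemma local_oscillation:
  fixes T :: "('n::finite, 'a::euclidean_space) operator" and K :: "'a \<Rightarrow> ('n \<Rightarrow> 'a) \<Rightarrow> complex"
    and p :: "'n \<Rightarrow> real" and w :: "'n \<Rightarrow> 'a \<Rightarrow> real" and \<mu> \<nu> :: "'a \<Rightarrow> real"
  assumes p: "\<And>j. 1 < p j" and k: "1 \<le> k"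
    and K: "kernel_regular C \<omega> K" "modulus \<omega>" "0 \<le> C" and rep: "kernel_represents K T" and ext: "off_support_extension T"
    and b: "locally_Lp k b"
    and w: "in_Ap p w" "Ap_const p w \<le> ennreal A" and w': "in_Ap p (w(i := \<mu>))" "Ap_const p (w(i := \<mu>)) \<le> ennreal A" and A: "0 < A"
    and \<nu>: "\<nu> = (\<lambda>x. w i x powr (1 / (real k * p i)) * \<mu> x powr (- 1 / (real k * p i)))"
    and l: "0 < l" and V_def: "V = (2 * l) ^ DIM('a)"
    and \<kappa>0: "0 < \<kappa>0" "\<kappa>0 / V ^ CARD('n) \<le> norm \<kappa>"
    and disj: "ccube x0 l \<inter> ccube y0 l = {}" and sub: "ccube x0 l \<subseteq> ccube y0 (\<rho> * l)" and \<rho>: "1 \<le> \<rho>"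
    and const: "\<forall>x\<in>ccube x0 l. \<forall>y. (\<forall>j. y j \<in> ccube y0 l) \<longrightarrow> norm (K x y - \<kappa>) \<le> norm \<kappa> / 4"
    and \<tau>: "1 \<le> \<tau>" "2 * (real CARD('n) + 1) * \<rho> ^ DIM('a) * 2 ^ (DIM('a) + 3) \<le> \<tau>"
    and N: "operator_norm (commutator_domain i k b) p w (total_exp p)
       (\<lambda>x. \<mu> x powr (total_exp p / p i) * (\<Prod>j\<in>UNIV - {i}. w j x powr (total_exp p / p j))) (iterated_commutator i k b T) < ennreal N" "0 < N"
    and H: "H = \<tau> ^ CARD('n) * A powr (1 / total_exp p)"
    and C1: "C1 = 4 * 2 ^ (CARD('n) - 1) * (\<tau> * H) ^ CARD('n) * (2 * real (Suc (norming_number k))) powr (1 / total_exp p) / \<kappa>0"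
    and B: "B = 2 * (2 ^ (DIM('a) + 4) * C1 * \<tau> * H * N) powr (1 / real k)"
    and aq: "ennreal aq * ennreal V = weight_mass \<nu> (ccube y0 l)" "0 \<le> aq"
  shows "\<exists>\<alpha>. emeasure lebesgue {x \<in> ccube y0 l. B * aq < norm (b x - \<alpha>)} \<le> ennreal (V / 2 ^ (DIM('a) + 2))"
proof -
  let ?Q = "ccube y0 l" and ?F = "ccube x0 l" and ?R = "ccube y0 (\<rho> * l)"
  let ?n = "CARD('n)" and ?d = "DIM('a)" and ?P = "total_exp p"
  have P: "0 < ?P" using total_exp_pos p by blast
  have V: "0 < V" using l by (simp add: V_def)
  have vQ: "emeasure lebesgue ?Q = ennreal V" and vF: "emeasure lebesgue ?F = ennreal V"
    using l emeasure_ccube[of l y0] emeasure_ccube[of l x0] by (simp_all add: V_def)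
  have rl: "0 < \<rho> * l" using \<rho> l by simp
  have vR: "emeasure lebesgue ?R = ennreal (\<rho> ^ ?d * V)"
    using rl emeasure_ccube[of "\<rho> * l" y0] by (simp add: V_def power_mult_distrib mult_ac)
  have subQ: "?Q \<subseteq> ?R" by (rule ccube_subset) (use \<rho> l in simp)
  have wj: "weight (w j)" for j using w(1) by (simp add: in_Ap_def)
  have w\<mu>: "weight \<mu>" using w'(1) unfolding in_Ap_def by (metis fun_upd_same)
  have wp: "0 < w j x" for j x using wj unfolding weight_def by blast
  have \<mu>p: "0 < \<mu> x" for x using w\<mu> unfolding weight_def by blast
  obtain W B1 where W: "\<And>j. 0 < W j" and B1: "B1 \<in> sets lebesgue"
    "emeasure lebesgue B1 \<le> ennreal ((real ?n + 1) / \<tau>) * emeasure lebesgue ?R"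
    and W1: "\<And>x j. x \<in> ?R \<Longrightarrow> x \<notin> B1 \<Longrightarrow> W j / \<tau> \<le> w j x powr (1 / p j)"
    and W2: "\<And>x j. x \<in> ?R \<Longrightarrow> x \<notin> B1 \<Longrightarrow> w j x powr (1 / p j) \<le> H * W j"
    using weights_almost_constant[where c = y0, OF p w rl \<tau>(1)] unfolding H by blast
  obtain W' B2 where W': "\<And>j. 0 < W' j" and B2: "B2 \<in> sets lebesgue"
    "emeasure lebesgue B2 \<le> ennreal ((real ?n + 1) / \<tau>) * emeasure lebesgue ?R"
    and W1': "\<And>x j. x \<in> ?R \<Longrightarrow> x \<notin> B2 \<Longrightarrow> W' j / \<tau> \<le> (w(i := \<mu>)) j x powr (1 / p j)"
    and W2': "\<And>x j. x \<in> ?R \<Longrightarrow> x \<notin> B2 \<Longrightarrow> (w(i := \<mu>)) j x powr (1 / p j) \<le> H * W' j"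
    using weights_almost_constant[where c = y0, OF p w' rl \<tau>(1)] unfolding H by blast
  define U where "U = W' i"
  have U: "0 < U" unfolding U_def by (rule W')
  have U1: "U / \<tau> \<le> \<mu> x powr (1 / p i)" and U2: "\<mu> x powr (1 / p i) \<le> H * U" if "x \<in> ?R" "x \<notin> B2" for x
    using W1'[OF that, of i] W2'[OF that, of i] by (simp_all add: U_def)
  have \<tau>0: "0 < \<tau>" using \<tau>(1) by simp
  have H0: "0 < H" unfolding H using \<tau>0 A by simp
  have C10: "0 < C1" unfolding C1 using \<tau>0 H0 \<kappa>0(1) by (intro divide_pos_pos mult_pos_pos) auto
  define X where "X = B1 \<union> B2"
  have X: "X \<in> sets lebesgue" using B1 B2 by (simp add: X_def)
  have Xm: "emeasure lebesgue X \<le> ennreal (V / 2 ^ (?d + 3))"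
  proof -
    have "emeasure lebesgue X \<le> emeasure lebesgue B1 + emeasure lebesgue B2"
      unfolding X_def using B1(1) B2(1) by (rule emeasure_subadditive)
    also have "\<dots> \<le> ennreal ((real ?n + 1) / \<tau>) * ennreal (\<rho> ^ ?d * V) + ennreal ((real ?n + 1) / \<tau>) * ennreal (\<rho> ^ ?d * V)"
      using B1(2) B2(2) unfolding vR by (rule add_mono)
    also have "\<dots> = ennreal (2 * ((real ?n + 1) / \<tau> * (\<rho> ^ ?d * V)))"
      using \<tau>0 \<rho> V by (simp add: ennreal_mult[symmetric] ennreal_plus[symmetric] del: ennreal_plus)
    also have "\<dots> \<le> ennreal (V / 2 ^ (?d + 3))"
    proof (rule ennreal_leI)
      have "V * (2 * (real ?n + 1) * \<rho> ^ ?d * 2 ^ (?d + 3)) \<le> V * \<tau>" using \<tau>(2) V by (intro mult_left_mono) auto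
      then have "V * (2 * (real ?n + 1) * \<rho> ^ ?d) \<le> V * \<tau> / 2 ^ (?d + 3)"
        by (subst pos_le_divide_eq) (auto simp: mult_ac)
      then have "V * (2 * (real ?n + 1) * \<rho> ^ ?d) / \<tau> \<le> V / 2 ^ (?d + 3)"
        using \<tau>0 by (subst pos_divide_le_eq) (auto simp: mult_ac)
      moreover have "2 * ((real ?n + 1) / \<tau> * (\<rho> ^ ?d * V)) = V * (2 * (real ?n + 1) * \<rho> ^ ?d) / \<tau>"
        by (simp add: field_simps)
      ultimately show "2 * ((real ?n + 1) / \<tau> * (\<rho> ^ ?d * V)) \<le> V / 2 ^ (?d + 3)" by (simp only:)
    qed
    finally show ?thesis .
  qed
  define E where "E = ?Q - X"
  define F where "F = ?F - X"
  have Es: "E \<in> sets lebesgue" "E \<subseteq> ?Q" and Fs: "F \<in> sets lebesgue" "F \<subseteq> ?F"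
    using X by (auto simp: E_def F_def)
  have El: "E \<in> lmeasurable" by (rule lmeasurable_subset_ccube[OF Es])
  have Fl: "F \<in> lmeasurable" by (rule lmeasurable_subset_ccube[OF Fs])
  have large: "V / 2 \<le> measure lebesgue (Y - X)" "measure lebesgue (Y - X) \<le> V"
    if Y: "Y \<in> sets lebesgue" "emeasure lebesgue Y = ennreal V" for Y
  proof -
    have e: "emeasure lebesgue (Y - X) \<le> ennreal V" using emeasure_mono[of "Y - X" Y lebesgue] Y X by auto
    then have f: "emeasure lebesgue (Y - X) = ennreal (measure lebesgue (Y - X))"
      by (intro emeasure_eq_ennreal_measure) (auto simp: top_unique)
    show "measure lebesgue (Y - X) \<le> V" using e V unfolding f by (simp add: ennreal_le_iff)
    have "ennreal V = emeasure lebesgue ((Y - X) \<union> (Y \<inter> X))" using Y by (simp add: Un_Diff_Int)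
    also have "\<dots> \<le> emeasure lebesgue (Y - X) + emeasure lebesgue (Y \<inter> X)" using Y X by (intro emeasure_subadditive) auto
    also have "\<dots> \<le> ennreal (measure lebesgue (Y - X)) + ennreal (V / 2 ^ (?d + 3))"
      using Xm emeasure_mono[of "Y \<inter> X" X lebesgue] X f by (intro add_mono) (auto intro: order_trans)
    also have "\<dots> = ennreal (measure lebesgue (Y - X) + V / 2 ^ (?d + 3))" using V by (simp add: ennreal_plus)
    finally have "V \<le> measure lebesgue (Y - X) + V / 2 ^ (?d + 3)"
      by (subst (asm) ennreal_le_iff) (use V in auto)
    moreover have "V / 2 ^ (?d + 3) \<le> V / 2"
      using V power_increasing[of 1 "?d + 3" "2::real"] by (intro divide_left_mono) auto
    ultimately show "V / 2 \<le> measure lebesgue (Y - X)" by linarith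
  qed
  define mE where "mE = measure lebesgue E"
  have mE: "V / 2 \<le> mE" "mE \<le> V" unfolding mE_def E_def using large[OF _ vQ] by auto
  have mF: "V / 2 \<le> measure lebesgue F" unfolding F_def using large[OF _ vF] by auto
  have bm: "b \<in> borel_measurable lebesgue" using b by (simp add: locally_Lp_def)
  have fin: "finite_measure (lebesgue_on E)" by (rule finite_measure_lebesgue_on[OF El])
  have bM: "b \<in> borel_measurable (lebesgue_on E)" using bm by (rule measurable_restrict_space1)
  have bi: "integrable (lebesgue_on E) (\<lambda>y. norm (b y) ^ k)"
    using locally_Lp_cube[OF b Es] Es(1) by (subst integrable_restrict_space) auto
  define I where "I z = (\<integral>y. norm (z - b y) ^ k \<partial>(lebesgue_on E))" for z
  have I0: "0 \<le> I z" for z unfolding I_def by simp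
  define D where "D = (INF z. I z)"
  have bdd: "bdd_below (range I)" using I0 by (intro bdd_belowI[of _ 0]) auto
  have DI: "D \<le> I z" for z unfolding D_def by (rule cINF_lower[OF bdd]) simp
  \<comment> \<open>A positive bound even if \<open>D = 0\<close>, so that some moment lies
    strictly below \<open>2 Y\<close>.\<close>
  define Y where "Y = C1 * N * (W i / U) * V"
  have Y: "0 < Y" unfolding Y_def using C10 N(2) W[of i] U V by simp
  have DY: "D \<le> Y"
  proof (cases "0 < D")
    case False
    then show ?thesis using Y by simp
  next
    case True
    have "(INF z. I z) < 2 * D" using True by (simp add: D_def)
    then obtain a where a: "I a < 2 * D" using cInf_lessD[of "range I" "2 * D"] by auto
    have disj': "F \<inter> ?Q = {}" using disj Fs(2) by blast
    have const': "norm (K x y - \<kappa>) \<le> norm \<kappa> / 4" if "x \<in> F" "\<forall>j. y j \<in> ?Q" for x y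
      using const that Fs(2) by blast
    obtain f G where f: "f \<in> commutator_domain i k b" "\<And>j y. norm (f j y) \<le> indicator E y"
      and G: "G \<in> sets lebesgue" "G \<subseteq> F" "emeasure lebesgue F \<le> of_nat (Suc (norming_number k)) * emeasure lebesgue G"
      and lower: "AE x in lebesgue. x \<in> G \<longrightarrow> norm \<kappa> / 4 * measure lebesgue E ^ (?n - 1) * D \<le> norm (iterated_commutator i k b T f x)"
      using commutator_test_function[where i = i, OF K rep ext k b Es Fs(1) disj' const' True DI[unfolded I_def] less_imp_le[OF a, unfolded I_def]]
      by blast
    have Gl: "G \<in> lmeasurable" using lmeasurable_subset_ccube[OF G(1)] G(2) Fs(2) by blast
    define L where "L = real (Suc (norming_number k))"
    have L: "1 \<le> L" by (simp add: L_def)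
    have GF: "measure lebesgue F \<le> L * measure lebesgue G"
    proof -
      have "ennreal (measure lebesgue F) \<le> of_nat (Suc (norming_number k)) * ennreal (measure lebesgue G)"
        using G(3) Fl Gl by (simp only: emeasure_eq_measure2)
      also have "\<dots> = ennreal (L * measure lebesgue G)"
        unfolding L_def by (simp only: ennreal_of_nat_eq_real_of_nat) (rule ennreal_mult'[symmetric], simp)
      finally show ?thesis using L by (subst (asm) ennreal_le_iff) auto
    qed
    define mG where "mG = measure lebesgue G"
    have mG: "V / (2 * L) \<le> mG" using GF mF L unfolding mG_def by (simp add: field_simps)
    have mG0: "0 < mG" using mG V L by (smt (verit) divide_pos_pos)
    have inR: "x \<in> ?R \<and> x \<notin> B1 \<and> x \<notin> B2" if "x \<in> E \<or> x \<in> G" for x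
      using that G(2) subQ sub by (auto simp: E_def F_def X_def)
    define s where "s = norm \<kappa> / 4 * mE ^ (?n - 1) * D"
    have s0: "0 \<le> s" unfolding s_def using True mE V by simp
    have "s * U \<le> N * (\<tau> * H) ^ ?n * W i * (measure lebesgue E / measure lebesgue G) powr (1 / ?P)"
      by (rule test_function_bound[OF p wp \<mu>p N El Gl mG0[unfolded mG_def] f s0 lower[folded mE_def, folded s_def] W U H0 \<tau>0])
        (use inR W1 W2 U1 in blast)+
    also have "\<dots> \<le> N * (\<tau> * H) ^ ?n * W i * (2 * L) powr (1 / ?P)"
    proof (intro mult_left_mono powr_mono2)
      have "mE / mG \<le> V / (V / (2 * L))" using mE mG V L by (intro frac_le) auto
      then show "measure lebesgue E / measure lebesgue G \<le> 2 * L" using V by (simp add: mE_def mG_def)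
    qed (use P N(2) \<tau>0 H0 W[of i] in auto)
    finally have 1: "s * U \<le> N * (\<tau> * H) ^ ?n * W i * (2 * L) powr (1 / ?P)" .
    have "\<kappa>0 / (4 * 2 ^ (?n - 1) * V) * D \<le> s"
    proof -
      have "\<kappa>0 / (4 * 2 ^ (?n - 1) * V) = \<kappa>0 / V ^ ?n / 4 * (V / 2) ^ (?n - 1)"
      proof -
        have "V ^ ?n = V * V ^ (?n - 1)" by (simp add: power_eq_if)
        then show ?thesis using V by (simp add: power_divide field_simps)
      qed
      also have "\<dots> \<le> norm \<kappa> / 4 * mE ^ (?n - 1)"
        using \<kappa>0 V mE by (intro mult_mono power_mono) auto
      finally show ?thesis unfolding s_def using True by (intro mult_right_mono) auto
    qed
    then have "\<kappa>0 / (4 * 2 ^ (?n - 1) * V) * D * U \<le> s * U" using U by (intro mult_right_mono) auto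
    with 1 have "\<kappa>0 / (4 * 2 ^ (?n - 1) * V) * D * U \<le> N * (\<tau> * H) ^ ?n * W i * (2 * L) powr (1 / ?P)" by linarith
    moreover have "D \<le> 4 * m * Z * l' / \<kappa>0 * N * (Wi / U) * V"
      if "\<kappa>0 / (4 * m * V) * D * U \<le> N * Z * Wi * l'" "0 < m" for m Z Wi l'
    proof -
      have "D * (\<kappa>0 * U) = (\<kappa>0 / (4 * m * V) * D * U) * (4 * m * V)" using that(2) V by simp
      also have "\<dots> \<le> (N * Z * Wi * l') * (4 * m * V)" using that V by (intro mult_right_mono) auto
      finally have "D \<le> (N * Z * Wi * l') * (4 * m * V) / (\<kappa>0 * U)"
        using \<kappa>0(1) U by (subst pos_le_divide_eq) auto
      then show ?thesis by (simp add: mult_ac)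
    qed
    ultimately show ?thesis unfolding Y_def C1 L_def by simp
  qed
  have "(INF z. I z) < 2 * Y" using DY Y unfolding D_def by linarith
  then obtain \<alpha> where \<alpha>: "I \<alpha> < 2 * Y" using cInf_lessD[of "range I" "2 * Y"] by auto
  define g where "g = (W i / (\<tau> * H * U)) powr (1 / real k)"
  have g: "0 < g" unfolding g_def using W[of i] \<tau>0 H0 U by (simp add: less_imp_neq[symmetric])
  have g\<nu>: "g \<le> \<nu> x" if x: "x \<in> E" for x
  proof -
    have xR: "x \<in> ?R" "x \<notin> B1" "x \<notin> B2" using x subQ by (auto simp: E_def X_def)
    have "W i / (\<tau> * H * U) = (W i / \<tau>) / (H * U)" by (simp add: mult_ac)
    also have "\<dots> \<le> w i x powr (1 / p i) / \<mu> x powr (1 / p i)"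
      using W1[OF xR(1,2), of i] U2[OF xR(1,3)] W[of i] \<tau>0 \<mu>p[of x] by (intro frac_le) auto
    finally have "g \<le> (w i x powr (1 / p i) / \<mu> x powr (1 / p i)) powr (1 / real k)"
      unfolding g_def using W[of i] \<tau>0 H0 U by (intro powr_mono2) auto
    also have "\<dots> = (w i x powr (1 / p i)) powr (1 / real k) / (\<mu> x powr (1 / p i)) powr (1 / real k)"
      by (rule powr_divide)
    also have "\<dots> = w i x powr (1 / (real k * p i)) / \<mu> x powr (1 / (real k * p i))"
      by (simp only: powr_powr) (simp add: mult.commute)
    also have "\<dots> = \<nu> x" unfolding \<nu> by (simp add: powr_minus divide_inverse)
    finally show ?thesis .
  qed
  have aqg: "g / 2 \<le> aq"
  proof -
    have "ennreal (g * mE) = (\<integral>\<^sup>+x. ennreal g * indicator E x \<partial>lebesgue)"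
      using El g by (subst nn_integral_cmult_indicator) (auto simp: fmeasurableD emeasure_eq_measure2 ennreal_mult mE_def)
    also have "\<dots> \<le> weight_mass \<nu> ?Q" unfolding weight_mass_def
      by (rule nn_integral_mono) (use g\<nu> Es(2) in \<open>auto simp: indicator_def intro!: ennreal_leI\<close>)
    also have "\<dots> = ennreal (aq * V)" using aq V by (simp add: ennreal_mult)
    finally have "g * mE \<le> aq * V" using aq(2) V by (subst (asm) ennreal_le_iff) auto
    moreover have "g * (V / 2) \<le> g * mE" using g mE by (intro mult_left_mono) auto
    ultimately have "(g / 2) * V \<le> aq * V" by simp
    then show ?thesis using V by (rule mult_right_le_imp_le)
  qed
  \<comment> \<open>\<open>B\<close> is chosen so that \<open>t\<^sup>k\<close> exceeds \<open>2
    Y\<close> by the factor that Chebyshev needs for the proportion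
    \<open>2\<^sup>-\<^sup>d\<^sup>-\<^sup>3\<close>.\<close>
  define t where "t = B * g / 2"
  have Bp: "0 < 2 ^ (?d + 4) * C1 * \<tau> * H * N" using C10 \<tau>0 H0 N(2) by simp
  have "0 < (2 ^ (?d + 4) * C1 * \<tau> * H * N) powr (1 / real k)" using Bp by (metis less_irrefl powr_gt_zero)
  then have B0: "0 < B" unfolding B by (rule mult_pos_pos[OF zero_less_numeral])
  have t: "0 < t" using B0 g by (simp add: t_def)
  have tk: "t ^ k = 2 ^ (?d + 4) * Y / V"
  proof -
    have "t ^ k = ((2 ^ (?d + 4) * C1 * \<tau> * H * N) powr (1 / real k)) ^ k * ((W i / (\<tau> * H * U)) powr (1 / real k)) ^ k"
      unfolding t_def B g_def by (simp add: power_mult_distrib)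
    also have "\<dots> = 2 ^ (?d + 4) * C1 * \<tau> * H * N * (W i / (\<tau> * H * U))"
      using Bp k W[of i] \<tau>0 H0 U by (simp only: powr_inverse_power mult_pos_pos divide_pos_pos)
    also have "\<dots> = 2 ^ (?d + 4) * Y / V" unfolding Y_def using \<tau>0 H0 V by simp
    finally show ?thesis .
  qed
  have bad: "emeasure lebesgue {x \<in> E. t < norm (b x - \<alpha>)} \<le> ennreal (V / 2 ^ (?d + 3))"
  proof (rule Chebyshev_power[OF Es(1) bm _ t])
    show "integrable (lebesgue_on E) (\<lambda>y. norm (\<alpha> - b y) ^ k)" by (rule integrable_norm_shifted_power[OF fin bM bi])
    have "t ^ k * (V / 2 ^ (?d + 3)) = 2 * Y" unfolding tk using V by (simp add: power_add)
    then show "(\<integral>y. norm (\<alpha> - b y) ^ k \<partial>(lebesgue_on E)) \<le> t ^ k * (V / 2 ^ (?d + 3))" using \<alpha> unfolding I_def by linarith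
  qed
  have bads: "{x \<in> E. t < norm (b x - \<alpha>)} \<in> sets lebesgue"
  proof -
    have "{x \<in> space lebesgue. x \<in> E \<and> t < norm (b x - \<alpha>)} \<in> sets lebesgue" using bm Es(1) by measurable
    then show ?thesis by simp
  qed
  have "t \<le> B * aq" using mult_left_mono[OF aqg, of B] B0 by (simp add: t_def)
  then have "{x \<in> ?Q. B * aq < norm (b x - \<alpha>)} \<subseteq> X \<union> {x \<in> E. t < norm (b x - \<alpha>)}" by (auto simp: E_def)
  then have "emeasure lebesgue {x \<in> ?Q. B * aq < norm (b x - \<alpha>)} \<le> emeasure lebesgue (X \<union> {x \<in> E. t < norm (b x - \<alpha>)})"
    using X bads by (intro emeasure_mono) auto
  also have "\<dots> \<le> emeasure lebesgue X + emeasure lebesgue {x \<in> E. t < norm (b x - \<alpha>)}"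
    using X bads by (rule emeasure_subadditive)
  also have "\<dots> \<le> ennreal (V / 2 ^ (?d + 3)) + ennreal (V / 2 ^ (?d + 3))" using Xm bad by (rule add_mono)
  also have "\<dots> = ennreal (V / 2 ^ (?d + 2))"
    using V by (simp add: ennreal_plus[symmetric] power_add del: ennreal_plus)
  finally show ?thesis by blast
qed

lemma mean_oscillation:
  fixes b :: "'a::euclidean_space \<Rightarrow> complex"
  assumes b: "locally_Lp k b" "1 \<le> k" and r: "0 < r"
  shows "(\<integral>\<^sup>+x\<in>ccube c r. ennreal (norm (b x - mean (ccube c r) b)) \<partial>lebesgue)
    \<le> 2 * (\<integral>\<^sup>+x\<in>ccube c r. ennreal (norm (b x - \<alpha>)) \<partial>lebesgue)"
proof -
  let ?Q = "ccube c r"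
  let ?M = "lebesgue_on ?Q"
  have Qs: "?Q \<in> sets lebesgue" by simp
  have Ql: "?Q \<in> lmeasurable" unfolding ccube_def by simp
  have fin: "finite_measure ?M" by (rule finite_measure_lebesgue_on[OF Ql])
  have bm: "b \<in> borel_measurable lebesgue" using b(1) by (simp add: locally_Lp_def)
  have bM: "b \<in> borel_measurable ?M" using bm by (rule measurable_restrict_space1)
  have bk: "integrable ?M (\<lambda>y. norm (b y) ^ k)"
    using locally_Lp_cube[OF b(1) Qs order_refl] Qs by (subst integrable_restrict_space) auto
  have bi: "integrable ?M b"
  proof (rule integrable_of_power[OF fin bM bk bM])
    show "norm (b y) \<le> 1 * (1 + norm (b y) ^ k)" for y
    proof (cases "norm (b y) \<le> 1")
      case True then show ?thesis by (simp add: add_increasing2)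
    next
      case False
      then have "norm (b y) ^ 1 \<le> norm (b y) ^ k" using b(2) by (intro power_increasing) auto
      then show ?thesis by simp
    qed
  qed
  interpret finite_measure ?M by (rule fin)
  define v where "v = measure lebesgue ?Q"
  have v: "0 < v" unfolding v_def using emeasure_ccube[of r c] r by (simp add: measure_def)
  have vM: "measure ?M (space ?M) = v" unfolding v_def by (simp add: measure_restrict_space)
  define m where "m = mean ?Q b"
  have m: "m = (\<integral>x. b x \<partial>?M) / of_real v"
    unfolding m_def mean_def v_def set_lebesgue_integral_def by (subst integral_restrict_space) auto
  define J where "J = (\<integral>x. norm (b x - \<alpha>) \<partial>?M)"
  have "norm (m - \<alpha>) * v = norm ((m - \<alpha>) * of_real v)" using v by (simp add: norm_mult)
  also have "(m - \<alpha>) * of_real v = (\<integral>x. b x \<partial>?M) - of_real v * \<alpha>" unfolding m using v by (simp add: field_simps)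
  also have "\<dots> = (\<integral>x. b x - \<alpha> \<partial>?M)" using bi vM by (simp add: scaleR_conv_of_real)
  also have "norm \<dots> \<le> J" unfolding J_def by (rule integral_norm_bound)
  finally have mv: "norm (m - \<alpha>) * v \<le> J" .
  have "(\<integral>x. norm (b x - m) \<partial>?M) \<le> (\<integral>x. norm (b x - \<alpha>) + norm (m - \<alpha>) \<partial>?M)"
  proof (rule integral_mono)
    show "norm (b x - m) \<le> norm (b x - \<alpha>) + norm (m - \<alpha>)" for x
      using norm_triangle_ineq4[of "b x - \<alpha>" "m - \<alpha>"] by simp
  qed (use bi in auto)
  also have "\<dots> = J + norm (m - \<alpha>) * v" unfolding J_def using bi vM by simp
  also have "\<dots> \<le> 2 * J" using mv by simp
  finally have le: "(\<integral>x. norm (b x - m) \<partial>?M) \<le> 2 * J" .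
  have conv: "(\<integral>\<^sup>+x\<in>?Q. ennreal (norm (b x - z)) \<partial>lebesgue) = ennreal (\<integral>x. norm (b x - z) \<partial>?M)" for z
  proof -
    have "(\<integral>\<^sup>+x\<in>?Q. ennreal (norm (b x - z)) \<partial>lebesgue) = (\<integral>\<^sup>+x. ennreal (norm (b x - z)) \<partial>?M)"
      by (subst nn_integral_restrict_space) auto
    also have "\<dots> = ennreal (\<integral>x. norm (b x - z) \<partial>?M)" by (rule nn_integral_eq_integral) (use bi in auto)
    finally show ?thesis .
  qed
  have "ennreal (\<integral>x. norm (b x - m) \<partial>?M) \<le> ennreal (2 * J)" by (rule ennreal_leI[OF le])
  also have "\<dots> = 2 * ennreal J" by (simp add: ennreal_mult' J_def)
  finally show ?thesis unfolding conv J_def m_def .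
qed

lemma BMO_norm_le:
  fixes b :: "'a::euclidean_space \<Rightarrow> complex"
  assumes \<nu>: "in_Ainf \<nu>" "Ainf_const \<nu> \<le> ennreal A" and b: "locally_Lp k b" "1 \<le> k" and B: "0 \<le> B" and A: "0 \<le> A"
    and osc: "\<And>c r a. 0 < r \<Longrightarrow> 0 \<le> a \<Longrightarrow> ennreal a * ennreal ((2 * r) ^ DIM('a)) = weight_mass \<nu> (ccube c r) \<Longrightarrow>
      \<exists>\<alpha>. emeasure lebesgue {x \<in> ccube c r. B * a < norm (b x - \<alpha>)} \<le> ennreal ((2 * r) ^ DIM('a) / 2 ^ (DIM('a) + 2))"
  shows "BMO_norm \<nu> b \<le> ennreal (8 * B * A)"
proof -
  have w: "weight \<nu>" using \<nu>(1) by (simp add: in_Ainf_def)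
  have bm: "b \<in> borel_measurable lebesgue" using b(1) by (simp add: locally_Lp_def)
  have mass: "weight_mass \<nu> (ccube (fst q) (snd q)) = weight_mass \<nu> (cell q)" for q :: "'a \<times> real"
    unfolding weight_mass_def by (rule nn_integral_ccube_cell)
  \<comment> \<open>The absolute value keeps \<open>a\<close> nonnegative also at pairs
    \<open>q\<close> with negative second component.\<close>
  define a where "a q = enn2real (weight_mass \<nu> (cell q)) / \<bar>vol q\<bar>" for q :: "'a \<times> real"
  have a0: "0 \<le> a q" for q by (simp add: a_def)
  have a1: "ennreal (a q) * ennreal (vol q) = weight_mass \<nu> (cell q)" if "0 < snd q" for q
  proof -
    have "weight_mass \<nu> (cell q) < \<infinity>" by (rule weight_mass_finite[OF w cell_subset_ccube])
    then have "weight_mass \<nu> (cell q) = ennreal (enn2real (weight_mass \<nu> (cell q)))" by simp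
    then show ?thesis using vol_pos[OF that] by (simp add: a_def ennreal_mult[symmetric])
  qed
  have "\<exists>\<alpha>. emeasure lebesgue {x \<in> cell q. B * a q < norm (b x - \<alpha>)} \<le> ennreal (vol q / 2 ^ (DIM('a) + 2))"
    if q: "0 < snd q" for q
  proof -
    have "ennreal (a q) * ennreal ((2 * snd q) ^ DIM('a)) = weight_mass \<nu> (ccube (fst q) (snd q))"
      using a1[OF q] by (simp add: mass vol_def)
    from osc[OF q a0 this] obtain \<alpha> where
      \<alpha>: "emeasure lebesgue {x \<in> ccube (fst q) (snd q). B * a q < norm (b x - \<alpha>)} \<le> ennreal (vol q / 2 ^ (DIM('a) + 2))"
      unfolding vol_def by blast
    have "{x \<in> space lebesgue. x \<in> ccube (fst q) (snd q) \<and> B * a q < norm (b x - \<alpha>)} \<in> sets lebesgue" using bm by measurable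
    then have "emeasure lebesgue {x \<in> cell q. B * a q < norm (b x - \<alpha>)} \<le> emeasure lebesgue {x \<in> ccube (fst q) (snd q). B * a q < norm (b x - \<alpha>)}"
      using cell_subset_ccube[of q] by (intro emeasure_mono) auto
    then show ?thesis using \<alpha> order_trans by blast
  qed
  then obtain \<alpha> where \<alpha>: "\<And>q. 0 < snd q \<Longrightarrow> emeasure lebesgue {x \<in> cell q. B * a q < norm (b x - \<alpha> q)} \<le> ennreal (vol q / 2 ^ (DIM('a) + 2))"
    by metis
  show ?thesis unfolding BMO_norm_def
  proof (rule SUP_least)
    fix Q :: "'a set" assume "Q \<in> cubes"
    then obtain c r where Q: "Q = ccube c r" and r: "0 < r" by (auto simp: cubes_eq)
    define q where "q = (c, r)"
    have q: "0 < snd q" "Q = ccube (fst q) (snd q)" using r Q by (simp_all add: q_def)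
    have "(\<integral>\<^sup>+x\<in>Q. ennreal (norm (b x - mean Q b)) \<partial>lebesgue) \<le> 2 * (\<integral>\<^sup>+x\<in>Q. ennreal (norm (b x - \<alpha> q)) \<partial>lebesgue)"
      unfolding Q by (rule mean_oscillation[OF b r])
    also have "(\<integral>\<^sup>+x\<in>Q. ennreal (norm (b x - \<alpha> q)) \<partial>lebesgue) = (\<integral>\<^sup>+x\<in>cell q. ennreal (norm (b x - \<alpha> q)) \<partial>lebesgue)"
      unfolding q(2) by (rule nn_integral_ccube_cell)
    also have "2 * \<dots> \<le> 2 * (ennreal (4 * B) * (ennreal A * weight_mass \<nu> (cell q)))"
      by (intro mult_left_mono sparse_oscillation_bound[OF w \<nu>(2) bm B a1 a0 \<alpha> q(1)]) auto
    also have "\<dots> = ennreal (8 * B * A) * weight_mass \<nu> Q"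
    proof -
      have "2 * (ennreal (4 * B) * (ennreal A * M)) = ennreal (8 * B * A) * M" for M
      proof -
        have "ennreal (8 * B * A) = ennreal 2 * (ennreal (4 * B) * ennreal A)"
          using A B by (simp add: ennreal_mult[symmetric] del: ennreal_numeral)
        then show ?thesis by (simp add: mult.assoc)
      qed
      then show ?thesis by (simp add: q(2) mass)
    qed
    finally have "(\<integral>\<^sup>+x\<in>Q. ennreal (norm (b x - mean Q b)) \<partial>lebesgue) / weight_mass \<nu> Q \<le> ennreal (8 * B * A) * weight_mass \<nu> Q / weight_mass \<nu> Q"
      by (rule divide_right_mono_ennreal)
    also have "\<dots> \<le> ennreal (8 * B * A)"
    proof (cases "weight_mass \<nu> Q = 0")
      case False
      moreover have "weight_mass \<nu> Q \<noteq> \<infinity>" using weight_mass_finite[OF w, of Q c r] Q by (simp add: less_top)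
      ultimately show ?thesis by (simp add: ennreal_mult_divide_eq)
    qed simp
    finally show "(\<integral>\<^sup>+x\<in>Q. ennreal (norm (b x - mean Q b)) \<partial>lebesgue) / weight_mass \<nu> Q \<le> ennreal (8 * B * A)" .
  qed
qed

text \<open>
  For parameters without any non-degenerate operator the theorem is vacuous; this lemma isolates
  those with \<open>C \<le> 0\<close>, for which the choice of \<open>\<Lambda>\<close> would
  make no sense.
\<close>

lemma kernel_constant_pos:
  fixes K :: "'a::euclidean_space \<Rightarrow> ('n::finite \<Rightarrow> 'a) \<Rightarrow> complex"
  assumes "kernel_size C K" "kernel_nondegenerate c K" "0 < c"
  shows "0 < C"
proof -
  obtain x :: 'a where x: "x \<notin> ball 0 1" "c / 1 ^ (CARD('n) * DIM('a)) \<le> norm (K x (\<lambda>_. 0))"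
    using assms(2) unfolding kernel_nondegenerate_def by (metis zero_less_one)
  have x0: "x \<noteq> 0" using x(1) by auto
  then have "off_diag x (\<lambda>_::'n. 0)" by (auto simp: off_diag_def)
  then have "norm (K x (\<lambda>_. 0)) \<le> C / kernel_dist x (\<lambda>_::'n. 0) ^ (CARD('n) * DIM('a))"
    using assms(1) unfolding kernel_size_def by blast
  then have "0 < C / kernel_dist x (\<lambda>_::'n. 0) ^ (CARD('n) * DIM('a))" using x(2) assms(3) by simp
  moreover have "0 < kernel_dist x (\<lambda>_::'n. 0)" using x0 by (simp add: kernel_dist_def)
  ultimately show ?thesis by (simp add: zero_less_divide_iff)
qed

theorem theorem1p6:
  fixes p :: "'n::finite \<Rightarrow> real" and i :: 'n and k :: nat
    and C\<^sub>T c\<^sub>T A :: real and \<omega> :: "real \<Rightarrow> real"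
  assumes "1 \<le> k" and "\<And>j. 1 < p j"
  shows "\<exists>C>0. \<forall>(T :: ('n, 'a::euclidean_space) operator) (b :: 'a \<Rightarrow> complex)
            (w :: 'n \<Rightarrow> 'a \<Rightarrow> real) (\<mu> :: 'a \<Rightarrow> real) (\<nu> :: 'a \<Rightarrow> real).
           nondegenerate_CZO C\<^sub>T \<omega> c\<^sub>T T \<and> off_support_extension T \<and>
           locally_Lp k b \<and>
           in_Ap p w \<and> Ap_const p w \<le> ennreal A \<and>
           in_Ap p (w(i := \<mu>)) \<and> Ap_const p (w(i := \<mu>)) \<le> ennreal A \<and>
           \<nu> = (\<lambda>x. w i x powr (1 / (real k * p i)) * \<mu> x powr (- 1 / (real k * p i))) \<and>
           in_Ainf \<nu> \<and> Ainf_const \<nu> \<le> ennreal A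
           \<longrightarrow> BMO_norm \<nu> b ^ k
               \<le> ennreal C *
                 operator_norm (commutator_domain i k b) p w
                   (total_exp p)
                   (\<lambda>x. \<mu> x powr (total_exp p / p i) *
                        (\<Prod>j\<in>UNIV - {i}. w j x powr (total_exp p / p j)))
                   (iterated_commutator i k b T)"
proof (cases "0 < C\<^sub>T \<and> 0 < c\<^sub>T \<and> modulus \<omega>")
  case False
  have "\<not> nondegenerate_CZO C\<^sub>T \<omega> c\<^sub>T T" for T :: "('n, 'a) operator"
    using False kernel_constant_pos unfolding nondegenerate_CZO_def by blast
  then show ?thesis by (intro exI[of _ 1]) simp
next
  case True
  then have C: "0 < C\<^sub>T" and c: "0 < c\<^sub>T" and \<omega>: "modulus \<omega>" by auto
  let ?n = "CARD('n)" and ?d = "DIM('a)" and ?P = "total_exp p"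
  obtain \<Lambda> \<rho> where \<Lambda>: "0 < \<Lambda>" and \<rho>: "1 \<le> \<rho>" and geo: "\<And>(K :: 'a \<Rightarrow> ('n \<Rightarrow> 'a) \<Rightarrow> complex) y0 l.
     kernel_size C\<^sub>T K \<Longrightarrow> kernel_regular C\<^sub>T \<omega> K \<Longrightarrow> kernel_nondegenerate c\<^sub>T K \<Longrightarrow> 0 < l \<Longrightarrow>
     (\<exists>x0 \<kappa>. c\<^sub>T / (\<Lambda> * l) ^ (?n * ?d) \<le> norm \<kappa> \<and> ccube x0 l \<inter> ccube y0 l = {} \<and> ccube x0 l \<subseteq> ccube y0 (\<rho> * l) \<and>
        (\<forall>x\<in>ccube x0 l. \<forall>y. (\<forall>j. y j \<in> ccube y0 l) \<longrightarrow> norm (K x y - \<kappa>) \<le> norm \<kappa> / 4))"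
    using kernel_almost_constant[OF C c \<omega>, where 'a = 'a and 'n = 'n] by blast
  \<comment> \<open>The bound \<open>A\<close> enters through powers and has to be
    positive.\<close>
  define A' where "A' = max A 1"
  have A': "0 < A'" "A \<le> A'" by (auto simp: A'_def)
  \<comment> \<open>The lower bound of the kernel in terms of the volume \<open>(2
    l)\<^sup>d\<close> of the cube instead of \<open>\<Lambda> l\<close>.\<close>
  define \<kappa>0 where "\<kappa>0 = c\<^sub>T * (2 / \<Lambda>) ^ (?n * ?d)"
  have \<kappa>0: "0 < \<kappa>0" using c \<Lambda> by (simp add: \<kappa>0_def)
  \<comment> \<open>The exceptional sets live in a cube with \<open>\<rho>\<^sup>d\<close> times
    the volume, and may fill only \<open>2\<^sup>-\<^sup>d\<^sup>-\<^sup>3\<close> of the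
    original one.\<close>
  define \<tau> where "\<tau> = max 1 (2 * (real ?n + 1) * \<rho> ^ ?d * 2 ^ (?d + 3))"
  have \<tau>: "1 \<le> \<tau>" "2 * (real ?n + 1) * \<rho> ^ ?d * 2 ^ (?d + 3) \<le> \<tau>" by (auto simp: \<tau>_def)
  define H where "H = \<tau> ^ ?n * A' powr (1 / ?P)"
  have H: "0 < H" using \<tau> A' by (simp add: H_def)
  define C1 where "C1 = 4 * 2 ^ (?n - 1) * (\<tau> * H) ^ ?n * (2 * real (Suc (norming_number k))) powr (1 / ?P) / \<kappa>0"
  have C1: "0 < C1" unfolding C1_def using \<tau> H \<kappa>0 by (intro divide_pos_pos mult_pos_pos) auto
  define C3 where "C3 = 2 ^ (?d + 4) * C1 * \<tau> * H"
  have C3: "0 < C3" unfolding C3_def using \<tau> H C1 by simp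
  define C4 where "C4 = (16 * A') ^ k * C3"
  have C4: "0 < C4" unfolding C4_def using C3 A' by simp
  have main: "BMO_norm \<nu> b ^ k \<le> ennreal C4 * ennreal N"
    if T: "nondegenerate_CZO C\<^sub>T \<omega> c\<^sub>T T" "off_support_extension T" and b: "locally_Lp k b"
      and w: "in_Ap p w" "Ap_const p w \<le> ennreal A" and w': "in_Ap p (w(i := \<mu>))" "Ap_const p (w(i := \<mu>)) \<le> ennreal A"
      and \<nu>: "\<nu> = (\<lambda>x. w i x powr (1 / (real k * p i)) * \<mu> x powr (- 1 / (real k * p i)))"
      and \<nu>A: "in_Ainf \<nu>" "Ainf_const \<nu> \<le> ennreal A"
      and N: "operator_norm (commutator_domain i k b) p w ?P
       (\<lambda>x. \<mu> x powr (?P / p i) * (\<Prod>j\<in>UNIV - {i}. w j x powr (?P / p j))) (iterated_commutator i k b T) < ennreal N" "0 < N"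
    for T :: "('n, 'a) operator" and b w \<mu> \<nu> N
  proof -
    obtain K where K: "kernel_size C\<^sub>T K" "kernel_regular C\<^sub>T \<omega> K" "kernel_represents K T" "kernel_nondegenerate c\<^sub>T K"
      using T(1) unfolding nondegenerate_CZO_def by blast
    have le: "x \<le> ennreal A \<Longrightarrow> x \<le> ennreal A'" for x using A'(2) ennreal_leI order_trans by blast
    define B where "B = 2 * (C3 * N) powr (1 / real k)"
    have B0: "0 \<le> B" by (simp add: B_def)
    have "BMO_norm \<nu> b \<le> ennreal (8 * B * A')"
    proof (rule BMO_norm_le[OF \<nu>A(1) le[OF \<nu>A(2)] b assms(1) B0 less_imp_le[OF A'(1)]])
      fix y0 :: 'a and l aq :: real
      assume l: "0 < l" and aq: "0 \<le> aq" "ennreal aq * ennreal ((2 * l) ^ ?d) = weight_mass \<nu> (ccube y0 l)"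
      obtain x0 \<kappa> where g: "c\<^sub>T / (\<Lambda> * l) ^ (?n * ?d) \<le> norm \<kappa>" "ccube x0 l \<inter> ccube y0 l = {}" "ccube x0 l \<subseteq> ccube y0 (\<rho> * l)"
        "\<forall>x\<in>ccube x0 l. \<forall>y. (\<forall>j. y j \<in> ccube y0 l) \<longrightarrow> norm (K x y - \<kappa>) \<le> norm \<kappa> / 4"
        using geo[OF K(1,2,4) l, of y0] by blast
      have "\<kappa>0 / ((2 * l) ^ ?d) ^ ?n = c\<^sub>T / (\<Lambda> * l) ^ (?n * ?d)"
      proof -
        have "\<kappa>0 / ((2 * l) ^ ?d) ^ ?n = c\<^sub>T * ((2 / \<Lambda>) ^ (?n * ?d) / (2 * l) ^ (?n * ?d))"
        proof -
          have "((2 * l) ^ ?d) ^ ?n = (2 * l) ^ (?n * ?d)" by (simp only: power_mult[symmetric] mult.commute)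
          then show ?thesis unfolding \<kappa>0_def by simp
        qed
        also have "(2 / \<Lambda>) ^ (?n * ?d) / (2 * l) ^ (?n * ?d) = (1 / (\<Lambda> * l)) ^ (?n * ?d)"
        proof -
          have "(2 / \<Lambda>) ^ (?n * ?d) / (2 * l) ^ (?n * ?d) = ((2 / \<Lambda>) / (2 * l)) ^ (?n * ?d)" by (simp only: power_divide)
          also have "(2 / \<Lambda>) / (2 * l) = 1 / (\<Lambda> * l)" by simp
          finally show ?thesis .
        qed
        finally show ?thesis by (simp add: power_divide)
      qed
      with g(1) have k0: "\<kappa>0 / ((2 * l) ^ ?d) ^ ?n \<le> norm \<kappa>" by simp
      show "\<exists>\<alpha>. emeasure lebesgue {x \<in> ccube y0 l. B * aq < norm (b x - \<alpha>)} \<le> ennreal ((2 * l) ^ ?d / 2 ^ (?d + 2))"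
        by (rule local_oscillation[OF assms(2) assms(1) K(2) \<omega> less_imp_le[OF C] K(3) T(2) b w(1) le[OF w(2)] w'(1) le[OF w'(2)] A'(1) \<nu>
            l refl \<kappa>0 k0 g(2,3) \<rho> g(4) \<tau> N H_def C1_def B_def[unfolded C3_def] aq(2,1)])
    qed
    then have "BMO_norm \<nu> b ^ k \<le> ennreal (8 * B * A') ^ k" by (rule power_mono) simp
    also have "\<dots> = ennreal ((8 * B * A') ^ k)" using B0 A' by (simp add: ennreal_power)
    also have "(8 * B * A') ^ k = (16 * A') ^ k * ((C3 * N) powr (1 / real k)) ^ k"
    proof -
      have "8 * B * A' = (16 * A') * (C3 * N) powr (1 / real k)" unfolding B_def by simp
      then show ?thesis by (simp only: power_mult_distrib)
    qed
    also have "\<dots> = C4 * N" using C3 N(2) assms(1) by (simp add: C4_def powr_inverse_power)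
    also have "ennreal (C4 * N) = ennreal C4 * ennreal N" using C4 by (simp add: ennreal_mult')
    finally show ?thesis .
  qed
  show ?thesis
  proof (intro exI[of _ C4] conjI C4 allI impI)
    fix T :: "('n, 'a) operator" and b :: "'a \<Rightarrow> complex" and w :: "'n \<Rightarrow> 'a \<Rightarrow> real" and \<mu> \<nu> :: "'a \<Rightarrow> real"
    let ?O = "operator_norm (commutator_domain i k b) p w ?P
       (\<lambda>x. \<mu> x powr (?P / p i) * (\<Prod>j\<in>UNIV - {i}. w j x powr (?P / p j))) (iterated_commutator i k b T)"
    assume a: "nondegenerate_CZO C\<^sub>T \<omega> c\<^sub>T T \<and> off_support_extension T \<and>
           locally_Lp k b \<and>
           in_Ap p w \<and> Ap_const p w \<le> ennreal A \<and>
           in_Ap p (w(i := \<mu>)) \<and> Ap_const p (w(i := \<mu>)) \<le> ennreal A \<and>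
           \<nu> = (\<lambda>x. w i x powr (1 / (real k * p i)) * \<mu> x powr (- 1 / (real k * p i))) \<and>
           in_Ainf \<nu> \<and> Ainf_const \<nu> \<le> ennreal A"
    have bound: "BMO_norm \<nu> b ^ k \<le> ennreal C4 * ennreal N" if "?O < ennreal N" "0 < N" for N
      by (rule main[of T b w \<mu> \<nu> N]) (use a that in blast)+
    show "BMO_norm \<nu> b ^ k \<le> ennreal C4 * ?O"
    proof (cases ?O)
      case top
      then show ?thesis using C4 by (simp add: ennreal_mult_top)
    next
      case (real x)
      show ?thesis
      proof (rule ennreal_le_epsilon)
        fix e :: real assume e: "0 < e"
        have "?O < ennreal (x + e / C4)" unfolding real(2) using real(1) e C4 by (intro ennreal_lessI) (auto intro: add_nonneg_pos)
        then have "BMO_norm \<nu> b ^ k \<le> ennreal C4 * ennreal (x + e / C4)"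
          by (rule bound) (use real(1) e C4 in \<open>auto intro: add_nonneg_pos\<close>)
        also have "\<dots> = ennreal (C4 * x + e)" using C4 by (simp add: ennreal_mult'[symmetric] distrib_left)
        also have "\<dots> = ennreal C4 * ?O + ennreal e" unfolding real(2) using real(1) C4 e by (simp add: ennreal_mult ennreal_plus)
        finally show "BMO_norm \<nu> b ^ k \<le> ennreal C4 * ?O + ennreal e" .
      qed
    qed
  qed
qed

end
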